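(* Let $(X,\sigma)$ be a (one-sided or two-sided) shift space on a finite alphabet, let $m$ be a Borel probability measure on $X$, and let $\varphi\colon X\to\mathbb{R}$ be a continuous function. Let $\mathcal{L}$ be the language of $X$. Suppose there exists a set $\mathcal{G}\subset\mathcal{L}$ such that (1) there exists $\tau>0$ such that for every $v,w\in\mathcal{G}$ there exists $u\in\mathcal{L}$ with $|u|\le\tau$ such that $vuw\in\mathcal{G}$; (2) $\mathcal{L}$ is edit approachable by $\mathcal{G}$; (3) $m$ is Gibbs for $\varphi$ with respect to $\mathcal{G}$. Then $(X,\sigma)$ satisfies a level-2 large deviations principle with reference measure $m$ and rate function $q^\varphi\colon\mathcal{M}(X)\to[-\infty,0]$ given by $$q^\varphi(\mu)=\begin{cases} h(\mu)+\int\varphi\,d\mu-P(\varphi) & \text{if }\mu\in\mathcal{M}_\sigma(X),\\ -\infty & \text{otherwise.}\end{cases}$$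
   Context: Shifts. Let $A$ be a finite set; $A^{\mathbb{N}}$ (one-sided sequences $x_1x_2\cdots$) and $A^{\mathbb{Z}}$ carry the metric $d(x,y)=2^{-t(x,y)}$, $t(x,y)=\min\{|k| : x_k\ne y_k\}$, and $\sigma$ is the left shift. A shift space (subshift) is a closed $\sigma$-invariant set $X\subset A^{\mathbb{N}}$ or $X\subset A^{\mathbb{Z}}$. Words. For a finite word $w=w_1\cdots w_n$ over $A$, $|w|=n$ is its length and $[w]=\{x\in X : x_1\cdots x_n=w\}$. The language of $X$ is $\mathcal{L}=\{w\in A^* : [w]\ne\emptyset\}$, where $A^*=\bigcup_{n\ge0}A^n$; $\mathcal{D}_n=\{w\in\mathcal{D}:|w|=n\}$ for $\mathcal{D}\subset\mathcal{L}$. Juxtaposition denotes concatenation. Edit approachability. An edit of a word is one of: substituting one symbol by another, inserting one symbol at any position, or deleting one symbol. The edit distance $\hat d(v,w)$ is the minimum number of edits needed to transform $v$ into $w$ (intermediate words may be arbitrary words over $A$). A mistake function is a non-decreasing $g\colon\mathbb{N}\to\mathbb{N}$ with $g(n)/n\to0$. $\mathcal{L}$ is edit approachable by $\mathcal{G}\subset\mathcal{L}$ if there is a mistake function $g$ such that for every $w\in\mathcal{L}$ there is $v\in\mathcal{G}$ with $\hat d(v,w)\le g(|w|)$. Pressure and Gibbs property. $S_n\varphi(x)=\sum_{k=0}^{n-1}\varphi(\sigma^kx)$ and $P(\varphi)=\varlimsup_{n\to\infty}\frac1n\log\sum_{w\in\mathcal{L}_n}e^{\sup_{x\in[w]}S_n\varphi(x)}$.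 The measure $m$ is Gibbs for $\varphi$ with respect to $\mathcal{G}$ if there are constants $K,K'>0$ such that $m[x_1\cdots x_n]\le K'e^{-nP(\varphi)+S_n\varphi(x)}$ for every $x\in X$ and $n\in\mathbb{N}$, and $m[x_1\cdots x_n]\ge Ke^{-nP(\varphi)+S_n\varphi(x)}$ whenever $x\in X$, $n\in\mathbb{N}$ are such that $x_1\cdots x_n\in\mathcal{G}$. Measures. $\mathcal{M}(X)$ is the set of Borel probability measures on $X$ with the weak* topology, $\mathcal{M}_\sigma(X)$ the subset of $\sigma$-invariant measures, and $h(\mu)=\lim_{n\to\infty}\frac1n\sum_{w\in\mathcal{L}_n}-\mu[w]\log\mu[w]$ for $\mu\in\mathcal{M}_\sigma(X)$. Large deviations. Let $\mathcal{E}_n(x)=\frac1n\sum_{j=0}^{n-1}\delta_{\sigma^jx}$. $(X,\sigma)$ satisfies a level-2 large deviations principle with reference measure $m$ and rate function $q\colon\mathcal{M}(X)\to[-\infty,0]$ if $q$ is upper semicontinuous, $\varliminf_{n\to\infty}\frac1n\log m(\{x\in X:\mathcal{E}_n(x)\in U\})\ge\sup_{\mu\in U}q(\mu)$ for every open $U\subset\mathcal{M}(X)$, and $\varlimsup_{n\to\infty}\frac1n\log m(\{x\in X:\mathcal{E}_n(x)\in F\})\le\sup_{\mu\in F}q(\mu)$ for every closed $F\subset\mathcal{M}(X)$. *)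

theory Defs
  imports "HOL-Probability.Probability"
begin

section \<open>Shift spaces\<close>

text \<open>
  A sequence over \<open>A\<close> is an extensional function in \<open>I \<rightarrow>\<^sub>E A\<close>, where the index set is
  \<open>I = {1..}\<close> for one-sided sequences \<open>x\<^sub>1x\<^sub>2\<dots>\<close> and \<open>I = UNIV\<close> for two-sided ones.
\<close>

definition left_shift :: "int set \<Rightarrow> (int \<Rightarrow> 'a) \<Rightarrow> (int \<Rightarrow> 'a)" where
  "left_shift I x = restrict (\<lambda>k. x (k + 1)) I"

definition seq_dist :: "int set \<Rightarrow> (int \<Rightarrow> 'a) \<Rightarrow> (int \<Rightarrow> 'a) \<Rightarrow> real" where
  "seq_dist I x y =
     (if x = y then 0 else (1/2) ^ (LEAST t. \<exists>k\<in>I. nat \<bar>k\<bar> = t \<and> x k \<noteq> y k))"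

lemma Metric_space_seq_dist: "Metric_space (I \<rightarrow>\<^sub>E A) (seq_dist I)"
proof
  show "0 \<le> seq_dist I x y" for x y :: "int \<Rightarrow> 'a"
    by (simp add: seq_dist_def)
  show "seq_dist I x y = seq_dist I y x" for x y :: "int \<Rightarrow> 'a"
    by (auto simp: seq_dist_def eq_commute[of "x _"])
  show "seq_dist I x y = 0 \<longleftrightarrow> x = y" for x y :: "int \<Rightarrow> 'a"
    by (simp add: seq_dist_def)
next
  fix x y z :: "int \<Rightarrow> 'a"
  assume xyz: "x \<in> I \<rightarrow>\<^sub>E A" "y \<in> I \<rightarrow>\<^sub>E A" "z \<in> I \<rightarrow>\<^sub>E A"
  let ?D = "\<lambda>u v t. \<exists>k\<in>I. nat \<bar>k\<bar> = t \<and> u k \<noteq> v k"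
  have nonneg: "0 \<le> seq_dist I u v" for u v :: "int \<Rightarrow> 'a"
    by (simp add: seq_dist_def)
  have lower: "(1/2) ^ t \<le> seq_dist I u v" if "?D u v t" for u v :: "int \<Rightarrow> 'a" and t
  proof -
    have "(LEAST t. ?D u v t) \<le> t" by (rule Least_le) (rule that)
    then show ?thesis using that by (auto simp: seq_dist_def intro!: power_decreasing)
  qed
  show "seq_dist I x z \<le> seq_dist I x y + seq_dist I y z"
  proof (cases "x = z")
    case True
    then show ?thesis using nonneg[of x y] nonneg[of y z] by (simp add: seq_dist_def)
  next
    case False
    then obtain k where "k \<in> I" "x k \<noteq> z k"
      using xyz by (metis PiE_ext)
    then have "\<exists>t. ?D x z t" by blast
    then have D: "?D x z (LEAST t. ?D x z t)" by (rule LeastI_ex)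
    have eq: "seq_dist I x z = (1/2) ^ (LEAST t. ?D x z t)"
      using False by (simp add: seq_dist_def)
    from D have "?D x y (LEAST t. ?D x z t) \<or> ?D y z (LEAST t. ?D x z t)" by metis
    then show ?thesis
      unfolding eq using lower nonneg by (smt (verit))
  qed
qed

definition full_shift_topology :: "int set \<Rightarrow> 'a set \<Rightarrow> (int \<Rightarrow> 'a) topology" where
  "full_shift_topology I A = Metric_space.mtopology (I \<rightarrow>\<^sub>E A) (seq_dist I)"

text \<open>Invariance means \<open>\<sigma>(X) \<subseteq> X\<close> in both cases; \<open>\<sigma>(X) = X\<close> is not required.\<close>

definition subshift :: "int set \<Rightarrow> 'a set \<Rightarrow> (int \<Rightarrow> 'a) set \<Rightarrow> bool" where
  "subshift I A X \<longleftrightarrow> closedin (full_shift_topology I A) X \<and> left_shift I ` X \<subseteq> X"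

definition shift_topology :: "int set \<Rightarrow> 'a set \<Rightarrow> (int \<Rightarrow> 'a) set \<Rightarrow> (int \<Rightarrow> 'a) topology" where
  "shift_topology I A X = subtopology (full_shift_topology I A) X"

section \<open>Words\<close>

definition initial_word :: "(int \<Rightarrow> 'a) \<Rightarrow> nat \<Rightarrow> 'a list" where
  "initial_word x n = map x [1..int n]"

definition cylinder :: "(int \<Rightarrow> 'a) set \<Rightarrow> 'a list \<Rightarrow> (int \<Rightarrow> 'a) set" where
  "cylinder X w = {x \<in> X. initial_word x (length w) = w}"

definition language :: "'a set \<Rightarrow> (int \<Rightarrow> 'a) set \<Rightarrow> 'a list set" where
  "language A X = {w \<in> lists A. cylinder X w \<noteq> {}}"

definition language_n :: "'a set \<Rightarrow> (int \<Rightarrow> 'a) set \<Rightarrow> nat \<Rightarrow> 'a list set" where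
  "language_n A X n = {w \<in> language A X. length w = n}"

section \<open>Edit approachability\<close>

inductive edit :: "'a set \<Rightarrow> 'a list \<Rightarrow> 'a list \<Rightarrow> bool" for A :: "'a set" where
  substitute: "b \<in> A \<Longrightarrow> b \<noteq> a \<Longrightarrow> edit A (xs @ [a] @ ys) (xs @ [b] @ ys)"
| insert: "b \<in> A \<Longrightarrow> edit A (xs @ ys) (xs @ [b] @ ys)"
| delete: "edit A (xs @ [a] @ ys) (xs @ ys)"

definition edit_dist :: "'a set \<Rightarrow> 'a list \<Rightarrow> 'a list \<Rightarrow> nat" where
  "edit_dist A v w = (LEAST n. (edit A ^^ n) v w)"

definition mistake_function :: "(nat \<Rightarrow> nat) \<Rightarrow> bool" where
  "mistake_function g \<longleftrightarrow> mono g \<and> (\<lambda>n. real (g n) / real n) \<longlonglongrightarrow> 0"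

definition edit_approachable :: "'a set \<Rightarrow> 'a list set \<Rightarrow> 'a list set \<Rightarrow> bool" where
  "edit_approachable A L G \<longleftrightarrow>
     (\<exists>g. mistake_function g \<and> (\<forall>w\<in>L. \<exists>v\<in>G. edit_dist A v w \<le> g (length w)))"

section \<open>Pressure and the Gibbs property\<close>

definition birkhoff_sum :: "int set \<Rightarrow> ((int \<Rightarrow> 'a) \<Rightarrow> real) \<Rightarrow> nat \<Rightarrow> (int \<Rightarrow> 'a) \<Rightarrow> real" where
  "birkhoff_sum I \<phi> n x = (\<Sum>k<n. \<phi> ((left_shift I ^^ k) x))"

text \<open>
  The upper limit is taken in the extended reals. It is finite whenever \<open>X\<close> is a nonempty shift
  space over a finite alphabet and \<open>\<phi>\<close> is continuous.
\<close>

definition pressure :: "int set \<Rightarrow> 'a set \<Rightarrow> (int \<Rightarrow> 'a) set \<Rightarrow> ((int \<Rightarrow> 'a) \<Rightarrow> real) \<Rightarrow> real" where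
  "pressure I A X \<phi> = real_of_ereal (limsup (\<lambda>n. ereal
     (1 / real n * ln (\<Sum>w\<in>language_n A X n. exp (SUP x\<in>cylinder X w. birkhoff_sum I \<phi> n x)))))"

definition gibbs :: "int set \<Rightarrow> 'a set \<Rightarrow> (int \<Rightarrow> 'a) set \<Rightarrow> (int \<Rightarrow> 'a) measure
    \<Rightarrow> ((int \<Rightarrow> 'a) \<Rightarrow> real) \<Rightarrow> 'a list set \<Rightarrow> bool" where
  "gibbs I A X m \<phi> G \<longleftrightarrow> (\<exists>K>0. \<exists>K'>0.
     (\<forall>x\<in>X. \<forall>n\<ge>1. measure m (cylinder X (initial_word x n))
        \<le> K' * exp (- real n * pressure I A X \<phi> + birkhoff_sum I \<phi> n x)) \<and>
     (\<forall>x\<in>X. \<forall>n\<ge>1. initial_word x n \<in> G \<longrightarrow> measure m (cylinder X (initial_word x n))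
        \<ge> K * exp (- real n * pressure I A X \<phi> + birkhoff_sum I \<phi> n x)))"

section \<open>Measures\<close>

definition borel_of :: "'b topology \<Rightarrow> 'b measure" where
  "borel_of T = sigma (topspace T) {U. openin T U}"

definition prob_measures :: "'b topology \<Rightarrow> 'b measure set" where
  "prob_measures T = {\<mu>. prob_space \<mu> \<and> sets \<mu> = sets (borel_of T)}"

text \<open>The coarsest topology for which \<open>\<mu> \<mapsto> \<integral>f d\<mu>\<close> is continuous for every continuous \<open>f\<close>.\<close>

definition weak_star_topology :: "'b topology \<Rightarrow> 'b measure topology" where
  "weak_star_topology T = topology_generated_by
     {{\<mu> \<in> prob_measures T. integral\<^sup>L \<mu> f \<in> V} | f V.
        continuous_map T euclideanreal f \<and> open V}"

definition invariant_measures :: "'b topology \<Rightarrow> ('b \<Rightarrow> 'b) \<Rightarrow> 'b measure set" where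
  "invariant_measures T s = {\<mu> \<in> prob_measures T. distr \<mu> \<mu> s = \<mu>}"

definition entropy_of :: "'a set \<Rightarrow> (int \<Rightarrow> 'a) set \<Rightarrow> (int \<Rightarrow> 'a) measure \<Rightarrow> real" where
  "entropy_of A X \<mu> = lim (\<lambda>n. 1 / real n *
     (\<Sum>w\<in>language_n A X n. - measure \<mu> (cylinder X w) * ln (measure \<mu> (cylinder X w))))"

section \<open>Large deviations\<close>

definition empirical_measure :: "'b topology \<Rightarrow> ('b \<Rightarrow> 'b) \<Rightarrow> nat \<Rightarrow> 'b \<Rightarrow> 'b measure" where
  "empirical_measure T s n x = measure_of (topspace T) {U. openin T U}
     (\<lambda>E. (\<Sum>j<n. emeasure (return (borel_of T) ((s ^^ j) x)) E) / of_nat n)"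

definition upper_semicontinuous :: "'c topology \<Rightarrow> ('c \<Rightarrow> ereal) \<Rightarrow> bool" where
  "upper_semicontinuous T q \<longleftrightarrow> (\<forall>a. openin T {\<mu> \<in> topspace T. q \<mu> < a})"

text \<open>Needed because \<open>ln 0 = 0\<close> for the library's real logarithm.\<close>

definition ext_ln :: "real \<Rightarrow> ereal" where
  "ext_ln p = (if p = 0 then -\<infinity> else ereal (ln p))"

definition level2_LDP ::
    "'b topology \<Rightarrow> ('b \<Rightarrow> 'b) \<Rightarrow> 'b measure \<Rightarrow> ('b measure \<Rightarrow> ereal) \<Rightarrow> bool" where
  "level2_LDP T s m q \<longleftrightarrow>
     (\<forall>\<mu>\<in>prob_measures T. q \<mu> \<le> 0) \<and>
     upper_semicontinuous (weak_star_topology T) q \<and>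
     (\<forall>U. openin (weak_star_topology T) U \<longrightarrow>
        liminf (\<lambda>n. ereal (1 / real n) *
          ext_ln (measure m {x \<in> topspace T. empirical_measure T s n x \<in> U})) \<ge> (SUP \<mu>\<in>U. q \<mu>)) \<and>
     (\<forall>F. closedin (weak_star_topology T) F \<longrightarrow>
        limsup (\<lambda>n. ereal (1 / real n) *
          ext_ln (measure m {x \<in> topspace T. empirical_measure T s n x \<in> F})) \<le> (SUP \<mu>\<in>F. q \<mu>))"

definition rate_function :: "int set \<Rightarrow> 'a set \<Rightarrow> (int \<Rightarrow> 'a) set \<Rightarrow> ((int \<Rightarrow> 'a) \<Rightarrow> real)
    \<Rightarrow> (int \<Rightarrow> 'a) measure \<Rightarrow> ereal" where
  "rate_function I A X \<phi> \<mu> =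
     (if \<mu> \<in> invariant_measures (shift_topology I A X) (left_shift I)
      then ereal (entropy_of A X \<mu> + integral\<^sup>L \<mu> \<phi> - pressure I A X \<phi>)
      else -\<infinity>)"

end

theory Submission
  imports Defs "HOL-Library.Sublist"
begin

text \<open>
  Both halves of the large deviations principle are reduced to local statements about small
  neighbourhoods \<open>U\<close> of one measure \<open>\<mu>\<close>. Write \<open>H\<^sub>n\<close> for the entropy of \<open>\<mu>\<close> on words of length \<open>n\<close>,
  and \<open>P\<close> for the pressure.

  Upper bound (\<open>local_upper_bound\<close>). Cover \<open>{x. \<E>\<^sub>n(x) \<in> U}\<close> by cylinders. The Gibbs property
  bounds the measure of each by about \<open>exp n(\<integral>\<phi> d\<mu> - P)\<close>, so only the number of words matters. The
  words in question have nearly the block statistics of \<open>\<mu>\<close>, hence the Markov chain of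
  order \<open>j\<close> with the transition probabilities of \<open>\<mu>\<close> gives each of them probability about
  \<open>exp (- n (H\<^bsub>j+1\<^esub> - H\<^sub>j))\<close>; as these probabilities sum to at most a constant, there are at most about
  \<open>exp n(H\<^bsub>j+1\<^esub> - H\<^sub>j)\<close> such words. If \<open>\<mu>\<close> is not invariant, empirical measures stay away from it
  altogether (\<open>local_upper_bound_noninvariant\<close>).

  Lower bound (\<open>many_good_words\<close>, \<open>local_lower_bound\<close>). Let \<open>\<mu>\<close> be invariant and \<open>l\<close> large. Choose
  \<open>N\<close> words of length \<open>l\<close> that form a typical sequence for independent draws from the distribution of
  \<open>\<mu>\<close> on \<open>l\<close>-words; there are about \<open>exp (N H\<^sub>l)\<close> such choices. Replace every word by one of \<open>G\<close>
  at small edit distance and glue. The result lies in \<open>G\<close>, so the lower Gibbs bound applies, and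
  its statistics are close to those of \<open>\<mu>\<close>: the law of large numbers takes care of the
  average over the \<open>N\<close> blocks, and by invariance the mean over one block is already correct up to
  boundary effects. Edits and gluing identify at most \<open>exp (\<delta> l N)\<close> sequences with each other, by a count of words within sublinear
  edit distance (\<open>card_edit_ball\<close>). Hence the exponential rate is at least about
  \<open>H\<^sub>l / l + \<integral>\<phi> d\<mu> - P\<close>.

  Comparing the two bounds shows that \<open>H\<^sub>l / l\<close> converges to the infimum of the increments
  \<open>H\<^bsub>j+1\<^esub> - H\<^sub>j\<close> (\<open>block_entropy_rate\<close>), so that both bounds become \<open>h(\<mu>) + \<integral>\<phi> d\<mu> - P\<close>. The global
  principle then follows from weak* compactness of the set of probability measures, which on a
  shift space is a statement about additive functions on clopen sets
  (\<open>compact_space_weak_star\<close>, \<open>level2_LDP_from_local_bounds\<close>).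
\<close>

section \<open>Probability measures on a compact zero-dimensional space\<close>

lemma sets_borel_of: "sets (borel_of T) = sigma_sets (topspace T) {U. openin T U}"
  unfolding borel_of_def by (rule sets_measure_of) (auto dest: openin_subset)

lemma space_borel_of: "space (borel_of T) = topspace T"
  unfolding borel_of_def by (rule space_measure_of) (auto dest: openin_subset)

lemma prob_measuresD:
  assumes "\<mu> \<in> prob_measures T"
  shows "prob_space \<mu>" "sets \<mu> = sets (borel_of T)" "space \<mu> = topspace T"
  using assms sets_eq_imp_space_eq[of \<mu> "borel_of T"] by (auto simp: prob_measures_def space_borel_of)

lemma openin_sets_borel_of: "openin T U \<Longrightarrow> U \<in> sets (borel_of T)"
  by (auto simp: sets_borel_of)

lemma closedin_sets_borel_of:
  assumes "closedin T C" shows "C \<in> sets (borel_of T)"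
proof -
  have "space (borel_of T) - (topspace T - C) \<in> sets (borel_of T)"
    using assms by (intro sets.compl_sets openin_sets_borel_of) auto
  then show ?thesis
    using closedin_subset[OF assms] by (simp add: space_borel_of double_diff)
qed

lemma continuous_map_borel_of:
  assumes "continuous_map T euclideanreal f" "sets \<mu> = sets (borel_of T)"
  shows "f \<in> borel_measurable \<mu>"
proof (rule borel_measurableI)
  fix S :: "real set" assume "open S"
  then have "openin T {x \<in> topspace T. f x \<in> S}"
    using assms(1) by (auto intro: openin_continuous_map_preimage)
  then have "{x \<in> topspace T. f x \<in> S} \<in> sets \<mu>"
    using assms(2) openin_sets_borel_of by auto
  moreover have "f -` S \<inter> space \<mu> = {x \<in> topspace T. f x \<in> S}"
    using sets_eq_imp_space_eq[OF assms(2)] by (auto simp: space_borel_of)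
  ultimately show "f -` S \<inter> space \<mu> \<in> sets \<mu>" by simp
qed

lemma topspace_weak_star [simp]: "topspace (weak_star_topology T) = prob_measures T"
proof -
  have "prob_measures T \<in> {{\<mu> \<in> prob_measures T. integral\<^sup>L \<mu> f \<in> V} | f V.
        continuous_map T euclideanreal f \<and> open V}"
    by (auto intro!: exI[of _ "\<lambda>_. 0"] exI[of _ UNIV])
  then show ?thesis
    unfolding weak_star_topology_def topology_generated_by_topspace by auto
qed

lemma openin_weak_star_basic:
  assumes "continuous_map T euclideanreal f" "open V"
  shows "openin (weak_star_topology T) {\<mu> \<in> prob_measures T. integral\<^sup>L \<mu> f \<in> V}"
  unfolding weak_star_topology_def using assms by (intro topology_generated_by_Basis) auto

text \<open>Finitely many continuous functions and one \<open>\<epsilon>\<close> suffice: the generating sets are of this kind,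
  and the property passes to finite intersections and arbitrary unions.\<close>

lemma weak_star_neighbourhood:
  assumes "openin (weak_star_topology T) U" "\<mu> \<in> U"
  obtains F \<epsilon> where "finite F" "\<epsilon> > 0" "\<forall>f\<in>F. continuous_map T euclideanreal f"
    "\<And>\<nu>. \<nu> \<in> prob_measures T \<Longrightarrow> \<forall>f\<in>F. \<bar>integral\<^sup>L \<nu> f - integral\<^sup>L \<mu> f\<bar> < \<epsilon> \<Longrightarrow> \<nu> \<in> U"
proof -
  have "\<exists>F \<epsilon>. finite F \<and> \<epsilon> > 0 \<and> (\<forall>f\<in>F. continuous_map T euclideanreal f) \<and>
     (\<forall>\<nu>\<in>prob_measures T. (\<forall>f\<in>F. \<bar>integral\<^sup>L \<nu> f - integral\<^sup>L \<mu> f\<bar> < \<epsilon>) \<longrightarrow> \<nu> \<in> U)"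
    using assms unfolding weak_star_topology_def openin_topology_generated_by_iff
  proof (induction rule: generate_topology_on.induct)
    case Empty
    then show ?case by simp
  next
    case (Int a b)
    then obtain F \<epsilon> F' \<epsilon>' where
      *: "finite F" "\<epsilon> > 0" "\<forall>f\<in>F. continuous_map T euclideanreal f"
        "\<forall>\<nu>\<in>prob_measures T. (\<forall>f\<in>F. \<bar>integral\<^sup>L \<nu> f - integral\<^sup>L \<mu> f\<bar> < \<epsilon>) \<longrightarrow> \<nu> \<in> a"
        "finite F'" "\<epsilon>' > 0" "\<forall>f\<in>F'. continuous_map T euclideanreal f"
        "\<forall>\<nu>\<in>prob_measures T. (\<forall>f\<in>F'. \<bar>integral\<^sup>L \<nu> f - integral\<^sup>L \<mu> f\<bar> < \<epsilon>') \<longrightarrow> \<nu> \<in> b"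
      by (auto simp del: all_simps)
    then show ?case
      by (intro exI[of _ "F \<union> F'"] exI[of _ "min \<epsilon> \<epsilon>'"]) auto
  next
    case (UN K)
    then obtain k where k: "k \<in> K" "\<mu> \<in> k" by auto
    with UN.IH[OF this] show ?case by (meson UnionI)
  next
    case (Basis s)
    then obtain f V where f: "s = {\<mu> \<in> prob_measures T. integral\<^sup>L \<mu> f \<in> V}"
      "continuous_map T euclideanreal f" "open V" by auto
    then obtain \<epsilon> where "\<epsilon> > 0" "ball (integral\<^sup>L \<mu> f) \<epsilon> \<subseteq> V"
      using Basis f by (metis (mono_tags, lifting) mem_Collect_eq openE)
    then show ?case using f
      by (intro exI[of _ "{f}"] exI[of _ \<epsilon>]) (auto simp: dist_real_def subset_iff abs_minus_commute)
  qed
  then show thesis using that by blast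
qed

lemma compact_continuous_bounded:
  assumes "compact_space T" "continuous_map T euclideanreal f"
  obtains B where "B \<ge> 0" "\<And>x. x \<in> topspace T \<Longrightarrow> \<bar>f x\<bar> \<le> B"
proof -
  have "compact (f ` topspace T)"
    using image_compactin[of T "topspace T" euclideanreal f] assms by (simp add: compact_space_def)
  then obtain B where "\<forall>y\<in>f ` topspace T. norm y \<le> B"
    using compact_imp_bounded bounded_iff by metis
  then show thesis by (intro that[of "max B 0"]) fastforce+
qed

lemma compact_continuous_integrable:
  assumes "compact_space T" "continuous_map T euclideanreal f" "\<mu> \<in> prob_measures T"
  shows "integrable \<mu> f"
proof -
  interpret prob_space \<mu> using assms(3) by (rule prob_measuresD)
  obtain B where "\<And>x. x \<in> topspace T \<Longrightarrow> \<bar>f x\<bar> \<le> B"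
    using compact_continuous_bounded assms by metis
  then show ?thesis
    using assms prob_measuresD[OF assms(3)]
    by (intro integrable_const_bound[of _ B] continuous_map_borel_of) auto
qed

lemma continuous_map_indicator_clopen:
  assumes "openin T C" "closedin T C"
  shows "continuous_map T euclideanreal (indicat_real C)"
  unfolding continuous_map_def
proof (intro conjI allI impI)
  fix U :: "real set"
  have "{x \<in> topspace T. indicat_real C x \<in> U} =
     (if 1 \<in> U then C else {}) \<union> (if 0 \<in> U then topspace T - C else {})"
    using openin_subset[OF assms(1)] by (auto simp: indicator_def split: if_splits)
  then show "openin T {x \<in> topspace T. indicat_real C x \<in> U}"
    using assms by (auto intro!: openin_Un openin_diff)
qed simp

lemma continuous_map_measurable:
  assumes s: "continuous_map T T s" and \<mu>: "\<mu> \<in> prob_measures T"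
  shows "s \<in> measurable \<mu> \<mu>"
proof (rule measurableI)
  note P = prob_measuresD[OF \<mu>]
  show "s x \<in> space \<mu>" if "x \<in> space \<mu>" for x
    using that s P by (auto simp: continuous_map_def)
  have s: "s \<in> measurable \<mu> (borel_of T)" unfolding borel_of_def
  proof (rule measurable_measure_of)
    show "s -` y \<inter> space \<mu> \<in> sets \<mu>" if "y \<in> {U. openin T U}" for y
    proof -
      have "openin T {x \<in> topspace T. s x \<in> y}"
        using that s by (auto intro: openin_continuous_map_preimage)
      moreover have "s -` y \<inter> space \<mu> = {x \<in> topspace T. s x \<in> y}" using P by auto
      ultimately show ?thesis using P openin_sets_borel_of by auto
    qed
  qed (use P s in \<open>auto simp: continuous_map_def dest: openin_subset\<close>)
  show "s -` A \<inter> space \<mu> \<in> sets \<mu>" if "A \<in> sets \<mu>" for A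
    by (rule measurable_sets[OF s]) (use that P(2) in simp)
qed

text \<open>Shift spaces enter the measure-theoretic part only through this property of their topology.
  It allows clopen sets, whose indicators are continuous, to replace general Borel sets.\<close>

locale compact_zero_dim =
  fixes T :: "'b topology"
  assumes compact: "compact_space T"
    and clopen_base: "openin T U \<Longrightarrow>
      \<exists>\<C>. countable \<C> \<and> (\<forall>C\<in>\<C>. openin T C \<and> closedin T C) \<and> U = \<Union>\<C>"
begin

definition clopens :: "'b set set" where
  "clopens = {C. openin T C \<and> closedin T C}"

lemma algebra_clopens: "algebra (topspace T) clopens"
  by (rule algebra.intro, rule ring_of_setsI)
     (auto simp: clopens_def algebra_axioms_def openin_diff dest: openin_subset)

lemma sigma_sets_clopens: "sigma_sets (topspace T) clopens = sets (borel_of T)"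
proof -
  have "U \<in> sigma_sets (topspace T) clopens" if "openin T U" for U
  proof -
    obtain \<C> where "countable \<C>" "\<forall>C\<in>\<C>. openin T C \<and> closedin T C" "U = \<Union>\<C>"
      using clopen_base[OF \<open>openin T U\<close>] by auto
    then show ?thesis
      by (auto intro!: sigma_sets_UNION simp: clopens_def)
  qed
  then show ?thesis
    unfolding sets_borel_of
    by (intro equalityI sigma_sets_mono subsetI) (auto simp: clopens_def)
qed

lemma clopen_sets: "\<mu> \<in> prob_measures T \<Longrightarrow> C \<in> clopens \<Longrightarrow> C \<in> sets \<mu>"
  by (auto simp: prob_measuresD clopens_def intro: openin_sets_borel_of)

lemma prob_measures_eqI:
  assumes "\<mu> \<in> prob_measures T" "\<nu> \<in> prob_measures T"
    and "\<And>C. C \<in> clopens \<Longrightarrow> measure \<mu> C = measure \<nu> C"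
  shows "\<mu> = \<nu>"
proof -
  interpret \<mu>: prob_space \<mu> using assms(1) by (rule prob_measuresD)
  interpret \<nu>: prob_space \<nu> using assms(2) by (rule prob_measuresD)
  interpret algebra "topspace T" clopens by (rule algebra_clopens)
  show ?thesis
  proof (rule measure_eqI_generator_eq[where E = clopens and \<Omega> = "topspace T" and A = "\<lambda>_. topspace T"])
    show "Int_stable clopens" by (auto simp: Int_stable_def)
    show "clopens \<subseteq> Pow (topspace T)" by (rule space_closed)
    show "sets \<mu> = sigma_sets (topspace T) clopens" "sets \<nu> = sigma_sets (topspace T) clopens"
      using prob_measuresD(2)[OF assms(1)] prob_measuresD(2)[OF assms(2)] sigma_sets_clopens by simp_all
    show "range (\<lambda>_. topspace T) \<subseteq> clopens" by auto
  qed (use assms(3) \<mu>.emeasure_eq_measure \<nu>.emeasure_eq_measure in auto)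
qed

text \<open>By compactness finitely many clopen sets on which \<open>f\<close> oscillates by at most \<open>\<epsilon>\<close> cover the space.
  They are treated one at a time, and each receives a constant value on the points that its
  predecessors do not cover.\<close>

lemma clopen_step_approximation:
  assumes f: "continuous_map T euclideanreal f" and "\<epsilon> > 0"
  obtains n :: nat and a :: "nat \<Rightarrow> real" and C where "\<And>i. i < n \<Longrightarrow> C i \<in> clopens"
    "\<And>x. x \<in> topspace T \<Longrightarrow> \<bar>f x - (\<Sum>i<n. a i * indicat_real (C i) x)\<bar> \<le> \<epsilon>"
proof -
  interpret algebra "topspace T" clopens by (rule algebra_clopens)
  define \<U> where "\<U> = {C \<in> clopens. \<forall>x\<in>C. \<forall>y\<in>C. \<bar>f x - f y\<bar> \<le> \<epsilon>}"
  have "\<exists>C\<in>\<U>. x \<in> C" if "x \<in> topspace T" for x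
  proof -
    have "openin T {y \<in> topspace T. f y \<in> ball (f x) (\<epsilon>/2)}"
      using f by (rule openin_continuous_map_preimage) auto
    from clopen_base[OF this] obtain \<C> where C: "\<forall>C\<in>\<C>. openin T C \<and> closedin T C"
      "{y \<in> topspace T. f y \<in> ball (f x) (\<epsilon>/2)} = \<Union>\<C>" by blast
    moreover have "x \<in> {y \<in> topspace T. f y \<in> ball (f x) (\<epsilon>/2)}"
      using that \<open>\<epsilon> > 0\<close> by auto
    ultimately obtain D where D: "D \<in> \<C>" "x \<in> D" by blast
    have "\<bar>f y - f z\<bar> \<le> \<epsilon>" if "y \<in> D" "z \<in> D" for y z
    proof -
      have "f y \<in> ball (f x) (\<epsilon>/2)" "f z \<in> ball (f x) (\<epsilon>/2)" using that C(2) D by blast+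
      then show ?thesis unfolding mem_ball dist_real_def by linarith
    qed
    then show ?thesis using C(1) D by (auto simp: \<U>_def clopens_def)
  qed
  then have "topspace T \<subseteq> \<Union>\<U>" by blast
  moreover have "\<forall>U\<in>\<U>. openin T U" by (auto simp: \<U>_def clopens_def)
  ultimately obtain \<F> where F: "finite \<F>" "\<F> \<subseteq> \<U>" "topspace T \<subseteq> \<Union>\<F>"
    using compact unfolding compact_space_alt by meson
  have "\<exists>(n::nat) a C. (\<forall>i<n. C i \<in> clopens) \<and>
      (\<forall>x\<in>\<Union>\<F>. \<bar>f x - (\<Sum>i<n. a i * indicat_real (C i) x)\<bar> \<le> \<epsilon>) \<and>
      (\<forall>x. x \<notin> \<Union>\<F> \<longrightarrow> (\<Sum>i<n. a i * indicat_real (C i) x) = 0)"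
    using F(1,2)
  proof (induction rule: finite_induct)
    case empty
    show ?case by (rule exI[of _ 0]) auto
  next
    case (insert D \<F>)
    then obtain n :: nat and a C where IH: "\<forall>i<n. C i \<in> clopens"
      "\<forall>x\<in>\<Union>\<F>. \<bar>f x - (\<Sum>i<n. a i * indicat_real (C i) x)\<bar> \<le> \<epsilon>"
      "\<forall>x. x \<notin> \<Union>\<F> \<longrightarrow> (\<Sum>i<n. a i * indicat_real (C i) x) = 0" by auto
    have D: "D \<in> clopens" "\<And>x y. x \<in> D \<Longrightarrow> y \<in> D \<Longrightarrow> \<bar>f x - f y\<bar> \<le> \<epsilon>"
      using insert by (auto simp: \<U>_def)
    have "\<Union>\<F> \<in> clopens" using insert by (auto simp: \<U>_def)
    with D have E: "D - \<Union>\<F> \<in> clopens" by auto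
    let ?a = "a(n := f (SOME x. x \<in> D))" and ?C = "C(n := D - \<Union>\<F>)"
    have S: "(\<Sum>i<Suc n. ?a i * indicat_real (?C i) x) =
      (\<Sum>i<n. a i * indicat_real (C i) x) + f (SOME x. x \<in> D) * indicat_real (D - \<Union>\<F>) x" for x
      by simp
    have *: "\<bar>f x - f (SOME x. x \<in> D)\<bar> \<le> \<epsilon>" if "x \<in> D" for x
      using D(2)[OF that, of "SOME x. x \<in> D"] someI[of "\<lambda>x. x \<in> D", OF that] by simp
    show ?case
    proof (intro exI[of _ "Suc n"] exI[of _ ?a] exI[of _ ?C] conjI allI impI ballI)
      fix x assume "x \<in> \<Union>(insert D \<F>)"
      then show "\<bar>f x - (\<Sum>i<Suc n. ?a i * indicat_real (?C i) x)\<bar> \<le> \<epsilon>"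
        unfolding S using IH(2,3) * by (cases "x \<in> \<Union>\<F>") auto
    next
      fix x assume "x \<notin> \<Union>(insert D \<F>)"
      then show "(\<Sum>i<Suc n. ?a i * indicat_real (?C i) x) = 0"
        unfolding S using IH(3) by auto
    qed (use IH(1) E in \<open>auto simp: less_Suc_eq\<close>)
  qed
  then obtain n :: nat and a C where "\<forall>i<n. C i \<in> clopens"
      "\<forall>x\<in>\<Union>\<F>. \<bar>f x - (\<Sum>i<n. a i * indicat_real (C i) x)\<bar> \<le> \<epsilon>" by blast
  then show thesis using that[of n C a] F(3) by blast
qed

text \<open>By compactness a decreasing sequence of clopen sets with empty intersection is eventually empty.
  So additivity on clopen sets already implies countable additivity, and Caratheodory's theorem
  applies.\<close>

lemma content_extends:
  assumes c: "\<And>C. C \<in> clopens \<Longrightarrow> 0 \<le> c C" "c (topspace T) = 1"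
    "\<And>C D. C \<in> clopens \<Longrightarrow> D \<in> clopens \<Longrightarrow> C \<inter> D = {} \<Longrightarrow> c (C \<union> D) = c C + (c D :: real)"
  obtains \<mu> where "\<mu> \<in> prob_measures T" "\<And>C. C \<in> clopens \<Longrightarrow> measure \<mu> C = c C"
proof -
  interpret algebra "topspace T" clopens by (rule algebra_clopens)
  have c0: "c {} = 0" using c(3)[of "{}" "{}"] by simp
  have "\<exists>\<mu>. (\<forall>C\<in>clopens. \<mu> C = ennreal (c C)) \<and>
      measure_space (topspace T) (sigma_sets (topspace T) clopens) \<mu>"
  proof (rule caratheodory_empty_continuous)
    show "positive clopens (\<lambda>C. ennreal (c C))" by (simp add: positive_def c0)
    show "additive clopens (\<lambda>C. ennreal (c C))" by (simp add: additive_def c ennreal_plus)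
  next
    fix D :: "nat \<Rightarrow> _" assume D: "range D \<subseteq> clopens" "decseq D" "(\<Inter>i. D i) = {}"
    have "\<exists>\<F>. finite \<F> \<and> \<F> \<subseteq> range (\<lambda>i. topspace T - D i) \<and> topspace T \<subseteq> \<Union>\<F>"
      using compact D unfolding compact_space_alt
      by (elim allE impE) (auto simp: clopens_def intro!: openin_diff)
    then obtain J where J: "finite J" "topspace T \<subseteq> (\<Union>i\<in>J. topspace T - D i)"
      by (metis finite_subset_image)
    have "D i = {}" if "i \<ge> Max (insert 0 J)" for i
    proof -
      have "D i \<subseteq> D j" if "j \<in> J" for j
        using that J(1) \<open>i \<ge> _\<close> D(2) by (auto simp: decseq_def)
      moreover have "D i \<subseteq> topspace T" using D(1) space_closed by blast
      ultimately show ?thesis using J(2) by blast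
    qed
    then have "\<forall>\<^sub>F i in sequentially. ennreal (c (D i)) = 0"
      unfolding eventually_sequentially using c0 by (metis ennreal_0)
    then show "(\<lambda>i. ennreal (c (D i))) \<longlonglongrightarrow> 0" by (rule tendsto_eventually)
  qed simp
  then obtain \<mu> where \<mu>: "\<forall>C\<in>clopens. \<mu> C = ennreal (c C)"
    "measure_space (topspace T) (sigma_sets (topspace T) clopens) \<mu>" by blast
  define M where "M = measure_of (topspace T) clopens \<mu>"
  have sets: "sets M = sets (borel_of T)" "space M = topspace T"
    unfolding M_def sigma_sets_clopens[symmetric] using space_closed by (simp_all add: space_measure_of)
  have em: "emeasure M C = ennreal (c C)" if "C \<in> clopens" for C
    using \<mu> that emeasure_measure_of[OF M_def space_closed]
    by (simp add: measure_space_def M_def emeasure_measure_of_sigma[of "topspace T"] sigma_sets.Basic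
        emeasure_measure_of[OF refl space_closed] space_closed)
  have "M \<in> prob_measures T"
    using em[of "topspace T"] c(2) sets by (auto simp: prob_measures_def intro!: prob_spaceI)
  moreover have "measure M C = c C" if "C \<in> clopens" for C
    using em[OF that] c(1)[OF that] by (simp add: measure_def)
  ultimately show thesis by (rule that)
qed


lemma integral_clopen_step:
  assumes "\<mu> \<in> prob_measures T" "\<And>i. i < n \<Longrightarrow> C i \<in> clopens"
  shows "integrable \<mu> (\<lambda>x. \<Sum>i<n. a i * indicat_real (C i) x)"
    "integral\<^sup>L \<mu> (\<lambda>x. \<Sum>i<n. a i * indicat_real (C i) x) = (\<Sum>i<(n::nat). a i * measure \<mu> (C i))"
proof -
  interpret prob_space \<mu> using assms(1) by (rule prob_measuresD)
  have "C i \<in> sets \<mu>" if "i < n" for i using clopen_sets assms that by auto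
  then have *: "integrable \<mu> (\<lambda>x. a i * indicat_real (C i) x)"
    "(\<integral>x. a i * indicat_real (C i) x \<partial>\<mu>) = a i * measure \<mu> (C i)" if "i < n" for i
    using that by (auto simp: sets.Int_space_eq2 integrable_real_indicator emeasure_eq_measure)
  show "integrable \<mu> (\<lambda>x. \<Sum>i<n. a i * indicat_real (C i) x)"
    using * by (intro Bochner_Integration.integrable_sum) simp
  show "integral\<^sup>L \<mu> (\<lambda>x. \<Sum>i<n. a i * indicat_real (C i) x) = (\<Sum>i<n. a i * measure \<mu> (C i))"
    using * by (subst Bochner_Integration.integral_sum) (simp_all del: integral_mult_right_zero)
qed

text \<open>A probability measure is determined by its values on clopen sets, which form a point of the
  compact cube \<open>[0,1]\<^bsup>clopens\<^esup>\<close>. The points that arise are exactly the finitely additive normalised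
  ones, a closed condition, and integrals of continuous functions are uniform limits of finite
  combinations of coordinates.\<close>

theorem compact_space_weak_star: "compact_space (weak_star_topology T)"
proof -
  interpret algebra "topspace T" clopens by (rule algebra_clopens)
  let ?cube = "product_topology (\<lambda>_. top_of_set {0..1::real}) clopens"
  define K where "K = {c \<in> topspace ?cube. c (topspace T) = 1 \<and>
    (\<forall>C\<in>clopens. \<forall>D\<in>clopens. C \<inter> D = {} \<longrightarrow> c (C \<union> D) = c C + c D)}"
  have proj: "continuous_map ?cube euclideanreal (\<lambda>c. c C)" if "C \<in> clopens" for C
    using continuous_map_product_projection[OF that, of "\<lambda>_. top_of_set {0..1::real}"]
    by (simp add: continuous_map_in_subtopology)
  have clK: "closedin ?cube K"
  proof -
    have 1: "closedin ?cube {c \<in> topspace ?cube. c (topspace T) \<in> {1}}"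
      by (rule closedin_continuous_map_preimage[OF proj]) auto
    have 2: "closedin ?cube {c \<in> topspace ?cube. C \<inter> D = {} \<longrightarrow> c (C \<union> D) - c C - c D \<in> {0}}"
      if "C \<in> clopens" "D \<in> clopens" for C D
    proof (cases "C \<inter> D = {}")
      case True
      have "closedin ?cube {c \<in> topspace ?cube. c (C \<union> D) - c C - c D \<in> {0}}"
        by (rule closedin_continuous_map_preimage[of _ euclideanreal])
           (use that in \<open>auto intro!: continuous_intros proj\<close>)
      then show ?thesis using True by simp
    next
      case False
      then have "{c \<in> topspace ?cube. C \<inter> D = {} \<longrightarrow> c (C \<union> D) - c C - c D \<in> {0}} = topspace ?cube"
        by auto
      then show ?thesis by (simp only: closedin_topspace)
    qed
    define \<D> where "\<D> C D = {c \<in> topspace ?cube. C \<inter> D = {} \<longrightarrow> c (C \<union> D) - c C - c D \<in> {0}}" for C D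
    have "closedin ?cube ({c \<in> topspace ?cube. c (topspace T) \<in> {1}} \<inter> (\<Inter>C\<in>clopens. \<Inter>D\<in>clopens. \<D> C D))"
      by (intro closedin_Int 1 closedin_INT) (use 2 in \<open>auto simp only: \<D>_def\<close>)
    moreover have "K = {c \<in> topspace ?cube. c (topspace T) \<in> {1}} \<inter> (\<Inter>C\<in>clopens. \<Inter>D\<in>clopens. \<D> C D)"
      unfolding K_def \<D>_def by fastforce
    ultimately show ?thesis by (simp only:)
  qed
  have cptc: "compact_space ?cube"
    unfolding compact_space_product_topology
    by (intro disjI2 ballI compact_space_subtopology) (simp add: compactin_euclidean_iff)
  have cK: "compactin ?cube K" by (rule closedin_compact_space[OF cptc clK])
  \<comment> \<open>The inverse of the embedding into the cube; its continuity is what carries compactness over.\<close>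
  define \<Psi> where "\<Psi> c = (SOME \<mu>. \<mu> \<in> prob_measures T \<and> (\<forall>C\<in>clopens. measure \<mu> C = c C))" for c
  have \<Psi>: "\<Psi> c \<in> prob_measures T" "\<And>C. C \<in> clopens \<Longrightarrow> measure (\<Psi> c) C = c C" if "c \<in> K" for c
  proof -
    have "0 \<le> c C" if "C \<in> clopens" for C
      using that \<open>c \<in> K\<close> by (simp add: K_def PiE_iff)
    moreover have "c (topspace T) = 1"
      "\<And>C D. C \<in> clopens \<Longrightarrow> D \<in> clopens \<Longrightarrow> C \<inter> D = {} \<Longrightarrow> c (C \<union> D) = c C + c D"
      using \<open>c \<in> K\<close> unfolding K_def by blast+
    ultimately have "\<exists>\<mu>. \<mu> \<in> prob_measures T \<and> (\<forall>C\<in>clopens. measure \<mu> C = c C)"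
      using content_extends[of c] by metis
    from someI_ex[OF this] show "\<Psi> c \<in> prob_measures T" "\<And>C. C \<in> clopens \<Longrightarrow> measure (\<Psi> c) C = c C"
      unfolding \<Psi>_def by auto
  qed
  have "continuous_map (subtopology ?cube K) (weak_star_topology T) \<Psi>"
    unfolding weak_star_topology_def
  proof (rule continuous_on_generated_topo)
    show "\<Psi> ` topspace (subtopology ?cube K) \<subseteq> \<Union> {{\<mu> \<in> prob_measures T. integral\<^sup>L \<mu> f \<in> V} |f V.
       continuous_map T euclideanreal f \<and> open V}"
      using \<Psi>(1) by (fastforce intro!: exI[of _ "\<lambda>_. 0"] exI[of _ UNIV])
  next
    fix S assume "S \<in> {{\<mu> \<in> prob_measures T. integral\<^sup>L \<mu> f \<in> V} |f V.
       continuous_map T euclideanreal f \<and> open V}"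
    then obtain f V where S: "S = {\<mu> \<in> prob_measures T. integral\<^sup>L \<mu> f \<in> V}"
      "continuous_map T euclideanreal f" "open V" by auto
    have "openin (subtopology ?cube K) {c \<in> K. integral\<^sup>L (\<Psi> c) f \<in> V}"
    proof (subst openin_subopen, intro ballI)
      fix c assume "c \<in> {c \<in> K. integral\<^sup>L (\<Psi> c) f \<in> V}"
      then have c: "c \<in> K" "integral\<^sup>L (\<Psi> c) f \<in> V" by auto
      then obtain \<epsilon> where \<epsilon>: "\<epsilon> > 0" "ball (integral\<^sup>L (\<Psi> c) f) \<epsilon> \<subseteq> V"
        using \<open>open V\<close> openE by metis
      obtain n :: nat and a C where h: "\<And>i. i < n \<Longrightarrow> C i \<in> clopens"
        "\<And>x. x \<in> topspace T \<Longrightarrow> \<bar>f x - (\<Sum>i<n. a i * indicat_real (C i) x)\<bar> \<le> \<epsilon> / 3"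
        using clopen_step_approximation[OF S(2), of "\<epsilon>/3"] \<epsilon>(1) by (metis zero_less_divide_iff zero_less_numeral)
      let ?l = "\<lambda>c. \<Sum>i<n. a i * c (C i)"
      have close: "\<bar>integral\<^sup>L (\<Psi> d) f - ?l d\<bar> \<le> \<epsilon> / 3" if "d \<in> K" for d
      proof -
        have M: "\<Psi> d \<in> prob_measures T" by (rule \<Psi>(1)[OF that])
        interpret prob_space "\<Psi> d" by (rule prob_measuresD[OF M])
        note int = compact_continuous_integrable[OF compact S(2) M] integral_clopen_step[OF M, of n C a, OF h(1)]
        have "?l d = (\<Sum>i<n. a i * prob (C i))" using \<Psi>(2)[OF that] h(1) by simp
        also have "\<dots> = (\<integral>x. (\<Sum>i<n. a i * indicat_real (C i) x) \<partial>\<Psi> d)"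
          using int(3) by simp
        finally have "\<bar>integral\<^sup>L (\<Psi> d) f - ?l d\<bar> =
          \<bar>\<integral>x. f x - (\<Sum>i<n. a i * indicat_real (C i) x) \<partial>\<Psi> d\<bar>" using int by simp
        also have "\<dots> \<le> (\<integral>x. \<bar>f x - (\<Sum>i<n. a i * indicat_real (C i) x)\<bar> \<partial>\<Psi> d)"
          by (rule integral_abs_bound)
        also have "\<dots> \<le> (\<integral>x. \<epsilon>/3 \<partial>\<Psi> d)"
          using int h(2) prob_measuresD(3)[OF M] by (intro integral_mono) auto
        finally show ?thesis by (simp add: prob_space)
      qed
      have "continuous_map ?cube euclideanreal ?l"
        using h(1) by (intro continuous_intros proj) auto
      then have "openin ?cube {d \<in> topspace ?cube. ?l d \<in> ball (?l c) (\<epsilon>/3)}"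
        by (rule openin_continuous_map_preimage) auto
      then have "openin (subtopology ?cube K) (K \<inter> {d \<in> topspace ?cube. ?l d \<in> ball (?l c) (\<epsilon>/3)})"
        by (rule openin_subtopology_Int2)
      moreover have "c \<in> K \<inter> {d \<in> topspace ?cube. ?l d \<in> ball (?l c) (\<epsilon>/3)}"
        using c \<epsilon>(1) by (auto simp: K_def)
      moreover have "d \<in> {c \<in> K. integral\<^sup>L (\<Psi> c) f \<in> V}"
        if "d \<in> K \<inter> {d \<in> topspace ?cube. ?l d \<in> ball (?l c) (\<epsilon>/3)}" for d
      proof -
        have "d \<in> K" "\<bar>?l c - ?l d\<bar> < \<epsilon>/3" using that by (auto simp: dist_real_def)
        with close[of d] close[OF c(1)] have "\<bar>integral\<^sup>L (\<Psi> c) f - integral\<^sup>L (\<Psi> d) f\<bar> < \<epsilon>" by linarith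
        then show ?thesis using \<epsilon>(2) \<open>d \<in> K\<close> by (auto simp: dist_real_def)
      qed
      ultimately show "\<exists>T'. openin (subtopology ?cube K) T' \<and> c \<in> T' \<and> T' \<subseteq> {c \<in> K. integral\<^sup>L (\<Psi> c) f \<in> V}"
        by blast
    qed
    moreover have "\<Psi> -` S \<inter> topspace (subtopology ?cube K) = {c \<in> K. integral\<^sup>L (\<Psi> c) f \<in> V}"
      using \<Psi>(1) by (auto simp: S K_def)
    ultimately show "openin (subtopology ?cube K) (\<Psi> -` S \<inter> topspace (subtopology ?cube K))" by simp
  qed
  then have "compactin (weak_star_topology T) (\<Psi> ` K)"
    by (rule image_compactin[rotated]) (simp add: compactin_subtopology cK)
  moreover have "\<Psi> ` K = prob_measures T"
  proof (intro equalityI subsetI)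
    fix \<mu> assume \<mu>: "\<mu> \<in> prob_measures T"
    interpret prob_space \<mu> by (rule prob_measuresD[OF \<mu>])
    define c where "c = restrict (measure \<mu>) clopens"
    have "c (C \<union> D) = c C + c D" if "C \<in> clopens" "D \<in> clopens" "C \<inter> D = {}" for C D
      using that Un[OF that(1,2)] clopen_sets[OF \<mu>] by (simp add: c_def finite_measure_Union)
    then have "c \<in> K"
      using prob_space prob_measuresD(3)[OF \<mu>] by (auto simp: K_def c_def)
    moreover have "\<Psi> c = \<mu>"
      using \<Psi>[OF \<open>c \<in> K\<close>] \<mu> by (intro prob_measures_eqI) (auto simp: c_def)
    ultimately show "\<mu> \<in> \<Psi> ` K" by blast
  qed (use \<Psi>(1) in auto)
  ultimately show ?thesis by (simp add: compact_space_def)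
qed

text \<open>Clopen sets determine a measure, so they also witness failure of invariance.\<close>

lemma noninvariant_clopen:
  assumes s: "continuous_map T T s" and \<mu>: "\<mu> \<in> prob_measures T" "\<mu> \<notin> invariant_measures T s"
  shows "\<exists>C\<in>clopens. measure \<mu> {x \<in> topspace T. s x \<in> C} \<noteq> measure \<mu> C"
proof (rule ccontr)
  assume asm: "\<not> ?thesis"
  then have eq: "measure \<mu> {x \<in> topspace T. s x \<in> C} = measure \<mu> C" if "C \<in> clopens" for C
    using that asm by blast
  note P = prob_measuresD[OF \<mu>(1)]
  interpret prob_space \<mu> by (rule P)
  note s_meas = continuous_map_measurable[OF s \<mu>(1)]
  have "distr \<mu> \<mu> s \<in> prob_measures T"
    using P prob_space_distr[OF s_meas] by (auto simp: prob_measures_def)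
  moreover have "measure (distr \<mu> \<mu> s) C = measure \<mu> C" if "C \<in> clopens" for C
    using eq[OF that] clopen_sets[OF \<mu>(1) that] P
    by (simp add: measure_distr[OF s_meas] vimage_def Int_def conj_commute)
  ultimately have "distr \<mu> \<mu> s = \<mu>" using \<mu>(1) by (intro prob_measures_eqI) auto
  then show False using \<mu> by (simp add: invariant_measures_def)
qed

end

section \<open>Empirical measures\<close>

text \<open>The empirical measure is the distribution of \<open>s\<^sup>j x\<close> for a uniformly random time \<open>j < n\<close>. For \<open>n = 0\<close>
  it is not a probability measure.\<close>

lemma empirical_measure_props:
  fixes s :: "'b \<Rightarrow> 'b"
  assumes "0 < n" and s: "\<And>x. x \<in> topspace T \<Longrightarrow> s x \<in> topspace T" and x: "x \<in> topspace T"
  shows "empirical_measure T s n x \<in> prob_measures T"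
    and "continuous_map T euclideanreal f \<Longrightarrow>
      integral\<^sup>L (empirical_measure T s n x) f = (\<Sum>j<n. f ((s ^^ j) x)) / n"
proof -
  let ?B = "borel_of T" and ?\<E> = "empirical_measure T s n x"
  have orbit: "(s ^^ j) x \<in> topspace T" for j
    by (induction j) (auto simp: x s)
  have n: "{..<n} \<noteq> {}" "finite {..<n}" using \<open>0 < n\<close> by auto
  define p where "p = pmf_of_set {..<n}"
  define N where "N = distr (measure_pmf p) ?B (\<lambda>j. (s ^^ j) x)"
  have setsN: "sets N = sets ?B" "space N = topspace T"
    by (simp_all add: N_def space_borel_of)
  have meas: "(\<lambda>j. (s ^^ j) x) \<in> measurable (measure_pmf p) ?B"
    by (simp add: space_borel_of Pi_iff orbit)
  have em: "emeasure N E = (\<Sum>j<n. emeasure (return ?B ((s ^^ j) x)) E) / of_nat n"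
    if "E \<in> sets ?B" for E
  proof -
    have "emeasure N E = emeasure (measure_pmf p) ((\<lambda>j. (s ^^ j) x) -` E)"
      unfolding N_def using emeasure_distr[OF meas that] by simp
    also have "\<dots> = (\<integral>\<^sup>+ j. indicator ((\<lambda>j. (s ^^ j) x) -` E) j \<partial>measure_pmf p)"
      by simp
    also have "\<dots> = (\<Sum>j<n. indicator ((\<lambda>j. (s ^^ j) x) -` E) j) / of_nat n"
      unfolding p_def nn_integral_pmf_of_set[OF n] by (simp add: ennreal_of_nat_eq_real_of_nat)
    also have "\<dots> = (\<Sum>j<n. indicator E ((s ^^ j) x)) / of_nat n"
      by (simp add: indicator_def)
    also have "(\<Sum>j<n. indicator E ((s ^^ j) x)) = (\<Sum>j<n. emeasure (return ?B ((s ^^ j) x)) E)"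
      using that by simp
    finally show ?thesis .
  qed
  have "?\<E> = measure_of (topspace T) {U. openin T U} (emeasure N)"
    unfolding empirical_measure_def
    by (rule measure_of_eq) (auto simp: em sets_borel_of dest: openin_subset)
  also have "\<dots> = N"
  proof (rule measure_eqI)
    show sets: "sets (measure_of (topspace T) {U. openin T U} (emeasure N)) = sets N"
      using setsN by (simp add: sets_borel_of) (auto dest: openin_subset intro!: sets_measure_of)
    fix E assume "E \<in> sets (measure_of (topspace T) {U. openin T U} (emeasure N))"
    then show "emeasure (measure_of (topspace T) {U. openin T U} (emeasure N)) E = emeasure N E"
      using emeasure_countably_additive[of N]
      by (intro emeasure_measure_of[OF refl]) (auto simp: sets positive_def dest: openin_subset)
  qed
  finally have N: "?\<E> = N" .
  show "?\<E> \<in> prob_measures T"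
    unfolding N using setsN(1) measure_pmf.prob_space_distr[OF meas]
    by (simp add: prob_measures_def N_def)
  show "integral\<^sup>L ?\<E> f = (\<Sum>j<n. f ((s ^^ j) x)) / n" if "continuous_map T euclideanreal f"
    unfolding N unfolding N_def
    using n continuous_map_borel_of[OF that, of ?B] meas
    by (simp add: integral_distr p_def integral_pmf_of_set)
qed

lemma continuous_map_funpow: "continuous_map T T s \<Longrightarrow> continuous_map T T (s ^^ j)"
  by (induction j) (simp_all add: continuous_map_compose)

lemma continuous_map_empirical_measure:
  assumes s: "continuous_map T T s" and n: "0 < n"
  shows "continuous_map T (weak_star_topology T) (empirical_measure T s n)"
  unfolding weak_star_topology_def
proof (rule continuous_on_generated_topo)
  have sT: "s x \<in> topspace T" if "x \<in> topspace T" for x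
    using s that by (auto simp: continuous_map_def)
  note E = empirical_measure_props[OF n sT]
  show "empirical_measure T s n ` topspace T \<subseteq> \<Union> {{\<mu> \<in> prob_measures T. integral\<^sup>L \<mu> f \<in> V} |f V.
       continuous_map T euclideanreal f \<and> open V}"
    using E(1) topspace_weak_star[of T, unfolded weak_star_topology_def topology_generated_by_topspace]
    by (simp add: image_subset_iff)
  fix S assume "S \<in> {{\<mu> \<in> prob_measures T. integral\<^sup>L \<mu> f \<in> V} |f V.
       continuous_map T euclideanreal f \<and> open V}"
  then obtain f V where S: "S = {\<mu> \<in> prob_measures T. integral\<^sup>L \<mu> f \<in> V}"
    and f: "continuous_map T euclideanreal f" and V: "open V" by auto
  have "continuous_map T euclideanreal (\<lambda>x. f ((s ^^ j) x))" for j
    using continuous_map_compose[OF continuous_map_funpow[OF s] f] by (simp add: comp_def)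
  then have "continuous_map T euclideanreal (\<lambda>x. (\<Sum>j<n. f ((s ^^ j) x)) / n)"
    using \<open>0 < n\<close> by (intro continuous_intros) simp_all
  then have "openin T {x \<in> topspace T. (\<Sum>j<n. f ((s ^^ j) x)) / n \<in> V}"
    by (rule openin_continuous_map_preimage) (simp add: V)
  moreover have "empirical_measure T s n -` S \<inter> topspace T = {x \<in> topspace T. (\<Sum>j<n. f ((s ^^ j) x)) / n \<in> V}"
    using E f by (auto simp: S)
  ultimately show "openin T (empirical_measure T s n -` S \<inter> topspace T)" by simp
qed

section \<open>A large deviations principle from local bounds\<close>

lemma ext_ln_rate_le_iff:
  assumes "0 < n" "0 \<le> p"
  shows "ereal (1 / real n) * ext_ln p \<le> ereal a \<longleftrightarrow> p \<le> exp (n * a)"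
proof (cases "p = 0")
  case False
  then have "ln p / n \<le> a \<longleftrightarrow> ln p \<le> n * a" using assms by (simp add: field_simps)
  also have "\<dots> \<longleftrightarrow> p \<le> exp (n * a)" using False assms
    by (metis antisym_conv2 exp_ln_iff exp_le_cancel_iff)
  finally show ?thesis using False by (simp add: ext_ln_def)
qed (use assms in \<open>auto simp: ext_ln_def\<close>)

lemma le_ext_ln_rate_iff:
  assumes "0 < n" "0 \<le> p"
  shows "ereal a \<le> ereal (1 / real n) * ext_ln p \<longleftrightarrow> exp (n * a) \<le> p"
proof (cases "p = 0")
  case False
  then have "a \<le> ln p / n \<longleftrightarrow> n * a \<le> ln p" using assms by (simp add: field_simps)
  also have "\<dots> \<longleftrightarrow> exp (n * a) \<le> p" using False assms
    by (metis antisym_conv2 exp_ln_iff exp_le_cancel_iff)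
  finally show ?thesis using False by (simp add: ext_ln_def)
qed (use assms exp_gt_zero[of "n * a"] in \<open>auto simp: ext_ln_def\<close>)

text \<open>The upper bound is the usual covering argument on compact sets. The other properties of the rate
  function are consequences of the two local bounds: taking for \<open>U\<close> the set of all probability
  measures gives \<open>q \<le> 0\<close>, and if \<open>q \<mu> < a\<close>, then the upper bound at \<open>\<mu>\<close> holds on an open set \<open>U\<close>,
  where the lower bound forces \<open>q < a\<close> throughout, which is upper semicontinuity.\<close>

theorem level2_LDP_from_local_bounds:
  fixes T :: "'b topology" and s :: "'b \<Rightarrow> 'b" and m :: "'b measure" and q :: "'b measure \<Rightarrow> ereal"
  defines "dev U n \<equiv> measure m {x \<in> topspace T. empirical_measure T s n x \<in> U}"
  assumes cpt: "compact_space (weak_star_topology T)" and s: "continuous_map T T s"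
    and m: "m \<in> prob_measures T"
    and lower: "\<And>U \<mu> a. openin (weak_star_topology T) U \<Longrightarrow> \<mu> \<in> U \<Longrightarrow> ereal a < q \<mu> \<Longrightarrow>
      \<forall>\<^sub>F n in sequentially. exp (real n * a) \<le> dev U n"
    and upper: "\<And>\<mu> a. \<mu> \<in> prob_measures T \<Longrightarrow> q \<mu> < ereal a \<Longrightarrow>
      \<exists>U. openin (weak_star_topology T) U \<and> \<mu> \<in> U \<and> (\<forall>\<^sub>F n in sequentially. dev U n \<le> exp (real n * a))"
  shows "level2_LDP T s m q"
proof -
  let ?W = "weak_star_topology T"
  interpret prob_space m using m by (rule prob_measuresD)
  note M = prob_measuresD[OF m]
  have dev_nonneg: "0 \<le> dev U n" for U n by (simp add: dev_def)
  have dev_sets: "{x \<in> topspace T. empirical_measure T s n x \<in> U} \<in> sets m"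
    if "openin ?W U \<or> closedin ?W U" "0 < n" for U n
    using that(1)
  proof
    note C = continuous_map_empirical_measure[OF s \<open>0 < n\<close>]
    show ?thesis if "openin ?W U"
      using openin_sets_borel_of[OF openin_continuous_map_preimage[OF C that]] M(2) by simp
    show ?thesis if "closedin ?W U"
      using closedin_sets_borel_of[OF closedin_continuous_map_preimage[OF C that]] M(2) by simp
  qed
  \<comment> \<open>On a set whose deviation probabilities decay at rate \<open>b\<close>, the lower bound rules out values above \<open>b\<close>.\<close>
  have contra: "\<not> ereal a < q \<nu>" if "openin ?W U" "\<nu> \<in> U" "\<forall>\<^sub>F n in sequentially. dev U n \<le> exp (real n * b)" "b < a" for U \<nu> a b
  proof
    assume "ereal a < q \<nu>"
    then have "\<forall>\<^sub>F n in sequentially. exp (real n * a) \<le> dev U n" using lower that by blast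
    with that(3) eventually_gt_at_top[of 0] have "\<forall>\<^sub>F n in sequentially. False"
    proof eventually_elim
      case (elim n)
      then have "exp (real n * a) \<le> exp (real n * b)" by linarith
      then have "real n * a \<le> real n * b" by simp
      then show ?case using elim(2) that(4) by simp
    qed
    then show False by simp
  qed
  have nonpos: "q \<mu> \<le> 0" if "\<mu> \<in> prob_measures T" for \<mu>
  proof (rule ccontr)
    assume "\<not> q \<mu> \<le> 0"
    then obtain a where a: "0 < ereal a" "ereal a < q \<mu>" using ereal_dense2 by (metis not_le)
    have "\<forall>\<^sub>F n in sequentially. dev (prob_measures T) n \<le> exp (real n * 0)"
      by (auto simp: dev_def)
    moreover have "openin ?W (prob_measures T)" using openin_topspace[of ?W] by simp
    ultimately show False using contra[of "prob_measures T" \<mu> 0 a] a that by auto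
  qed
  have usc: "upper_semicontinuous ?W q"
    unfolding upper_semicontinuous_def
  proof (intro allI, subst openin_subopen, intro ballI)
    fix a \<mu> assume "\<mu> \<in> {\<mu> \<in> topspace ?W. q \<mu> < a}"
    then obtain b where b: "\<mu> \<in> prob_measures T" "q \<mu> < ereal b" "ereal b < a"
      using ereal_dense2 by auto
    then obtain U where U: "openin ?W U" "\<mu> \<in> U" "\<forall>\<^sub>F n in sequentially. dev U n \<le> exp (real n * b)"
      using upper by blast
    have "q \<nu> \<le> ereal b" if "\<nu> \<in> U" for \<nu>
    proof (rule ccontr)
      assume "\<not> q \<nu> \<le> ereal b"
      then obtain c where "ereal b < ereal c" "ereal c < q \<nu>" using ereal_dense2 by (metis not_le)
      then show False using contra[OF U(1) that U(3), of c] by simp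
    qed
    then have "U \<subseteq> {\<mu> \<in> topspace ?W. q \<mu> < a}"
      using openin_subset[OF U(1)] b(3) by fastforce
    then show "\<exists>U. openin ?W U \<and> \<mu> \<in> U \<and> U \<subseteq> {\<mu> \<in> topspace ?W. q \<mu> < a}" using U by blast
  qed
  have low: "(SUP \<mu>\<in>U. q \<mu>) \<le> liminf (\<lambda>n. ereal (1 / real n) * ext_ln (dev U n))" if U: "openin ?W U" for U
  proof (rule SUP_least, rule dense_le)
    fix \<mu> y assume "\<mu> \<in> U" "y < q \<mu>"
    then obtain a where a: "y < ereal a" "ereal a < q \<mu>" using ereal_dense2 by blast
    have "\<forall>\<^sub>F n in sequentially. y \<le> ereal (1 / real n) * ext_ln (dev U n)"
      using lower[OF U \<open>\<mu> \<in> U\<close> a(2)] eventually_gt_at_top[of 0]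
    proof eventually_elim
      case (elim n)
      then have "ereal a \<le> ereal (1 / real n) * ext_ln (dev U n)"
        using le_ext_ln_rate_iff dev_nonneg by blast
      then show ?case using a(1) by simp
    qed
    then show "y \<le> liminf (\<lambda>n. ereal (1 / real n) * ext_ln (dev U n))" by (rule Liminf_bounded)
  qed
  have up: "limsup (\<lambda>n. ereal (1 / real n) * ext_ln (dev F n)) \<le> (SUP \<mu>\<in>F. q \<mu>)" if F: "closedin ?W F" for F
  proof (rule dense_ge)
    fix y assume "(SUP \<mu>\<in>F. q \<mu>) < y"
    then obtain a where a: "(SUP \<mu>\<in>F. q \<mu>) < ereal a" "ereal a < y" using ereal_dense2 by blast
    have FM: "F \<subseteq> prob_measures T" using closedin_subset[OF F] by simp
    have "\<exists>U. openin ?W U \<and> \<mu> \<in> U \<and> (\<forall>\<^sub>F n in sequentially. dev U n \<le> exp (real n * a))" if "\<mu> \<in> F" for \<mu>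
      using upper[of \<mu> a] a(1) FM that SUP_upper[of \<mu> F q] by (meson le_less_trans subsetD)
    then obtain V where V: "\<And>\<mu>. \<mu> \<in> F \<Longrightarrow> openin ?W (V \<mu>) \<and> \<mu> \<in> V \<mu> \<and> (\<forall>\<^sub>F n in sequentially. dev (V \<mu>) n \<le> exp (real n * a))"
      by metis
    have "compactin ?W F" using cpt F by (rule closedin_compact_space)
    then obtain \<F> where "finite \<F>" "\<F> \<subseteq> V ` F" "F \<subseteq> \<Union>\<F>"
      using V unfolding compactin_def
      by (elim conjE allE[of _ "V ` F"]) (auto 4 4)
    then obtain D where D: "finite D" "D \<subseteq> F" "F \<subseteq> (\<Union>\<mu>\<in>D. V \<mu>)"
      by (metis finite_subset_image)
    have ev: "\<forall>\<^sub>F n in sequentially. \<forall>\<mu>\<in>D. dev (V \<mu>) n \<le> exp (real n * a)"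
      using D V by (intro eventually_ball_finite) auto
    \<comment> \<open>One is added so that the logarithm also makes sense for \<open>F = {}\<close>.\<close>
    define N where "N = real (card D) + 1"
    have "\<forall>\<^sub>F n in sequentially. ereal (1 / real n) * ext_ln (dev F n) \<le> ereal (a + ln N / n)"
      using ev eventually_gt_at_top[of 0]
    proof eventually_elim
      case (elim n)
      have "dev F n \<le> measure m (\<Union>\<mu>\<in>D. {x \<in> topspace T. empirical_measure T s n x \<in> V \<mu>})"
        unfolding dev_def using D V elim(2) by (intro finite_measure_mono sets.finite_UN dev_sets) auto
      also have "\<dots> \<le> (\<Sum>\<mu>\<in>D. dev (V \<mu>) n)"
        unfolding dev_def using D V elim(2) by (intro finite_measure_subadditive_finite) (auto intro!: dev_sets)
      also have "\<dots> \<le> (\<Sum>\<mu>\<in>D. exp (real n * a))" using elim(1) by (intro sum_mono) auto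
      also have "\<dots> \<le> N * exp (real n * a)" by (simp add: N_def algebra_simps)
      also have "\<dots> = exp (real n * (a + ln N / n))"
      proof -
        have "N > 0" by (simp add: N_def add_nonneg_pos)
        then show ?thesis using elim(2) by (simp add: distrib_left exp_add)
      qed
      finally show ?case using ext_ln_rate_le_iff[OF elim(2) dev_nonneg] by blast
    qed
    then have "limsup (\<lambda>n. ereal (1 / real n) * ext_ln (dev F n)) \<le> limsup (\<lambda>n. ereal (a + ln N / n))"
      by (rule Limsup_mono)
    also have "\<dots> = ereal a"
    proof (rule lim_imp_Limsup)
      have "(\<lambda>n. a + ln N / real n) \<longlonglongrightarrow> a + 0"
        by (intro tendsto_add tendsto_const lim_const_over_n)
      then show "(\<lambda>n. ereal (a + ln N / n)) \<longlonglongrightarrow> ereal a" by simp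
    qed simp
    finally show "limsup (\<lambda>n. ereal (1 / real n) * ext_ln (dev F n)) \<le> y" using a(2) by simp
  qed
  show ?thesis
    unfolding level2_LDP_def using nonpos usc low up unfolding dev_def by blast
qed

section \<open>Shift spaces\<close>

definition agree :: "int set \<Rightarrow> nat \<Rightarrow> (int \<Rightarrow> 'a) \<Rightarrow> (int \<Rightarrow> 'a) \<Rightarrow> bool" where
  "agree I t x y \<longleftrightarrow> (\<forall>k\<in>I. nat \<bar>k\<bar> \<le> t \<longrightarrow> x k = y k)"

lemma agree_refl [simp]: "agree I t x x"
  and agree_sym: "agree I t x y \<Longrightarrow> agree I t y x"
  and agree_trans: "agree I t x y \<Longrightarrow> agree I t y z \<Longrightarrow> agree I t x z"
  by (auto simp: agree_def)

lemma agree_mono: "agree I t x y \<Longrightarrow> t' \<le> t \<Longrightarrow> agree I t' x y"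
  by (auto simp: agree_def)

lemma seq_dist_less_iff_agree:
  assumes "x \<in> I \<rightarrow>\<^sub>E A" "y \<in> I \<rightarrow>\<^sub>E A"
  shows "seq_dist I x y < (1/2) ^ t \<longleftrightarrow> agree I t x y"
proof (cases "x = y")
  case False
  then have "\<exists>t. \<exists>k\<in>I. nat \<bar>k\<bar> = t \<and> x k \<noteq> y k"
    using assms by (metis PiE_ext)
  then have D: "\<exists>k\<in>I. nat \<bar>k\<bar> = (LEAST t. \<exists>k\<in>I. nat \<bar>k\<bar> = t \<and> x k \<noteq> y k) \<and> x k \<noteq> y k"
    by (rule LeastI_ex)
  have "agree I t x y \<longleftrightarrow> t < (LEAST t. \<exists>k\<in>I. nat \<bar>k\<bar> = t \<and> x k \<noteq> y k)" (is "_ \<longleftrightarrow> t < ?L")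
  proof
    show "t < ?L" if "agree I t x y"
      using D that by (auto simp: agree_def not_le[symmetric])
    show "agree I t x y" if "t < ?L"
      unfolding agree_def
    proof (intro ballI impI)
      fix k assume "k \<in> I" "nat \<bar>k\<bar> \<le> t"
      then have "nat \<bar>k\<bar> < ?L" using that by simp
      from not_less_Least[OF this] show "x k = y k" using \<open>k \<in> I\<close> by blast
    qed
  qed
  then show ?thesis using False by (simp add: seq_dist_def power_strict_decreasing_iff)
qed (simp add: seq_dist_def)

lemma openin_full_shift:
  "openin (full_shift_topology I A) U \<longleftrightarrow>
     U \<subseteq> I \<rightarrow>\<^sub>E A \<and> (\<forall>x\<in>U. \<exists>t. \<forall>y\<in>I \<rightarrow>\<^sub>E A. agree I t x y \<longrightarrow> y \<in> U)"
proof -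
  interpret Metric_space "I \<rightarrow>\<^sub>E A" "seq_dist I" by (rule Metric_space_seq_dist)
  have "(\<exists>r>0. mball x r \<subseteq> U) \<longleftrightarrow> (\<exists>t. \<forall>y\<in>I \<rightarrow>\<^sub>E A. agree I t x y \<longrightarrow> y \<in> U)"
    if x: "x \<in> I \<rightarrow>\<^sub>E A" for x
  proof
    assume "\<exists>r>0. mball x r \<subseteq> U"
    then obtain r where r: "r > 0" "mball x r \<subseteq> U" by blast
    obtain t where "(1/2) ^ t < r" using real_arch_pow_inv[OF r(1), of "1/2"] by auto
    then have "y \<in> U" if "y \<in> I \<rightarrow>\<^sub>E A" "agree I t x y" for y
      using seq_dist_less_iff_agree[OF x that(1), of t] that r(2) x by (auto simp: subset_iff)
    then show "\<exists>t. \<forall>y\<in>I \<rightarrow>\<^sub>E A. agree I t x y \<longrightarrow> y \<in> U" by blast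
  next
    assume "\<exists>t. \<forall>y\<in>I \<rightarrow>\<^sub>E A. agree I t x y \<longrightarrow> y \<in> U"
    then obtain t where t: "\<forall>y\<in>I \<rightarrow>\<^sub>E A. agree I t x y \<longrightarrow> y \<in> U" by blast
    have "mball x ((1/2)^t) \<subseteq> U"
      using t seq_dist_less_iff_agree[OF x] by (auto simp: in_mball)
    then show "\<exists>r>0. mball x r \<subseteq> U" by (intro exI[of _ "(1/2)^t"]) simp
  qed
  then show ?thesis
    unfolding full_shift_topology_def openin_mtopology by blast
qed

lemma topspace_full_shift: "topspace (full_shift_topology I A) = I \<rightarrow>\<^sub>E A"
proof -
  interpret Metric_space "I \<rightarrow>\<^sub>E A" "seq_dist I" by (rule Metric_space_seq_dist)
  show ?thesis by (simp add: full_shift_topology_def)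
qed

text \<open>This identification makes Tychonoff's theorem available.\<close>

lemma full_shift_topology_eq_product:
  "full_shift_topology I A = product_topology (\<lambda>_. discrete_topology A) I"
proof (subst topology_eq, intro allI iffI)
  fix U assume U: "openin (full_shift_topology I A) U"
  show "openin (product_topology (\<lambda>_. discrete_topology A) I) U"
    unfolding openin_product_topology_alt
  proof
    fix x assume x: "x \<in> U"
    with U obtain t where t: "\<forall>y\<in>I \<rightarrow>\<^sub>E A. agree I t x y \<longrightarrow> y \<in> U"
      and xA: "x \<in> I \<rightarrow>\<^sub>E A" unfolding openin_full_shift by blast
    define V where "V i = (if nat \<bar>i\<bar> \<le> t then {x i} else A)" for i
    have "{i \<in> I. V i \<noteq> A} \<subseteq> {- int t..int t}" by (auto simp: V_def split: if_splits)
    then have "finite {i \<in> I. V i \<noteq> A}" by (rule finite_subset) simp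
    moreover have "V i \<subseteq> A" if "i \<in> I" for i using xA that by (auto simp: V_def)
    moreover have "x \<in> Pi\<^sub>E I V" using xA by (auto simp: V_def PiE_iff)
    moreover have "Pi\<^sub>E I V \<subseteq> U"
    proof
      fix y assume y: "y \<in> Pi\<^sub>E I V"
      have "y \<in> I \<rightarrow>\<^sub>E A" using PiE_mono[of I V "\<lambda>_. A"] calculation(2) y by blast
      moreover have "agree I t x y" using y by (force simp: agree_def V_def PiE_iff)
      ultimately show "y \<in> U" using t by blast
    qed
    ultimately show "\<exists>V. finite {i \<in> I. V i \<noteq> topspace (discrete_topology A)} \<and>
        (\<forall>i\<in>I. openin (discrete_topology A) (V i)) \<and> x \<in> Pi\<^sub>E I V \<and> Pi\<^sub>E I V \<subseteq> U"
      by (intro exI[of _ V]) simp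
  qed
next
  fix U assume U: "openin (product_topology (\<lambda>_. discrete_topology A) I) U"
  show "openin (full_shift_topology I A) U"
    unfolding openin_full_shift
  proof (intro conjI ballI)
    show "U \<subseteq> I \<rightarrow>\<^sub>E A" using openin_subset[OF U] by simp
    fix x assume "x \<in> U"
    then have "\<exists>V. finite {i \<in> I. V i \<noteq> topspace (discrete_topology A)} \<and>
        (\<forall>i\<in>I. openin (discrete_topology A) (V i)) \<and> x \<in> Pi\<^sub>E I V \<and> Pi\<^sub>E I V \<subseteq> U"
      using U unfolding openin_product_topology_alt by blast
    then obtain V where V: "finite {i \<in> I. V i \<noteq> A}" "\<forall>i\<in>I. V i \<subseteq> A" "x \<in> Pi\<^sub>E I V" "Pi\<^sub>E I V \<subseteq> U"
      unfolding topspace_discrete_topology openin_discrete_topology by blast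
    define t where "t = Max (insert 0 ((\<lambda>i. nat \<bar>i\<bar>) ` {i \<in> I. V i \<noteq> A}))"
    have t: "nat \<bar>i\<bar> \<le> t" if "i \<in> I" "V i \<noteq> A" for i
      unfolding t_def using V(1) that by (intro Max_ge) auto
    have "y \<in> U" if y: "y \<in> I \<rightarrow>\<^sub>E A" "agree I t x y" for y
    proof -
      have "y i \<in> V i" if "i \<in> I" for i
        using t[OF that] y V(3) that by (cases "V i = A") (auto simp: agree_def PiE_iff)
      then have "y \<in> Pi\<^sub>E I V" using y(1) by (simp add: PiE_iff)
      then show ?thesis using V(4) by blast
    qed
    then show "\<exists>t. \<forall>y\<in>I \<rightarrow>\<^sub>E A. agree I t x y \<longrightarrow> y \<in> U" by blast
  qed
qed

lemma initial_word_conv: "initial_word x n = map (\<lambda>i. x (int i + 1)) [0..<n]"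
  unfolding initial_word_def by (rule nth_equalityI) (auto simp: add.commute)

lemma length_initial_word [simp]: "length (initial_word x n) = n"
  by (simp add: initial_word_def)

lemma take_initial_word: "take k (initial_word x n) = initial_word x (min k n)"
  by (rule nth_equalityI) (auto simp: initial_word_conv)

locale shift_space =
  fixes I :: "int set" and A :: "'a set" and X :: "(int \<Rightarrow> 'a) set"
  assumes I: "I = {1..} \<or> I = UNIV" and finite_A: "finite A" and X: "subshift I A X"
begin

abbreviation T where "T \<equiv> shift_topology I A X"
abbreviation \<sigma> where "\<sigma> \<equiv> left_shift I"

lemma X_subset: "X \<subseteq> I \<rightarrow>\<^sub>E A"
  using X closedin_subset topspace_full_shift unfolding subshift_def by metis

lemma topspace_T [simp]: "topspace T = X"
  using X_subset by (auto simp: shift_topology_def topspace_full_shift)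

text \<open>All topological facts about \<open>X\<close> below are derived from this description by finite windows.\<close>

lemma openin_T: "openin T U \<longleftrightarrow> U \<subseteq> X \<and> (\<forall>x\<in>U. \<exists>t. \<forall>y\<in>X. agree I t x y \<longrightarrow> y \<in> U)"
proof
  assume "openin T U"
  then obtain V where V: "openin (full_shift_topology I A) V" "U = V \<inter> X"
    unfolding shift_topology_def openin_subtopology by blast
  then show "U \<subseteq> X \<and> (\<forall>x\<in>U. \<exists>t. \<forall>y\<in>X. agree I t x y \<longrightarrow> y \<in> U)"
    using X_subset unfolding openin_full_shift by (metis Int_iff inf.cobounded2 subsetD)
next
  assume U: "U \<subseteq> X \<and> (\<forall>x\<in>U. \<exists>t. \<forall>y\<in>X. agree I t x y \<longrightarrow> y \<in> U)"
  define V where "V = {z \<in> I \<rightarrow>\<^sub>E A. \<exists>x\<in>U. \<exists>t. agree I t x z \<and> (\<forall>y\<in>X. agree I t x y \<longrightarrow> y \<in> U)}"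
  have "openin (full_shift_topology I A) V"
    unfolding openin_full_shift
  proof (intro conjI ballI)
    fix z assume "z \<in> V"
    then obtain x t where x: "x \<in> U" "agree I t x z" "\<forall>y\<in>X. agree I t x y \<longrightarrow> y \<in> U"
      unfolding V_def by blast
    then show "\<exists>t. \<forall>y\<in>I \<rightarrow>\<^sub>E A. agree I t z y \<longrightarrow> y \<in> V"
      unfolding V_def using agree_trans[OF x(2)] by blast
  qed (auto simp: V_def)
  moreover have "U = V \<inter> X" using U X_subset unfolding V_def using agree_refl by blast
  ultimately show "openin T U" unfolding shift_topology_def openin_subtopology by blast
qed

lemma compact_T: "compact_space T"
proof -
  have "compact_space (full_shift_topology I A)"
    unfolding full_shift_topology_eq_product compact_space_product_topology
    using finite_A by (simp add: compact_space_discrete_topology)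
  then show ?thesis
    unfolding shift_topology_def
    using X by (intro compact_space_subtopology closedin_compact_space) (auto simp: subshift_def)
qed

lemma I_props: "1 \<in> I" "k \<in> I \<Longrightarrow> k + int j \<in> I" "0 < k \<Longrightarrow> k \<in> I"
  using I by auto

lemma shift_in: "x \<in> X \<Longrightarrow> (\<sigma> ^^ j) x \<in> X"
proof (induction j)
  case (Suc j)
  have "\<sigma> ` X \<subseteq> X" using X by (simp add: subshift_def)
  with Suc show ?case by (simp add: image_subset_iff)
qed simp

lemma shift_apply: "k \<in> I \<Longrightarrow> (\<sigma> ^^ j) x k = x (k + int j)"
proof (induction j arbitrary: k)
  case (Suc j)
  then have "(\<sigma> ^^ Suc j) x k = (\<sigma> ^^ j) x (k + 1)" by (simp add: left_shift_def)
  also have "\<dots> = x (k + 1 + int j)" using Suc I_props(2)[of k 1] by (intro Suc.IH) simp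
  finally show ?case by (simp add: ac_simps)
qed simp

lemma drop_initial_word: "drop j (initial_word x n) = initial_word ((\<sigma> ^^ j) x) (n - j)"
  by (rule nth_equalityI) (auto simp: initial_word_conv shift_apply I_props ac_simps)

lemma initial_word_add: "initial_word x (j + n) = initial_word x j @ initial_word ((\<sigma> ^^ j) x) n"
  using append_take_drop_id[of j "initial_word x (j + n)"]
  by (simp add: take_initial_word drop_initial_word)

lemma initial_word_Suc: "initial_word x (Suc n) = x 1 # initial_word (\<sigma> x) n"
  using initial_word_add[of x 1 n] by (simp add: initial_word_conv)

text \<open>\<open>\<sigma> x\<close> on the window \<open>-t..t\<close> is determined by \<open>x\<close> on the window \<open>-(t+1)..t+1\<close>.\<close>

lemma continuous_map_shift: "continuous_map T T \<sigma>"
  unfolding continuous_map_def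
proof (intro conjI allI impI)
  show "\<sigma> \<in> topspace T \<rightarrow> topspace T" using shift_in[of _ 1] by (simp add: Pi_iff)
  fix U assume U: "openin T U"
  show "openin T {x \<in> topspace T. \<sigma> x \<in> U}"
    unfolding openin_T
  proof (intro conjI ballI)
    fix x assume "x \<in> {x \<in> topspace T. \<sigma> x \<in> U}"
    then obtain t where t: "\<forall>y\<in>X. agree I t (\<sigma> x) y \<longrightarrow> y \<in> U" and "x \<in> X"
      using U unfolding openin_T by auto
    have "\<sigma> y \<in> U" if "y \<in> X" "agree I (t + 1) x y" for y
    proof -
      have "agree I t (\<sigma> x) (\<sigma> y)"
        unfolding agree_def
      proof (intro ballI impI)
        fix k assume k: "k \<in> I" "nat \<bar>k\<bar> \<le> t"
        have "x (k + 1) = y (k + 1)"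
          using that(2) k I_props(2)[of k 1] unfolding agree_def by auto
        then show "\<sigma> x k = \<sigma> y k" using k by (simp add: left_shift_def)
      qed
      then show ?thesis using t shift_in[OF that(1), of 1] by simp
    qed
    then show "\<exists>t. \<forall>y\<in>X. agree I t x y \<longrightarrow> y \<in> {x \<in> topspace T. \<sigma> x \<in> U}" by auto
  qed auto
qed

lemma window_clopen:
  "openin T {y \<in> X. agree I t x y}" "closedin T {y \<in> X. agree I t x y}"
proof -
  show "openin T {y \<in> X. agree I t x y}"
    unfolding openin_T
  proof (intro conjI ballI exI impI)
    fix y z assume "y \<in> {y \<in> X. agree I t x y}" "z \<in> X" "agree I t y z"
    then show "z \<in> {y \<in> X. agree I t x y}" using agree_trans[of I t x y z] by simp
  qed auto
  have "openin T (X - {y \<in> X. agree I t x y})"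
    unfolding openin_T
  proof (intro conjI ballI exI impI)
    fix y z assume "y \<in> X - {y \<in> X. agree I t x y}" "z \<in> X" "agree I t y z"
    then show "z \<in> X - {y \<in> X. agree I t x y}"
      using agree_trans[of I t x z y] agree_sym[of I t y z] by auto
  qed auto
  then show "closedin T {y \<in> X. agree I t x y}" unfolding closedin_def topspace_T by blast
qed

lemma finite_windows: "finite {{y \<in> X. agree I t x y} | x. x \<in> X}"
proof -
  let ?J = "{k \<in> I. nat \<bar>k\<bar> \<le> t}"
  have "?J \<subseteq> {- int t..int t}" by auto
  then have "finite ?J" by (rule finite_subset) simp
  have "{{y \<in> X. agree I t x y} | x. x \<in> X} \<subseteq> (\<lambda>u. {y \<in> X. \<forall>k\<in>?J. u k = y k}) ` (?J \<rightarrow>\<^sub>E A)"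
  proof (clarify)
    fix x assume "x \<in> X"
    then have "restrict x ?J \<in> ?J \<rightarrow>\<^sub>E A" using X_subset by (auto simp: PiE_iff)
    moreover have "{y \<in> X. agree I t x y} = {y \<in> X. \<forall>k\<in>?J. restrict x ?J k = y k}"
      by (auto simp: agree_def)
    ultimately show "{y \<in> X. agree I t x y} \<in> (\<lambda>u. {y \<in> X. \<forall>k\<in>?J. u k = y k}) ` (?J \<rightarrow>\<^sub>E A)" by blast
  qed
  then show ?thesis
    using \<open>finite ?J\<close> by (rule finite_subset[OF _ finite_imageI[OF finite_PiE]]) (simp_all add: finite_A)
qed

sublocale compact_zero_dim T
proof
  fix U assume U: "openin T U"
  define \<C> where "\<C> = {C \<in> (\<Union>t. {{y \<in> X. agree I t x y} | x. x \<in> X}). C \<subseteq> U}"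
  have "countable (\<Union>t. {{y \<in> X. agree I t x y} | x. x \<in> X})"
    using finite_windows by (intro countable_UN) (auto intro: countable_finite)
  then have "countable \<C>" by (rule countable_subset[rotated]) (auto simp: \<C>_def)
  moreover have "\<forall>C\<in>\<C>. openin T C \<and> closedin T C"
    using window_clopen unfolding \<C>_def by blast
  moreover have "U \<subseteq> \<Union>\<C>"
  proof
    fix x assume "x \<in> U"
    then obtain t where t: "\<forall>y\<in>X. agree I t x y \<longrightarrow> y \<in> U" and "x \<in> X"
      using U unfolding openin_T by blast
    then have "{y \<in> X. agree I t x y} \<in> \<C>" unfolding \<C>_def by blast
    moreover have "x \<in> {y \<in> X. agree I t x y}" using \<open>x \<in> X\<close> by simp
    ultimately show "x \<in> \<Union>\<C>" by blast
  qed
  moreover have "\<Union>\<C> \<subseteq> U" unfolding \<C>_def by blast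
  ultimately show "\<exists>\<C>. countable \<C> \<and> (\<forall>C\<in>\<C>. openin T C \<and> closedin T C) \<and> U = \<Union>\<C>" by blast
qed (rule compact_T)

lemma uniformly_window_continuous:
  assumes f: "continuous_map T euclideanreal f" and "\<epsilon> > 0"
  obtains t where "\<And>x y. x \<in> X \<Longrightarrow> y \<in> X \<Longrightarrow> agree I t x y \<Longrightarrow> \<bar>f x - f y\<bar> \<le> \<epsilon>"
proof -
  have "\<exists>t. \<forall>y\<in>X. agree I t x y \<longrightarrow> \<bar>f x - f y\<bar> < \<epsilon>/2" if "x \<in> X" for x
  proof -
    have "openin T {y \<in> topspace T. f y \<in> ball (f x) (\<epsilon>/2)}"
      by (rule openin_continuous_map_preimage[OF f]) simp
    then have "\<forall>z\<in>{y \<in> X. f y \<in> ball (f x) (\<epsilon>/2)}. \<exists>t. \<forall>y\<in>X. agree I t z y \<longrightarrow> y \<in> {y \<in> X. f y \<in> ball (f x) (\<epsilon>/2)}"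
      unfolding openin_T topspace_T by blast
    moreover have "x \<in> {y \<in> X. f y \<in> ball (f x) (\<epsilon>/2)}" using that \<open>\<epsilon> > 0\<close> by simp
    ultimately obtain t where "\<forall>y\<in>X. agree I t x y \<longrightarrow> y \<in> {y \<in> X. f y \<in> ball (f x) (\<epsilon>/2)}" by blast
    then show ?thesis by (auto simp: dist_real_def)
  qed
  then obtain t where t: "\<And>x y. x \<in> X \<Longrightarrow> y \<in> X \<Longrightarrow> agree I (t x) x y \<Longrightarrow> \<bar>f x - f y\<bar> < \<epsilon>/2" by metis
  let ?\<U> = "(\<lambda>x. {y \<in> X. agree I (t x) x y}) ` X"
  have "\<forall>U\<in>?\<U>. openin T U" using window_clopen(1) by blast
  moreover have "topspace T \<subseteq> \<Union>?\<U>" using agree_refl by force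
  ultimately obtain \<F> where "finite \<F>" "\<F> \<subseteq> ?\<U>" "topspace T \<subseteq> \<Union>\<F>"
    using compact_T unfolding compact_space_alt by meson
  moreover from this obtain D where "finite D" "D \<subseteq> X" "\<F> = (\<lambda>x. {y \<in> X. agree I (t x) x y}) ` D"
    using finite_subset_image by meson
  ultimately have D: "finite D" "D \<subseteq> X" "X \<subseteq> (\<Union>x\<in>D. {y \<in> X. agree I (t x) x y})"
    by simp_all
  have "\<bar>f x - f y\<bar> \<le> \<epsilon>" if "x \<in> X" "y \<in> X" "agree I (Max (insert 0 (t ` D))) x y" for x y
  proof -
    obtain z where z: "z \<in> D" "agree I (t z) z x" using D(3) \<open>x \<in> X\<close> by blast
    then have "t z \<le> Max (insert 0 (t ` D))" using D(1) by (intro Max_ge) auto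
    then have "agree I (t z) z y" using agree_trans[OF z(2) agree_mono[OF that(3)]] by blast
    then have "\<bar>f z - f y\<bar> < \<epsilon>/2" "\<bar>f z - f x\<bar> < \<epsilon>/2" using t z D(2) that by auto
    then show ?thesis by linarith
  qed
  then show thesis by (rule that)
qed

end

section \<open>Additive functionals of words and edits\<close>

text \<open>Birkhoff sums are replaced by this functional of words. Letting \<open>F\<close> also act on the
  truncated blocks at the end of the word keeps the recursion free of side conditions.\<close>

fun block_sum :: "nat \<Rightarrow> ('a list \<Rightarrow> real) \<Rightarrow> 'a list \<Rightarrow> real" where
  "block_sum k F [] = 0"
| "block_sum k F (a # w) = F (take k (a # w)) + block_sum k F w"

lemma block_sum_bound:
  assumes "\<And>u. \<bar>F u\<bar> \<le> B" shows "\<bar>block_sum k F w\<bar> \<le> B * length w"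
proof (induction w)
  case (Cons a w)
  then show ?case using assms[of "take k (a # w)"] by (auto simp: algebra_simps)
qed simp

text \<open>Only the last \<open>k\<close> letters of \<open>v\<close> have blocks that reach into \<open>w\<close>.\<close>

lemma block_sum_append:
  assumes F: "\<And>u. \<bar>F u\<bar> \<le> B"
  shows "\<bar>block_sum k F (v @ w) - block_sum k F v - block_sum k F w\<bar> \<le> 2 * B * k"
proof -
  have B: "0 \<le> B" using F[of "[]"] by linarith
  have "\<bar>block_sum k F (v @ w) - block_sum k F v - block_sum k F w\<bar> \<le> 2 * B * min (length v) k"
  proof (induction v)
    case (Cons a v)
    show ?case
    proof (cases "k \<le> length (a # v)")
      case True
      have "min (length v) k \<le> min (length (a # v)) k" by simp
      then have "2 * B * min (length v) k \<le> 2 * B * min (length (a # v)) k"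
        using B by (intro mult_left_mono) auto
      moreover have "take k ((a # v) @ w) = take k (a # v)" using True by (simp only: take_append) simp
      ultimately show ?thesis using Cons by simp
    next
      case False
      then show ?thesis
        using Cons F[of "take k (a # v @ w)"] F[of "take k (a # v)"] by (simp add: algebra_simps)
    qed
  qed simp
  also have "\<dots> \<le> 2 * B * k" using B by (intro mult_left_mono) auto
  finally show ?thesis .
qed

text \<open>Cutting the word around the edited letter costs \<open>4Bk\<close>, and the letter itself contributes at
  most \<open>B\<close>; for a substitution this happens twice.\<close>

lemma block_sum_edit:
  assumes F: "\<And>u. \<bar>F u\<bar> \<le> B" and "edit A v w"
  shows "\<bar>block_sum k F v - block_sum k F w\<bar> \<le> 2 * B * (4 * k + 1)"
proof -
  note app = block_sum_append[of F B k, OF F]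
  have B: "0 \<le> B" using F[of "[]"] by linarith
  then have "0 \<le> B * k" by simp
  have one: "\<bar>block_sum k F (xs @ [a] @ ys) - block_sum k F xs - block_sum k F ys\<bar> \<le> 4 * B * k + B" for xs a ys
    using app[of xs "[a] @ ys"] app[of "[a]" ys] F[of "take k [a]"] by simp
  from \<open>edit A v w\<close> show ?thesis
  proof cases
    case (substitute b a xs ys)
    then show ?thesis using one[of xs a ys] one[of xs b ys] by (simp add: algebra_simps)
  next
    case (insert b xs ys)
    then show ?thesis using one[of xs b ys] app[of xs ys] \<open>0 \<le> B * k\<close> B by (simp add: algebra_simps)
  next
    case (delete xs a ys)
    then show ?thesis using one[of xs a ys] app[of xs ys] \<open>0 \<le> B * k\<close> B by (simp add: algebra_simps)
  qed
qed

lemma edit_steps_bound: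
  assumes "\<And>v w. edit A v w \<Longrightarrow> \<bar>h v - h w\<bar> \<le> (D :: real)" "(edit A ^^ n) v w"
  shows "\<bar>h v - h w\<bar> \<le> n * D"
  using assms(2)
proof (induction n arbitrary: w)
  case (Suc n)
  then obtain u where "(edit A ^^ n) v u" "edit A u w" by auto
  then show ?case using Suc.IH[of u] assms(1)[of u w] by (simp add: algebra_simps)
qed simp

lemma edit_steps_length:
  assumes "(edit A ^^ n) v w" shows "length v \<le> length w + n" "length w \<le> length v + n"
proof -
  have "\<bar>real (length v) - real (length w)\<bar> \<le> real n * 1"
    using assms by (rule edit_steps_bound[rotated]) (auto elim!: edit.cases)
  then show "length v \<le> length w + n" "length w \<le> length v + n" by linarith+
qed

text \<open>The minimum in the definition of the edit distance is attained, because deleting all letters of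
  \<open>v\<close> and then inserting those of \<open>w\<close> is a possible sequence of edits.\<close>

lemma edit_steps_edit_dist:
  assumes "v \<in> lists A" "w \<in> lists A"
  shows "(edit A ^^ edit_dist A v w) v w"
proof -
  have del: "(edit A ^^ length v) v []" for v
  proof (induction v)
    case (Cons a v)
    have "edit A (a # v) v" using edit.delete[of A "[]" a v] by simp
    then show ?case using Cons by (metis length_Cons relpowp_Suc_I2)
  qed simp
  have ins: "(edit A ^^ length w) [] w" if "w \<in> lists A" for w
    using that
  proof (induction w)
    case (Cons a w)
    then have "edit A w (a # w)" using edit.insert[of a A "[]" w] by simp
    then show ?case using Cons by auto
  qed simp
  have "(edit A ^^ (length v + length w)) v w"
    using del[of v] ins[OF assms(2)] by (auto simp: relpowp_add)
  then show ?thesis unfolding edit_dist_def by (rule LeastI)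
qed

subsection \<open>Counting words within a small edit distance\<close>

lemma subseq_remove_one:
  assumes "subseq s (xs @ [a] @ ys)"
  obtains s' where "subseq s' s" "subseq s' (xs @ ys)" "length s \<le> Suc (length s')"
proof -
  obtain s1 s2 where s: "s = s1 @ s2" "subseq s1 xs" "subseq s2 ([a] @ ys)"
    using assms subseq_appendE by blast
  show thesis
  proof (cases "subseq s2 ys")
    case True
    then show thesis using s list_emb_append_mono by (intro that[of s]) auto
  next
    case False
    then obtain s3 where "s2 = a # s3" "subseq s3 ys"
      using s(3) by (cases s2) (auto split: if_splits elim: list_emb.cases)
    then show thesis using s by (intro that[of "s1 @ s3"]) (auto intro: list_emb_append_mono)
  qed
qed

text \<open>A sequence of \<open>n\<close> edits destroys at most \<open>n\<close> letters of a word; what survives is a common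
  subsequence. Unlike the edits themselves, subsequences are easy to count.\<close>

lemma edit_steps_common_subseq:
  assumes "(edit A ^^ n) v w"
  shows "\<exists>s. subseq s v \<and> subseq s w \<and> length v \<le> length s + n \<and> length w \<le> length s + n"
  using assms
proof (induction n arbitrary: w)
  case (Suc n)
  then obtain u where u: "(edit A ^^ n) v u" "edit A u w" by auto
  then obtain s where s: "subseq s v" "subseq s u" "length v \<le> length s + n" "length u \<le> length s + n"
    using Suc.IH by blast
  from u(2) show ?case
  proof cases
    case (substitute b a xs ys)
    with s(2) obtain s' where s': "subseq s' s" "subseq s' (xs @ ys)" "length s \<le> Suc (length s')"
      using subseq_remove_one by metis
    have "subseq s' w" using s'(2) substitute subseq_order.trans[OF s'(2)]
      by (metis list_emb_append_mono list_emb_append2 subseq_order.order_refl)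
    then show ?thesis using s s' substitute
      by (intro exI[of _ s']) (auto intro: subseq_order.trans)
  next
    case (insert b xs ys)
    have "subseq u w" using insert by (metis list_emb_append_mono list_emb_append2 subseq_order.order_refl)
    then show ?thesis using s insert by (intro exI[of _ s]) (auto intro: subseq_order.trans)
  next
    case (delete xs a ys)
    with s(2) obtain s' where s': "subseq s' s" "subseq s' (xs @ ys)" "length s \<le> Suc (length s')"
      using subseq_remove_one by metis
    then show ?thesis using s delete
      by (intro exI[of _ s']) (auto intro: subseq_order.trans)
  qed
qed auto

lemma finite_subseqs: "finite {s. subseq s v}"
  by (rule finite_subset[of _ "set (List.subseqs v)"]) auto

text \<open>Weighting every dropped letter by \<open>z\<close> turns the count into a product over the letters of \<open>v\<close>, each
  of which is kept or dropped; a word with at most \<open>g\<close> dropped letters has weight at least \<open>z\<^sup>g\<close>.\<close>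

lemma card_long_subseqs:
  fixes z :: real assumes z: "0 < z" "z \<le> 1"
  shows "z ^ g * card {s. subseq s v \<and> length v \<le> length s + g} \<le> (1 + z) ^ length v"
proof (induction v arbitrary: g)
  case Nil
  have "{s. subseq s [] \<and> length [] \<le> length s + g} = {[]}" by auto
  then have one: "card {s. subseq s [] \<and> length [] \<le> length s + g} = 1"
    by (metis is_singleton_altdef is_singletonI)
  show ?case unfolding one using z by (simp add: power_le_one)
next
  case (Cons a v)
  let ?S = "\<lambda>v g. {s. subseq s v \<and> length v \<le> length s + g}"
  have fin: "finite (?S v g)" for v g by (rule finite_subset[OF _ finite_subseqs[of v]]) auto
  have fin': "finite (if g = 0 then {} else ?S v (g - 1))"
  proof (cases "g = 0")
    case False
    then show ?thesis using fin[of v "g - 1"] by simp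
  qed simp
  have "?S (a # v) g \<subseteq> (#) a ` ?S v g \<union> (if g = 0 then {} else ?S v (g - 1))"
  proof
    fix s assume s: "s \<in> ?S (a # v) g"
    show "s \<in> (#) a ` ?S v g \<union> (if g = 0 then {} else ?S v (g - 1))"
    proof (cases "subseq s v")
      case True
      then have "length s \<le> length v" by (rule list_emb_length)
      then show ?thesis using s True by auto
    next
      case False
      then obtain s' where "s = a # s'" "subseq s' v"
        using s by (cases s) (auto split: if_splits elim: list_emb.cases)
      then show ?thesis using s by auto
    qed
  qed
  then have "card (?S (a # v) g) \<le> card ((#) a ` ?S v g \<union> (if g = 0 then {} else ?S v (g - 1)))"
    by (intro card_mono finite_UnI finite_imageI fin fin')
  also have "\<dots> \<le> card ((#) a ` ?S v g) + card (if g = 0 then {} else ?S v (g - 1))" by (rule card_Un_le)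
  also have "card ((#) a ` ?S v g) \<le> card (?S v g)" using fin by (rule card_image_le)
  finally have "z ^ g * real (card (?S (a # v) g)) \<le>
      z ^ g * (real (card (?S v g)) + real (card (if g = 0 then {} else ?S v (g - 1))))"
    using z by (intro mult_left_mono) auto
  also have "\<dots> \<le> (1 + z) ^ length v + z * (1 + z) ^ length v"
  proof (cases g)
    case 0
    have "real (card (?S v 0)) \<le> (1 + z) ^ length v" using Cons[of 0] by simp
    then show ?thesis using z 0 by (simp add: add_increasing2)
  next
    case (Suc h)
    then have "z * (z ^ h * card (?S v h)) \<le> z * (1 + z) ^ length v"
      using Cons[of h] z by (intro mult_left_mono) auto
    then show ?thesis using Cons[of g] Suc by (simp add: distrib_left mult.assoc)
  qed
  finally show ?case by (simp add: distrib_right)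
qed

lemma finite_words: "finite A \<Longrightarrow> finite {w \<in> lists A. length w = n}"
  using finite_lists_length_eq[of A n] by (simp add: lists_eq_set conj_commute)

text \<open>The same weighting for inserted letters: reading \<open>w\<close> from the left, every letter either matches
  the next letter of \<open>s\<close> or is one of \<open>card A\<close> insertions of weight \<open>z\<close>.\<close>

lemma card_superseqs:
  fixes z :: real
  assumes A: "finite A" and z: "0 < z"
  shows "z ^ (n - length s) * card {w \<in> lists A. length w = n \<and> subseq s w} \<le> (1 + card A * z) ^ n"
proof (induction n arbitrary: s)
  case 0
  have "{w \<in> lists A. length w = 0 \<and> subseq s w} \<subseteq> {[]}" by auto
  from card_mono[OF _ this] show ?case by simp
next
  case (Suc n)
  let ?S = "\<lambda>s n. {w \<in> lists A. length w = n \<and> subseq s w}"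
  let ?c = "real (card A)"
  have fin: "finite (?S s n)" for s n by (rule finite_subset[OF _ finite_words[OF A, of n]]) auto
  let ?P = "case s of [] \<Rightarrow> {} | a # s' \<Rightarrow> (#) a ` ?S s' n"
  have "?S s (Suc n) \<subseteq> ?P \<union> (\<lambda>(b, w). b # w) ` (A \<times> ?S s n)"
  proof
    fix w assume w: "w \<in> ?S s (Suc n)"
    then obtain b w' where bw: "w = b # w'" "b \<in> A" "w' \<in> lists A" "length w' = n" by (cases w) auto
    show "w \<in> ?P \<union> (\<lambda>(b, w). b # w) ` (A \<times> ?S s n)"
    proof (cases "subseq s w'")
      case True
      then show ?thesis using bw by force
    next
      case False
      then obtain s' where "s = b # s'" "subseq s' w'"
        using w bw by (cases s) (auto split: if_splits elim: list_emb.cases)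
      then show ?thesis using bw by auto
    qed
  qed
  moreover have finP: "finite ?P" using fin by (auto split: list.split)
  ultimately have "card (?S s (Suc n)) \<le> card (?P \<union> (\<lambda>(b, w). b # w) ` (A \<times> ?S s n))"
    using fin A by (intro card_mono) auto
  also have "\<dots> \<le> card ?P + card ((\<lambda>(b, w). b # w) ` (A \<times> ?S s n))" by (rule card_Un_le)
  also have "card ((\<lambda>(b, w). b # w) ` (A \<times> ?S s n)) \<le> card A * card (?S s n)"
    using card_image_le[of "A \<times> ?S s n" "\<lambda>(b, w). b # w"] fin A by (simp add: card_cartesian_product)
  finally have "z ^ (Suc n - length s) * real (card (?S s (Suc n))) \<le>
      z ^ (Suc n - length s) * real (card ?P + card A * card (?S s n))"
    using z by (intro mult_left_mono) (auto simp del: of_nat_add of_nat_mult)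
  also have "\<dots> = z ^ (Suc n - length s) * card ?P + z ^ (Suc n - length s) * (?c * card (?S s n))"
    by (simp add: distrib_left)
  also have "\<dots> \<le> (1 + ?c * z) ^ n + ?c * z * (1 + ?c * z) ^ n"
  proof (rule add_mono)
    show "z ^ (Suc n - length s) * card ?P \<le> (1 + ?c * z) ^ n"
    proof (cases s)
      case (Cons a s')
      have "card ?P \<le> card (?S s' n)" using Cons fin by (auto intro: card_image_le)
      then have "z ^ (n - length s') * real (card ?P) \<le> z ^ (n - length s') * card (?S s' n)"
        using z by (intro mult_left_mono) auto
      then show ?thesis using Suc[of s'] Cons by simp
    qed (use z in simp)
    show "z ^ (Suc n - length s) * (?c * card (?S s n)) \<le> ?c * z * (1 + ?c * z) ^ n"
    proof (cases "length s \<le> n")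
      case True
      then have "z ^ (Suc n - length s) * (?c * card (?S s n)) = ?c * z * (z ^ (n - length s) * card (?S s n))"
        by (simp add: Suc_diff_le)
      also have "\<dots> \<le> ?c * z * (1 + ?c * z) ^ n"
        using z Suc[of s] by (intro mult_left_mono) auto
      finally show ?thesis .
    next
      case False
      then have "?S s n = {}" by (auto dest: list_emb_length)
      then show ?thesis using z by (simp only:) simp
    qed
  qed
  finally show ?case by (simp add: distrib_right)
qed

text \<open>The factor \<open>z\<^bsup>-2g\<^esup>\<close> is the price for the mistakes and \<open>(1 + z)\<close>-powers bound the choices of
  their positions. For fixed small \<open>z\<close> this is \<open>exp (\<delta> n)\<close> as soon as \<open>g\<close> is a small proportion
  of \<open>n\<close>, whereas counting edits one after the other would lose a factor \<open>n\<^bsup>g\<^esup>\<close>.\<close>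

lemma card_edit_ball:
  fixes z :: real
  assumes A: "finite A" and z: "0 < z" "z \<le> 1"
  shows "z ^ (2 * g) * card {w \<in> lists A. length w = n \<and> (\<exists>d\<le>g. (edit A ^^ d) v w)}
    \<le> (1 + z) ^ length v * (1 + card A * z) ^ n"
proof -
  let ?W = "{w \<in> lists A. length w = n \<and> (\<exists>d\<le>g. (edit A ^^ d) v w)}"
  let ?S = "{s. subseq s v \<and> length v \<le> length s + g}"
  let ?R = "\<lambda>s. {w \<in> lists A. length w = n \<and> subseq s w}"
  have finS: "finite ?S" by (rule finite_subset[OF _ finite_subseqs[of v]]) auto
  have finS': "finite {s\<in>?S. n \<le> length s + g}" by (rule finite_subset[OF _ finS]) blast
  have finR: "finite (?R s)" for s by (rule finite_subset[OF _ finite_words[OF A, of n]]) auto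
  have "?W \<subseteq> (\<Union>s\<in>{s\<in>?S. n \<le> length s + g}. ?R s)"
  proof
    fix w assume "w \<in> ?W"
    then obtain d where d: "d \<le> g" "(edit A ^^ d) v w" "w \<in> lists A" "length w = n" by auto
    obtain s where "subseq s v" "subseq s w" "length v \<le> length s + d" "length w \<le> length s + d"
      using edit_steps_common_subseq[OF d(2)] by blast
    then show "w \<in> (\<Union>s\<in>{s\<in>?S. n \<le> length s + g}. ?R s)" using d by auto
  qed
  then have "card ?W \<le> card (\<Union>s\<in>{s\<in>?S. n \<le> length s + g}. ?R s)"
    using finS' finR by (intro card_mono finite_UN_I)
  also have "\<dots> \<le> (\<Sum>s\<in>{s\<in>?S. n \<le> length s + g}. card (?R s))"
    using finS' by (rule card_UN_le)
  finally have "z ^ (2 * g) * real (card ?W) \<le> z ^ (2 * g) * real (\<Sum>s\<in>{s\<in>?S. n \<le> length s + g}. card (?R s))"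
    using z by (intro mult_left_mono) (auto simp del: of_nat_sum)
  also have "\<dots> = (\<Sum>s\<in>{s\<in>?S. n \<le> length s + g}. z ^ g * (z ^ g * card (?R s)))"
    by (simp add: sum_distrib_left mult_2 power_add mult.assoc)
  also have "\<dots> \<le> (\<Sum>s\<in>{s\<in>?S. n \<le> length s + g}. z ^ g * (1 + card A * z) ^ n)"
  proof (intro sum_mono mult_left_mono)
    fix s assume s: "s \<in> {s\<in>?S. n \<le> length s + g}"
    have "z ^ g * card (?R s) \<le> z ^ (n - length s) * card (?R s)"
      using s z by (intro mult_right_mono power_decreasing) auto
    also have "\<dots> \<le> (1 + card A * z) ^ n" by (rule card_superseqs[OF A z(1)])
    finally show "z ^ g * card (?R s) \<le> (1 + card A * z) ^ n" .
  qed (use z in auto)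
  also have "\<dots> \<le> (\<Sum>s\<in>?S. z ^ g * (1 + card A * z) ^ n)"
    using z by (intro sum_mono2 finS) (auto simp: zero_le_mult_iff)
  also have "\<dots> = (z ^ g * card ?S) * (1 + card A * z) ^ n" by simp
  also have "\<dots> \<le> (1 + z) ^ length v * (1 + card A * z) ^ n"
    using card_long_subseqs[OF z, of g v] z by (intro mult_right_mono) auto
  finally show ?thesis .
qed

section \<open>Typical sequences\<close>

definition sequences :: "'b set \<Rightarrow> nat \<Rightarrow> 'b list set" where
  "sequences S N = {ws \<in> lists S. length ws = N}"

lemma finite_sequences: "finite S \<Longrightarrow> finite (sequences S N)"
  unfolding sequences_def by (rule finite_words)

lemma sequences_0 [simp]: "sequences S 0 = {[]}"
  by (auto simp: sequences_def)

lemma sequences_Suc: "sequences S (Suc N) = (\<lambda>(a, ws). a # ws) ` (S \<times> sequences S N)"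
  by (auto simp: sequences_def length_Suc_conv image_iff)

lemma sum_sequences_Suc:
  "(\<Sum>ws\<in>sequences S (Suc N). h ws) = (\<Sum>a\<in>S. \<Sum>ws\<in>sequences S N. h (a # ws))"
  unfolding sequences_Suc sum.cartesian_product
  by (subst sum.reindex) (auto simp: inj_on_def split_def)

lemma sum_UN_le:
  fixes h :: "'c \<Rightarrow> real"
  assumes "finite J" "\<And>j. j \<in> J \<Longrightarrow> finite (B j)" "\<And>j x. j \<in> J \<Longrightarrow> x \<in> B j \<Longrightarrow> 0 \<le> h x"
  shows "sum h (\<Union>j\<in>J. B j) \<le> (\<Sum>j\<in>J. sum h (B j))"
  using assms
proof (induction J rule: finite_induct)
  case (insert i J)
  have "sum h (B i \<union> (\<Union>j\<in>J. B j)) + sum h (B i \<inter> (\<Union>j\<in>J. B j)) = sum h (B i) + sum h (\<Union>j\<in>J. B j)"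
    using insert by (intro sum.union_inter) auto
  moreover have "0 \<le> sum h (B i \<inter> (\<Union>j\<in>J. B j))" using insert.prems by (intro sum_nonneg) auto
  moreover have "sum h (\<Union>j\<in>J. B j) \<le> (\<Sum>j\<in>J. sum h (B j))"
    using insert.IH insert.prems by blast
  ultimately show ?case using insert.hyps by simp
qed simp

text \<open>Independent draws from a distribution on a finite set are handled by finite sums over lists.\<close>

locale finite_distribution =
  fixes S :: "'b set" and p :: "'b \<Rightarrow> real"
  assumes finite_S: "finite S" and p_nonneg: "\<And>a. a \<in> S \<Longrightarrow> 0 \<le> p a" and p_sum: "(\<Sum>a\<in>S. p a) = 1"
begin

definition weight :: "'b list \<Rightarrow> real" where
  "weight ws = prod_list (map p ws)"

definition mean :: "('b \<Rightarrow> real) \<Rightarrow> real" where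
  "mean Y = (\<Sum>a\<in>S. p a * Y a)"

lemma weight_simps [simp]: "weight [] = 1" "weight (a # ws) = p a * weight ws"
  by (simp_all add: weight_def)

lemma weight_nonneg: "ws \<in> sequences S N \<Longrightarrow> 0 \<le> weight ws"
  by (induction ws arbitrary: N) (auto simp: sequences_def p_nonneg)

lemma weight_total: "(\<Sum>ws\<in>sequences S N. weight ws) = 1"
  by (induction N) (simp_all add: sum_sequences_Suc sum_distrib_left[symmetric] p_sum)

text \<open>Mean and variance of a sum of \<open>N\<close> independent centred variables.\<close>

lemma sequence_sum_centred:
  assumes "mean Y = 0"
  shows "(\<Sum>ws\<in>sequences S N. weight ws * sum_list (map Y ws)) = 0"
    and "(\<Sum>ws\<in>sequences S N. weight ws * (sum_list (map Y ws))\<^sup>2) = N * mean (\<lambda>a. (Y a)\<^sup>2)"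
proof -
  show 1: "(\<Sum>ws\<in>sequences S N. weight ws * sum_list (map Y ws)) = 0" for N
  proof (induction N)
    case (Suc N)
    have "(\<Sum>ws\<in>sequences S (Suc N). weight ws * sum_list (map Y ws)) =
      (\<Sum>a\<in>S. p a * Y a * (\<Sum>ws\<in>sequences S N. weight ws)
          + p a * (\<Sum>ws\<in>sequences S N. weight ws * sum_list (map Y ws)))"
      by (simp add: sum_sequences_Suc sum_distrib_left algebra_simps sum.distrib)
    then show ?case using assms Suc by (simp add: weight_total mean_def)
  qed simp
  show "(\<Sum>ws\<in>sequences S N. weight ws * (sum_list (map Y ws))\<^sup>2) = N * mean (\<lambda>a. (Y a)\<^sup>2)"
  proof (induction N)
    case (Suc N)
    have "(\<Sum>ws\<in>sequences S (Suc N). weight ws * (sum_list (map Y ws))\<^sup>2) =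
      (\<Sum>a\<in>S. p a * (Y a)\<^sup>2 * (\<Sum>ws\<in>sequences S N. weight ws)
          + 2 * (p a * Y a) * (\<Sum>ws\<in>sequences S N. weight ws * sum_list (map Y ws))
          + p a * (\<Sum>ws\<in>sequences S N. weight ws * (sum_list (map Y ws))\<^sup>2))"
      by (simp add: sum_sequences_Suc sum_distrib_left algebra_simps sum.distrib power2_eq_square)
    also have "\<dots> = mean (\<lambda>a. (Y a)\<^sup>2) + (\<Sum>a\<in>S. p a) * (N * mean (\<lambda>a. (Y a)\<^sup>2))"
      unfolding 1 Suc weight_total mean_def by (simp add: sum.distrib sum_distrib_right)
    finally show ?case by (simp add: p_sum algebra_simps)
  qed simp
qed

lemma mean_add_const: "mean (\<lambda>a. Y a - c) = mean Y - c"
  by (simp add: mean_def right_diff_distrib sum_subtractf p_sum sum_distrib_right[symmetric])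

lemma sum_list_map_diff_const:
  fixes Y :: "_ \<Rightarrow> real"
  shows "sum_list (map (\<lambda>a. Y a - c) ws) = sum_list (map Y ws) - real (length ws) * c"
  by (induction ws) (simp_all add: algebra_simps)

lemma atypical_weight:
  assumes "0 < \<epsilon>" "0 < N"
  shows "(\<Sum>ws\<in>{ws \<in> sequences S N. \<bar>sum_list (map Y ws) - N * mean Y\<bar> > \<epsilon> * N}. weight ws)
    \<le> mean (\<lambda>a. (Y a - mean Y)\<^sup>2) / \<epsilon>\<^sup>2 / N"
proof -
  let ?Z = "\<lambda>a. Y a - mean Y" and ?B = "{ws \<in> sequences S N. \<bar>sum_list (map Y ws) - N * mean Y\<bar> > \<epsilon> * N}"
  have B: "finite ?B" "?B \<subseteq> sequences S N" using finite_sequences[OF finite_S] by auto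
  have "(\<epsilon> * N)\<^sup>2 * (\<Sum>ws\<in>?B. weight ws) = (\<Sum>ws\<in>?B. weight ws * (\<epsilon> * N)\<^sup>2)"
    by (simp add: sum_distrib_left mult.commute)
  also have "\<dots> \<le> (\<Sum>ws\<in>?B. weight ws * (sum_list (map ?Z ws))\<^sup>2)"
  proof (intro sum_mono mult_left_mono)
    fix ws assume ws: "ws \<in> ?B"
    then have "sum_list (map ?Z ws) = sum_list (map Y ws) - N * mean Y"
      by (subst sum_list_map_diff_const) (simp add: sequences_def)
    then have "\<bar>\<epsilon> * N\<bar> \<le> \<bar>sum_list (map ?Z ws)\<bar>" using ws assms by simp
    then show "(\<epsilon> * N)\<^sup>2 \<le> (sum_list (map ?Z ws))\<^sup>2" by (simp only: abs_le_square_iff)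
    show "0 \<le> weight ws" using ws weight_nonneg by blast
  qed
  also have "\<dots> \<le> (\<Sum>ws\<in>sequences S N. weight ws * (sum_list (map ?Z ws))\<^sup>2)"
    using B finite_sequences[OF finite_S] weight_nonneg by (intro sum_mono2) auto
  also have "\<dots> = N * mean (\<lambda>a. (Y a - mean Y)\<^sup>2)"
    by (rule sequence_sum_centred) (simp add: mean_add_const)
  finally have "\<epsilon>\<^sup>2 * N * N * (\<Sum>ws\<in>?B. weight ws) \<le> mean (\<lambda>a. (Y a - mean Y)\<^sup>2) * N"
    by (simp add: power_mult_distrib power2_eq_square ac_simps)
  then have "\<epsilon>\<^sup>2 * N * (\<Sum>ws\<in>?B. weight ws) \<le> mean (\<lambda>a. (Y a - mean Y)\<^sup>2)"
    using assms by (simp add: mult.commute mult.left_commute)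
  then show ?thesis using assms by (simp add: field_simps)
qed

text \<open>By Chebyshev's inequality the sequences along which finitely many averages are close to
  their means carry at least half of the product measure. Applied to \<open>- ln p\<close> as well, each of
  them has weight at most \<open>exp (- N (H - \<epsilon>/2))\<close>, so there must be many.\<close>

theorem typical_sequences:
  fixes \<Y> :: "('b \<Rightarrow> real) set"
  assumes "finite \<Y>" and \<epsilon>: "0 < \<epsilon>"
  shows "\<forall>\<^sub>F N in sequentially. exp (real N * ((\<Sum>a\<in>S. - p a * ln (p a)) - \<epsilon>)) \<le>
    real (card {ws \<in> sequences S N. \<forall>Y\<in>\<Y>. \<bar>sum_list (map Y ws) - real N * mean Y\<bar> \<le> \<epsilon> * real N})"
proof -
  define I where "I = (\<lambda>a. - ln (p a))"
  define H where "H = (\<Sum>a\<in>S. - p a * ln (p a))"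
  have H: "H = mean I" by (simp add: H_def mean_def I_def)
  define V where "V = (\<Sum>Y\<in>insert I \<Y>. mean (\<lambda>a. (Y a - mean Y)\<^sup>2) / (\<epsilon>/2)\<^sup>2)"
  have "\<forall>\<^sub>F N in sequentially. V / real N < 1/2"
    using lim_const_over_n[of V] by (rule order_tendstoD) simp
  moreover have "\<forall>\<^sub>F N in sequentially. 2 * ln 2 / \<epsilon> \<le> real N"
    using filterlim_real_sequentially by (simp add: filterlim_at_top)
  moreover have "\<forall>\<^sub>F N in sequentially. 0 < (N::nat)" by (rule eventually_gt_at_top)
  ultimately show ?thesis
  proof eventually_elim
    case (elim N)
    let ?Q = "sequences S N"
    let ?T = "{ws \<in> ?Q. \<forall>Y\<in>\<Y>. \<bar>sum_list (map Y ws) - real N * mean Y\<bar> \<le> \<epsilon> * real N}"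
    let ?B = "\<lambda>Y. {ws \<in> ?Q. \<bar>sum_list (map Y ws) - N * mean Y\<bar> > \<epsilon>/2 * N}"
    let ?P = "{ws \<in> ?Q. \<forall>Y\<in>insert I \<Y>. ws \<notin> ?B Y}"
    have fQ: "finite ?Q" by (rule finite_sequences[OF finite_S])
    have "(\<Sum>ws\<in>(\<Union>Y\<in>insert I \<Y>. ?B Y). weight ws) \<le> (\<Sum>Y\<in>insert I \<Y>. \<Sum>ws\<in>?B Y. weight ws)"
      using fQ assms(1) weight_nonneg by (intro sum_UN_le) auto
    also have "\<dots> \<le> (\<Sum>Y\<in>insert I \<Y>. mean (\<lambda>a. (Y a - mean Y)\<^sup>2) / (\<epsilon>/2)\<^sup>2 / N)"
      using \<epsilon> elim(3) by (intro sum_mono atypical_weight) auto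
    also have "\<dots> = V / N" by (simp add: V_def sum_divide_distrib)
    finally have bad: "(\<Sum>ws\<in>(\<Union>Y\<in>insert I \<Y>. ?B Y). weight ws) < 1/2" using elim(1) by linarith
    have "?Q = ?P \<union> (\<Union>Y\<in>insert I \<Y>. ?B Y)" by auto
    then have "1 = (\<Sum>ws\<in>?P \<union> (\<Union>Y\<in>insert I \<Y>. ?B Y). weight ws)" using weight_total[of N] by simp
    also have "\<dots> = (\<Sum>ws\<in>?P. weight ws) + (\<Sum>ws\<in>(\<Union>Y\<in>insert I \<Y>. ?B Y). weight ws)"
      using fQ assms(1) by (intro sum.union_disjoint) auto
    finally have "1/2 \<le> (\<Sum>ws\<in>?P. weight ws)" using bad by linarith
    also have "\<dots> \<le> (\<Sum>ws\<in>?P. exp (- real N * (H - \<epsilon>/2)))"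
    proof (rule sum_mono)
      fix ws assume ws: "ws \<in> ?P"
      show "weight ws \<le> exp (- real N * (H - \<epsilon>/2))"
      proof (cases "\<exists>a\<in>set ws. p a = 0")
        case True
        then have "weight ws = 0" by (auto simp: weight_def prod_list_zero_iff)
        then show ?thesis by simp
      next
        case False
        have "set ws \<subseteq> S" using ws by (auto simp: sequences_def)
        with False have "weight ws = exp (- sum_list (map I ws))"
          by (induction ws) (auto simp: I_def exp_add exp_minus exp_diff less_le p_nonneg divide_inverse)
        moreover have "N * H - \<epsilon>/2 * N \<le> sum_list (map I ws)"
        proof -
          have "\<bar>sum_list (map I ws) - N * mean I\<bar> \<le> \<epsilon>/2 * N" using ws by (auto simp: not_less)
          then show ?thesis unfolding H by linarith
        qed
        ultimately show ?thesis by (simp add: algebra_simps)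
      qed
    qed
    also have "\<dots> = card ?P * exp (- real N * (H - \<epsilon>/2))" by simp
    also have "\<dots> \<le> card ?T * exp (- real N * (H - \<epsilon>/2))"
    proof (intro mult_right_mono of_nat_mono card_mono)
      have "\<epsilon> / 2 * N \<le> \<epsilon> * N" using \<epsilon> by (simp add: mult_right_mono)
      then show "?P \<subseteq> ?T" by force
    qed (use fQ in auto)
    finally have "exp (real N * (H - \<epsilon>/2)) * (1/2)
      \<le> exp (real N * (H - \<epsilon>/2)) * (card ?T * exp (- real N * (H - \<epsilon>/2)))"
      by (rule mult_left_mono) simp
    also have "\<dots> = card ?T" by (simp add: exp_minus)
    finally have "exp (real N * (H - \<epsilon>/2)) / 2 \<le> card ?T" by simp
    moreover have "exp (real N * (H - \<epsilon>)) \<le> exp (real N * (H - \<epsilon>/2)) / 2"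
    proof -
      have "ln 2 \<le> N * \<epsilon> / 2" using elim(2) \<epsilon> by (simp add: field_simps)
      then have "2 * exp (real N * (H - \<epsilon>)) \<le> exp (N * \<epsilon> / 2) * exp (real N * (H - \<epsilon>))"
        using exp_le_cancel_iff[of "ln 2" "N * \<epsilon> / 2"] by (intro mult_right_mono) simp_all
      also have "\<dots> = exp (real N * (H - \<epsilon>/2))" by (simp add: exp_add[symmetric] algebra_simps)
      finally show ?thesis by simp
    qed
    ultimately show ?case unfolding H_def by linarith
  qed
qed

end

section \<open>Gluing words\<close>

text \<open>The piece \<open>r w\<close> replaces \<open>w\<close>, and \<open>c v w\<close> is the connecting word between \<open>v\<close> and \<open>w\<close>. Nothing is
  appended after the last piece.\<close>

fun glue :: "('a list \<Rightarrow> 'a list \<Rightarrow> 'a list) \<Rightarrow> ('b \<Rightarrow> 'a list) \<Rightarrow> 'b list \<Rightarrow> 'a list" where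
  "glue c r [] = []"
| "glue c r (w # ws) = r w @ (if ws = [] then [] else c (r w) (glue c r ws)) @ glue c r ws"

lemma glue_in:
  assumes "\<And>v w. v \<in> G \<Longrightarrow> w \<in> G \<Longrightarrow> v @ c v w @ w \<in> G" "\<And>w. w \<in> S \<Longrightarrow> r w \<in> G"
    and "ws \<in> sequences S N" "0 < N"
  shows "glue c r ws \<in> G"
  using assms(3,4)
proof (induction ws arbitrary: N)
  case (Cons w ws)
  then show ?case
    using assms(1,2) by (cases "ws = []") (auto simp: sequences_def)
qed (simp add: sequences_def)

lemma glue_length:
  assumes G: "\<And>v w. v \<in> G \<Longrightarrow> w \<in> G \<Longrightarrow> v @ c v w @ w \<in> G \<and> length (c v w) \<le> \<tau>" "\<And>w. w \<in> S \<Longrightarrow> r w \<in> G"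
    and r: "\<And>w. w \<in> S \<Longrightarrow> L \<le> length (r w) \<and> length (r w) \<le> M"
    and "ws \<in> sequences S N"
  shows "N * L \<le> length (glue c r ws)" "length (glue c r ws) \<le> N * (M + \<tau>)"
proof -
  have "N * L \<le> length (glue c r ws) \<and> length (glue c r ws) \<le> N * (M + \<tau>)"
    using assms(4)
  proof (induction ws arbitrary: N)
    case (Cons w ws)
    then obtain N' where N': "N = Suc N'" "ws \<in> sequences S N'" "w \<in> S" by (auto simp: sequences_def)
    have "length (if ws = [] then [] else c (r w) (glue c r ws)) \<le> \<tau>"
      using G N' glue_in[of G c S r ws N'] by (auto simp: sequences_def)
    then show ?case using Cons.IH[OF N'(2)] r[OF N'(3)] N'(1) by simp
  qed (simp add: sequences_def)
  then show "N * L \<le> length (glue c r ws)" "length (glue c r ws) \<le> N * (M + \<tau>)" by auto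
qed

text \<open>Every block contributes the error \<open>E\<close> of its replacement, two cuts of cost \<open>2Bk\<close>, and a connecting
  word of length at most \<open>\<tau>\<close>.\<close>

lemma block_sum_glue:
  assumes G: "\<And>v w. v \<in> G \<Longrightarrow> w \<in> G \<Longrightarrow> v @ c v w @ w \<in> G \<and> length (c v w) \<le> \<tau>" "\<And>w. w \<in> S \<Longrightarrow> r w \<in> G"
    and F: "\<And>u. \<bar>F u\<bar> \<le> B"
    and r: "\<And>w. w \<in> S \<Longrightarrow> \<bar>block_sum k F (r w) - Y w\<bar> \<le> E"
    and "ws \<in> sequences S N"
  shows "\<bar>block_sum k F (glue c r ws) - sum_list (map Y ws)\<bar> \<le> N * (E + 4 * B * k + B * \<tau>)"
  using assms(5)
proof (induction ws arbitrary: N)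
  case (Cons w ws)
  then obtain N' where N': "N = Suc N'" "ws \<in> sequences S N'" "w \<in> S" by (auto simp: sequences_def)
  have B: "0 \<le> B" using F[of "[]"] by linarith
  let ?u = "if ws = [] then [] else c (r w) (glue c r ws)"
  have "length ?u \<le> \<tau>"
    using G N' glue_in[of G c S r ws N'] by (auto simp: sequences_def)
  then have "B * length ?u \<le> B * \<tau>" using B by (intro mult_left_mono) auto
  then have u: "\<bar>block_sum k F ?u\<bar> \<le> B * \<tau>" using block_sum_bound[of F B k ?u, OF F] by linarith
  have "\<bar>block_sum k F (glue c r (w # ws)) - block_sum k F (r w) - block_sum k F (?u @ glue c r ws)\<bar> \<le> 2 * B * k"
    using block_sum_append[of F B k "r w" "?u @ glue c r ws", OF F] by simp
  moreover have "\<bar>block_sum k F (?u @ glue c r ws) - block_sum k F ?u - block_sum k F (glue c r ws)\<bar> \<le> 2 * B * k"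
    by (rule block_sum_append[OF F])
  ultimately have "\<bar>block_sum k F (glue c r (w # ws)) - sum_list (map Y (w # ws))\<bar> \<le>
      N' * (E + 4 * B * k + B * \<tau>) + (E + 4 * B * k + B * \<tau>)"
    using Cons.IH[OF N'(2)] u r[OF N'(3)] by (simp del: glue.simps add: sum_list.Cons)
  then show ?case using N'(1) by (simp add: algebra_simps del: glue.simps)
qed (simp add: sequences_def)

text \<open>Reading a glued word from the left, the piece \<open>r w\<close> is known once its length is, and so is
  the rest once the length of the connecting word is.\<close>

lemma card_glue_fibre:
  assumes G: "\<And>v w. v \<in> G \<Longrightarrow> w \<in> G \<Longrightarrow> v @ c v w @ w \<in> G \<and> length (c v w) \<le> \<tau>" "\<And>w. w \<in> S \<Longrightarrow> r w \<in> G"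
    and S: "finite S" and r: "\<And>w. w \<in> S \<Longrightarrow> length (r w) \<le> M"
    and Q: "\<And>v. card {w \<in> S. r w = v} \<le> Q"
  shows "card {ws \<in> sequences S N. glue c r ws = y} \<le> ((M + 1) * (\<tau> + 1) * Q) ^ N"
proof (induction N arbitrary: y)
  case 0
  have "{ws \<in> sequences S 0. glue c r ws = y} \<subseteq> {[]}" by auto
  from card_mono[OF _ this] show ?case by simp
next
  case (Suc N)
  let ?R = "\<lambda>v. {w \<in> S. r w = v}" and ?F = "\<lambda>N y. {ws \<in> sequences S N. glue c r ws = y}"
  let ?U = "\<lambda>(a, b). (\<lambda>(w, ws). w # ws) ` (?R (take a y) \<times> ?F N (drop (a + b) y))"
  have fin: "finite (?R v)" "finite (?F N y)" for v N y
    using S finite_sequences[OF S] by auto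
  have "?F (Suc N) y \<subseteq> (\<Union>ab\<in>{..M} \<times> {..\<tau>}. ?U ab)"
  proof
    fix ws' assume "ws' \<in> ?F (Suc N) y"
    then obtain w ws where ws: "ws' = w # ws" "w \<in> S" "ws \<in> sequences S N" "glue c r (w # ws) = y"
      by (auto simp: sequences_Suc)
    let ?u = "if ws = [] then [] else c (r w) (glue c r ws)"
    have "length ?u \<le> \<tau>"
      using G ws glue_in[of G c S r ws N] by (auto simp: sequences_def)
    moreover have "w \<in> ?R (take (length (r w)) y)" "ws \<in> ?F N (drop (length (r w) + length ?u) y)"
      using ws by auto
    ultimately have "ws' \<in> ?U (length (r w), length ?u)" "(length (r w), length ?u) \<in> {..M} \<times> {..\<tau>}"
      using ws(1,2) r by auto
    then show "ws' \<in> (\<Union>ab\<in>{..M} \<times> {..\<tau>}. ?U ab)" by blast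
  qed
  then have "card (?F (Suc N) y) \<le> card (\<Union>ab\<in>{..M} \<times> {..\<tau>}. ?U ab)"
    using fin by (intro card_mono finite_UN_I) auto
  also have "\<dots> \<le> (\<Sum>ab\<in>{..M} \<times> {..\<tau>}. card (?U ab))" by (intro card_UN_le) auto
  also have "\<dots> \<le> (\<Sum>ab\<in>{..M} \<times> {..\<tau>}. Q * ((M + 1) * (\<tau> + 1) * Q) ^ N)"
  proof (rule sum_mono)
    fix ab :: "nat \<times> nat"
    obtain a b where ab: "ab = (a, b)" by force
    have "card (?U ab) \<le> card (?R (take a y) \<times> ?F N (drop (a + b) y))"
      unfolding ab using fin by (simp only: prod.case) (intro card_image_le finite_cartesian_product)
    also have "\<dots> \<le> Q * ((M + 1) * (\<tau> + 1) * Q) ^ N"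
      unfolding card_cartesian_product by (intro mult_le_mono Q Suc.IH)
    finally show "card (?U ab) \<le> Q * ((M + 1) * (\<tau> + 1) * Q) ^ N" .
  qed
  also have "\<dots> = ((M + 1) * (\<tau> + 1) * Q) ^ Suc N" by (simp add: algebra_simps)
  finally show ?case .
qed

section \<open>Birkhoff sums, cylinders and invariant measures\<close>

context shift_space
begin

lemma birkhoff_sum_add:
  "birkhoff_sum I f (m + n) x = birkhoff_sum I f m x + birkhoff_sum I f n ((\<sigma> ^^ m) x)"
proof -
  have "(\<sigma> ^^ k) ((\<sigma> ^^ m) x) = (\<sigma> ^^ (m + k)) x" for k
    by (simp add: funpow_add add.commute[of m])
  then show ?thesis
    by (induction n) (simp_all add: birkhoff_sum_def)
qed

lemma birkhoff_sum_Suc: "birkhoff_sum I f (Suc n) x = f x + birkhoff_sum I f n (\<sigma> x)"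
  using birkhoff_sum_add[of f 1 n x] by (simp add: birkhoff_sum_def)

lemma birkhoff_sum_bound:
  assumes "\<And>x. x \<in> X \<Longrightarrow> \<bar>f x\<bar> \<le> B" "x \<in> X"
  shows "\<bar>birkhoff_sum I f n x\<bar> \<le> n * B"
proof -
  have "\<bar>birkhoff_sum I f n x\<bar> \<le> (\<Sum>k<n. \<bar>f ((\<sigma> ^^ k) x)\<bar>)"
    unfolding birkhoff_sum_def by (rule sum_abs)
  also have "\<dots> \<le> (\<Sum>k<n. B)" using assms shift_in by (intro sum_mono) auto
  finally show ?thesis by simp
qed

lemma initial_word_eqD:
  assumes "initial_word x n = initial_word y n" "1 \<le> j" "j \<le> int n"
  shows "x j = y j"
proof -
  have "initial_word x n ! nat (j - 1) = initial_word y n ! nat (j - 1)" using assms(1) by simp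
  moreover have "nat (j - 1) < n" using assms(2,3) by linarith
  ultimately show ?thesis using assms(2) by (simp add: initial_word_conv)
qed

text \<open>The two sides differ only at the last \<open>k\<close> positions, where the block is truncated.\<close>

lemma block_sum_initial_word:
  assumes F: "\<And>u. \<bar>F u\<bar> \<le> B"
  shows "\<bar>birkhoff_sum I (\<lambda>x. F (initial_word x k)) n x - block_sum k F (initial_word x n)\<bar> \<le> 2 * B * k"
proof -
  have B: "0 \<le> B" using F[of "[]"] by linarith
  have "\<bar>birkhoff_sum I (\<lambda>x. F (initial_word x k)) n x - block_sum k F (initial_word x n)\<bar> \<le> 2 * B * min n k"
  proof (induction n arbitrary: x)
    case 0
    show ?case by (simp add: birkhoff_sum_def initial_word_def)
  next
    case (Suc n)
    have bs: "block_sum k F (initial_word x (Suc n)) = F (initial_word x (min k (Suc n))) + block_sum k F (initial_word (\<sigma> x) n)"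
      using take_initial_word[of k x "Suc n"] by (simp add: initial_word_Suc)
    show ?case
    proof (cases "k \<le> Suc n")
      case True
      then have "2 * B * min n k \<le> 2 * B * min (Suc n) k" using B by (intro mult_left_mono) auto
      then show ?thesis using Suc[of "\<sigma> x"] True unfolding birkhoff_sum_Suc bs by simp
    next
      case False
      have "\<bar>F (initial_word x k) - F (initial_word x (min k (Suc n)))\<bar> \<le> 2 * B"
        using F[of "initial_word x k"] F[of "initial_word x (min k (Suc n))"] by linarith
      moreover have "2 * B * min (Suc n) k = 2 * B * min n k + 2 * B" using False by (simp add: algebra_simps)
      ultimately show ?thesis using Suc[of "\<sigma> x"] unfolding birkhoff_sum_Suc bs by linarith
    qed
  qed
  also have "\<dots> \<le> 2 * B * k" using B by (intro mult_left_mono) auto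
  finally show ?thesis .
qed

text \<open>A continuous function depends up to \<open>\<eta>\<close> on a window \<open>-t..t\<close>. Shifting by \<open>t + 1\<close> moves
  this window into the positive coordinates, which words see; this treats one-sided and two-sided
  shifts alike and costs only a bounded error in Birkhoff sums.\<close>

lemma birkhoff_sum_block_approximation:
  fixes \<eta> :: real
  assumes f: "continuous_map T euclideanreal f" and \<eta>: "\<eta> > 0"
  obtains k F B C where "0 \<le> B" "\<And>u. \<bar>F u\<bar> \<le> B"
    "\<And>x n. x \<in> X \<Longrightarrow> \<bar>birkhoff_sum I f n x - block_sum k F (initial_word x n)\<bar> \<le> \<eta> * n + C"
proof -
  obtain t where t: "\<And>x y. x \<in> X \<Longrightarrow> y \<in> X \<Longrightarrow> agree I t x y \<Longrightarrow> \<bar>f x - f y\<bar> \<le> \<eta>"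
    using uniformly_window_continuous[OF f \<eta>] by blast
  obtain B where B: "0 \<le> B" "\<And>x. x \<in> X \<Longrightarrow> \<bar>f x\<bar> \<le> B"
    using compact_continuous_bounded[OF compact_T f] by (metis topspace_T)
  define k where "k = 2 * t + 1"
  define c where "c u = (SOME x. x \<in> X \<and> initial_word x k = u)" for u
  define F where "F u = (if \<exists>x\<in>X. initial_word x k = u then f ((\<sigma> ^^ (t + 1)) (c u)) else 0)" for u
  have c: "c (initial_word x k) \<in> X" "initial_word (c (initial_word x k)) k = initial_word x k" if "x \<in> X" for x
    using someI[of "\<lambda>y. y \<in> X \<and> initial_word y k = initial_word x k" x] that by (auto simp: c_def)
  have F: "\<bar>F u\<bar> \<le> B" for u
    using B shift_in c by (auto simp: F_def simp del: funpow.simps)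
  have close: "\<bar>f ((\<sigma> ^^ (t + 1)) x) - F (initial_word x k)\<bar> \<le> \<eta>" if x: "x \<in> X" for x
  proof -
    let ?y = "c (initial_word x k)"
    have "agree I t ((\<sigma> ^^ (t + 1)) x) ((\<sigma> ^^ (t + 1)) ?y)"
      unfolding agree_def
    proof (intro ballI impI)
      fix i assume i: "i \<in> I" "nat \<bar>i\<bar> \<le> t"
      have "x (i + int (t + 1)) = ?y (i + int (t + 1))"
        using i by (intro initial_word_eqD[OF c(2)[OF x, symmetric]]) (auto simp: k_def)
      then show "(\<sigma> ^^ (t + 1)) x i = (\<sigma> ^^ (t + 1)) ?y i"
        unfolding shift_apply[OF i(1)] .
    qed
    then have "\<bar>f ((\<sigma> ^^ (t + 1)) x) - f ((\<sigma> ^^ (t + 1)) ?y)\<bar> \<le> \<eta>"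
      using t shift_in x c by blast
    moreover have "F (initial_word x k) = f ((\<sigma> ^^ (t + 1)) ?y)"
      using x unfolding F_def by auto
    ultimately show ?thesis by simp
  qed
  have "\<bar>birkhoff_sum I f n x - block_sum k F (initial_word x n)\<bar> \<le> \<eta> * n + (2 * (t + 1) * B + 2 * B * k)"
    if x: "x \<in> X" for x n
  proof -
    have "birkhoff_sum I f n x - birkhoff_sum I f n ((\<sigma> ^^ (t + 1)) x) =
        birkhoff_sum I f (t + 1) x - birkhoff_sum I f (t + 1) ((\<sigma> ^^ n) x)"
      using birkhoff_sum_add[of f n "t + 1" x] birkhoff_sum_add[of f "t + 1" n x]
      by (simp add: add.commute[of n])
    moreover have "\<bar>birkhoff_sum I f (t + 1) x\<bar> \<le> (t + 1) * B"
        "\<bar>birkhoff_sum I f (t + 1) ((\<sigma> ^^ n) x)\<bar> \<le> (t + 1) * B"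
      by (rule birkhoff_sum_bound[of f B, OF B(2)]; use shift_in x in blast)+
    ultimately have 1: "\<bar>birkhoff_sum I f n x - birkhoff_sum I f n ((\<sigma> ^^ (t + 1)) x)\<bar> \<le> 2 * (t + 1) * B"
      by (simp only: of_nat_mult)
    have comm: "(\<sigma> ^^ (t + 1)) ((\<sigma> ^^ j) x) = (\<sigma> ^^ j) ((\<sigma> ^^ (t + 1)) x)" for j
      by (metis add.commute comp_apply funpow_add)
    have "\<bar>birkhoff_sum I f n ((\<sigma> ^^ (t + 1)) x) - birkhoff_sum I (\<lambda>x. F (initial_word x k)) n x\<bar>
      = \<bar>\<Sum>j<n. f ((\<sigma> ^^ (t + 1)) ((\<sigma> ^^ j) x)) - F (initial_word ((\<sigma> ^^ j) x) k)\<bar>"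
      unfolding birkhoff_sum_def comm by (simp only: sum_subtractf)
    also have "\<dots> \<le> (\<Sum>j<n. \<eta>)"
      using close shift_in[OF x] by (intro order_trans[OF sum_abs] sum_mono) blast
    finally have 2: "\<bar>birkhoff_sum I f n ((\<sigma> ^^ (t + 1)) x) - birkhoff_sum I (\<lambda>x. F (initial_word x k)) n x\<bar> \<le> \<eta> * n"
      by (simp add: mult.commute)
    show ?thesis using 1 2 block_sum_initial_word[of F B k n x, OF F] by linarith
  qed
  then show thesis using that[of B F k] B(1) F by blast
qed

lemma language_n_iff: "w \<in> language_n A X n \<longleftrightarrow> (\<exists>x\<in>X. initial_word x n = w)"
proof -
  have "set (initial_word x n) \<subseteq> A" if "x \<in> X" for x
  proof -
    have "x \<in> I \<rightarrow>\<^sub>E A" using X_subset that by blast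
    then show ?thesis using I_props(3) by (auto simp: initial_word_def PiE_iff)
  qed
  then show ?thesis
    by (auto simp: language_n_def language_def cylinder_def lists_eq_set)
qed

lemma initial_word_in_language: "x \<in> X \<Longrightarrow> initial_word x n \<in> language_n A X n"
  using language_n_iff by blast

lemma language_n_subset: "language_n A X n \<subseteq> {w \<in> lists A. length w = n}"
  by (auto simp: language_n_def language_def)

lemma finite_language_n: "finite (language_n A X n)"
  by (rule finite_subset[OF language_n_subset finite_words[OF finite_A]])

lemma cylinder_clopen: "cylinder X w \<in> clopens"
proof -
  let ?n = "length w"
  have same: "initial_word x ?n = initial_word y ?n" if "agree I ?n x y" for x y
    using that I_props(3) by (auto simp: initial_word_def agree_def)
  have "openin T (cylinder X w)"
    unfolding openin_T
  proof (intro conjI ballI exI impI)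
    fix x y assume "x \<in> cylinder X w" "y \<in> X" "agree I ?n x y"
    then show "y \<in> cylinder X w" using same[of x y] by (simp add: cylinder_def)
  qed (simp add: cylinder_def)
  moreover have "openin T (X - cylinder X w)"
    unfolding openin_T
  proof (intro conjI ballI exI impI)
    fix x y assume "x \<in> X - cylinder X w" "y \<in> X" "agree I ?n x y"
    then show "y \<in> X - cylinder X w" using same[of x y] by (simp add: cylinder_def)
  qed simp
  ultimately show ?thesis
    unfolding clopens_def closedin_def by (simp add: cylinder_def)
qed

text \<open>This expression gives both the continuity and the integral of a function of the first \<open>n\<close> letters.\<close>

lemma word_function_as_step:
  assumes "x \<in> X"
  shows "H (initial_word x n) = (\<Sum>w\<in>language_n A X n. H w * indicat_real (cylinder X w) x)"
proof -
  have "(\<Sum>w\<in>language_n A X n. H w * indicat_real (cylinder X w) x) =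
      (\<Sum>w\<in>language_n A X n. if w = initial_word x n then H w else 0)"
    using assms by (intro sum.cong) (auto simp: cylinder_def language_n_def)
  also have "\<dots> = H (initial_word x n)"
    using finite_language_n initial_word_in_language[OF assms] by simp
  finally show ?thesis by simp
qed

lemma continuous_map_word_function:
  "continuous_map T euclideanreal (\<lambda>x. H (initial_word x n))"
proof -
  have "continuous_map T euclideanreal (\<lambda>x. \<Sum>w\<in>language_n A X n. H w * indicat_real (cylinder X w) x)"
    using cylinder_clopen finite_language_n
    by (intro continuous_map_sum continuous_map_real_mult_left continuous_map_indicator_clopen)
       (auto simp: clopens_def)
  then show ?thesis
    by (rule continuous_map_eq) (use word_function_as_step in simp)
qed

lemma integral_word_function:
  assumes \<mu>: "\<mu> \<in> prob_measures T"
  shows "(\<integral>x. H (initial_word x n) \<partial>\<mu>) = (\<Sum>w\<in>language_n A X n. measure \<mu> (cylinder X w) * H w)"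
proof -
  interpret prob_space \<mu> by (rule prob_measuresD[OF \<mu>])
  have cyl: "cylinder X w \<in> sets \<mu>" for w using clopen_sets[OF \<mu> cylinder_clopen] .
  have "(\<integral>x. H (initial_word x n) \<partial>\<mu>) = (\<integral>x. (\<Sum>w\<in>language_n A X n. H w * indicat_real (cylinder X w) x) \<partial>\<mu>)"
    using word_function_as_step prob_measuresD(3)[OF \<mu>] by (intro Bochner_Integration.integral_cong) auto
  also have "\<dots> = (\<Sum>w\<in>language_n A X n. \<integral>x. H w * indicat_real (cylinder X w) x \<partial>\<mu>)"
    using cyl by (intro Bochner_Integration.integral_sum integrable_mult_right)
       (simp add: integrable_real_indicator emeasure_eq_measure)
  also have "\<dots> = (\<Sum>w\<in>language_n A X n. measure \<mu> (cylinder X w) * H w)"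
    using cyl by (simp add: sets.Int_space_eq2 mult.commute)
  finally show ?thesis .
qed

lemma measure_cylinder_sum: "\<mu> \<in> prob_measures T \<Longrightarrow> (\<Sum>w\<in>language_n A X n. measure \<mu> (cylinder X w)) = 1"
  using integral_word_function[of \<mu> "\<lambda>_. 1" n] prob_space.prob_space[OF prob_measuresD(1), of \<mu> T]
  by simp

lemma cylinder_marginal:
  assumes \<mu>: "\<mu> \<in> prob_measures T"
  shows "(\<Sum>a\<in>A. measure \<mu> (cylinder X (v @ [a]))) = measure \<mu> (cylinder X v)"
proof -
  interpret prob_space \<mu> by (rule prob_measuresD[OF \<mu>])
  have "cylinder X v = (\<Union>a\<in>A. cylinder X (v @ [a]))"
  proof (intro equalityI subsetI)
    fix x assume x: "x \<in> cylinder X v"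
    then have "x \<in> X" and *: "initial_word x (length v + 1) = v @ initial_word ((\<sigma> ^^ length v) x) 1"
      using initial_word_add[of x "length v" 1] by (auto simp: cylinder_def)
    moreover have "initial_word x (length v + 1) \<in> lists A"
      using initial_word_in_language[OF \<open>x \<in> X\<close>] language_n_subset by blast
    ultimately show "x \<in> (\<Union>a\<in>A. cylinder X (v @ [a]))"
      by (auto simp: cylinder_def initial_word_conv)
  next
    fix x assume "x \<in> (\<Union>a\<in>A. cylinder X (v @ [a]))"
    then obtain a where "x \<in> X" "initial_word x (length v + 1) = v @ [a]" by (auto simp: cylinder_def)
    then show "x \<in> cylinder X v"
      using take_initial_word[of "length v" x "length v + 1"] by (simp add: cylinder_def)
  qed
  moreover have "measure \<mu> (\<Union>a\<in>A. cylinder X (v @ [a])) = (\<Sum>a\<in>A. measure \<mu> (cylinder X (v @ [a])))"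
  proof (rule finite_measure_finite_Union[OF finite_A])
    show "(\<lambda>a. cylinder X (v @ [a])) ` A \<subseteq> sets \<mu>" using clopen_sets[OF \<mu> cylinder_clopen] by blast
  qed (auto simp: disjoint_family_on_def cylinder_def)
  ultimately show ?thesis by simp
qed

lemma invariant_measuresD:
  assumes "\<mu> \<in> invariant_measures T \<sigma>"
  shows "\<mu> \<in> prob_measures T"
    and "continuous_map T euclideanreal f \<Longrightarrow> (\<integral>x. f (\<sigma> x) \<partial>\<mu>) = integral\<^sup>L \<mu> f"
proof -
  show \<mu>: "\<mu> \<in> prob_measures T" using assms by (simp add: invariant_measures_def)
  assume f: "continuous_map T euclideanreal f"
  have "\<sigma> \<in> measurable \<mu> \<mu>" using continuous_map_measurable[OF continuous_map_shift \<mu>] .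
  moreover have "distr \<mu> \<mu> \<sigma> = \<mu>" using assms by (simp add: invariant_measures_def)
  moreover have "f \<in> borel_measurable \<mu>" using f prob_measuresD(2)[OF \<mu>] by (rule continuous_map_borel_of)
  ultimately show "(\<integral>x. f (\<sigma> x) \<partial>\<mu>) = integral\<^sup>L \<mu> f"
    using integral_distr[of \<sigma> \<mu> \<mu> f] by simp
qed

lemma integral_birkhoff_sum:
  assumes \<mu>: "\<mu> \<in> invariant_measures T \<sigma>" and f: "continuous_map T euclideanreal f"
  shows "integrable \<mu> (birkhoff_sum I f n)" "integral\<^sup>L \<mu> (birkhoff_sum I f n) = n * integral\<^sup>L \<mu> f"
proof -
  note P = invariant_measuresD(1)[OF \<mu>]
  have f': "continuous_map T euclideanreal (\<lambda>x. f ((\<sigma> ^^ j) x))" for j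
    using continuous_map_compose[OF continuous_map_funpow[OF continuous_map_shift] f] by (simp add: comp_def)
  have int: "integrable \<mu> (\<lambda>x. f ((\<sigma> ^^ j) x))" for j
    by (rule compact_continuous_integrable[OF compact_T f' P])
  have eq: "(\<integral>x. f ((\<sigma> ^^ j) x) \<partial>\<mu>) = integral\<^sup>L \<mu> f" for j
  proof (induction j)
    case (Suc j)
    have "(\<integral>x. f ((\<sigma> ^^ Suc j) x) \<partial>\<mu>) = (\<integral>x. f ((\<sigma> ^^ j) (\<sigma> x)) \<partial>\<mu>)" by (simp add: funpow_swap1)
    then show ?case using invariant_measuresD(2)[OF \<mu> f'] Suc by simp
  qed simp
  show "integrable \<mu> (birkhoff_sum I f n)" unfolding birkhoff_sum_def using int by (intro Bochner_Integration.integrable_sum)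
  show "integral\<^sup>L \<mu> (birkhoff_sum I f n) = n * integral\<^sup>L \<mu> f"
    unfolding birkhoff_sum_def using int eq by (subst Bochner_Integration.integral_sum) auto
qed

end

section \<open>The local upper bound\<close>

text \<open>The probability that a chain with transition probabilities \<open>\<rho>\<close> continues the past \<open>u\<close> by \<open>y\<close>. The
  state is a word of constant length: one letter enters on the right and one leaves on the left.\<close>

fun path_weight :: "('a list \<Rightarrow> real) \<Rightarrow> 'a list \<Rightarrow> 'a list \<Rightarrow> real" where
  "path_weight \<rho> u [] = 1"
| "path_weight \<rho> u (a # y) = \<rho> (u @ [a]) * path_weight \<rho> (tl (u @ [a])) y"

lemma path_weight_nonneg: "(\<And>u. 0 \<le> \<rho> u) \<Longrightarrow> 0 \<le> path_weight \<rho> u y"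
  by (induction y arbitrary: u) auto

lemma path_weight_total:
  assumes "\<And>v. (\<Sum>a\<in>A. \<rho> (v @ [a])) = 1"
  shows "(\<Sum>y\<in>sequences A n. path_weight \<rho> u y) = 1"
proof (induction n arbitrary: u)
  case (Suc n)
  then show ?case by (simp add: sum_sequences_Suc sum_distrib_left[symmetric] assms)
qed simp

context shift_space
begin

definition block_entropy :: "(int \<Rightarrow> 'a) measure \<Rightarrow> nat \<Rightarrow> real" where
  "block_entropy \<mu> n = (\<Sum>w\<in>language_n A X n. - measure \<mu> (cylinder X w) * ln (measure \<mu> (cylinder X w)))"

text \<open>The conditional probability under \<open>\<mu>\<close> of the last letter of \<open>u\<close> given the preceding ones, that is,
  a transition probability of the Markov chain approximating \<open>\<mu>\<close>. The smoothing by \<open>\<eta>\<close> keeps it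
  positive without changing the total mass \<open>1\<close>.\<close>

definition transition :: "(int \<Rightarrow> 'a) measure \<Rightarrow> real \<Rightarrow> 'a list \<Rightarrow> real" where
  "transition \<mu> \<eta> u = (measure \<mu> (cylinder X u) + \<eta>) / (measure \<mu> (cylinder X (butlast u)) + \<eta> * card A)"

lemma alphabet_nonempty: "X \<noteq> {} \<Longrightarrow> 0 < card A"
proof -
  assume "X \<noteq> {}"
  then obtain x where "x \<in> X" by blast
  then have "x 1 \<in> A" using X_subset I_props(1) by (auto simp: PiE_iff)
  then show ?thesis using finite_A by (auto simp: card_gt_0_iff)
qed

lemma prob_measures_X_nonempty: "\<mu> \<in> prob_measures T \<Longrightarrow> X \<noteq> {}"
  using prob_space.not_empty[OF prob_measuresD(1), of \<mu> T] prob_measuresD(3)[of \<mu> T] by simp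

lemma transition_pos:
  assumes "\<mu> \<in> prob_measures T" "0 < \<eta>" shows "0 < transition \<mu> \<eta> u"
  using assms alphabet_nonempty[OF prob_measures_X_nonempty[OF assms(1)]]
  by (auto simp: transition_def intro!: divide_pos_pos add_nonneg_pos)

lemma transition_sum:
  assumes "\<mu> \<in> prob_measures T" "0 < \<eta>" shows "(\<Sum>a\<in>A. transition \<mu> \<eta> (v @ [a])) = 1"
proof -
  have "0 < measure \<mu> (cylinder X v) + \<eta> * card A"
    using assms alphabet_nonempty[OF prob_measures_X_nonempty[OF assms(1)]]
    by (auto intro!: add_nonneg_pos)
  then show ?thesis
    by (simp add: transition_def sum_divide_distrib[symmetric] sum.distrib cylinder_marginal[OF assms(1)] mult.commute)
qed

text \<open>Along an orbit the logarithms of the transition probabilities add up to the logarithm of the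
  probability of the word that is read.\<close>

lemma exp_birkhoff_sum_eq_path_weight:
  assumes "\<And>u. 0 < \<rho> u"
  shows "exp (birkhoff_sum I (\<lambda>x. ln (\<rho> (initial_word x (j + 1)))) n x) =
    path_weight \<rho> (initial_word x j) (initial_word ((\<sigma> ^^ j) x) n)"
proof (induction n arbitrary: x)
  case 0
  show ?case by (simp add: birkhoff_sum_def initial_word_def)
next
  case (Suc n)
  have 1: "initial_word x j @ [(\<sigma> ^^ j) x 1] = initial_word x (j + 1)"
    unfolding initial_word_add by (simp add: initial_word_conv)
  have 2: "tl (initial_word x (j + 1)) = initial_word (\<sigma> x) j"
    using initial_word_Suc[of x j] by simp
  have 3: "\<sigma> ((\<sigma> ^^ j) x) = (\<sigma> ^^ j) (\<sigma> x)" by (simp add: funpow_swap1)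
  show ?case
    unfolding birkhoff_sum_Suc initial_word_Suc[of "(\<sigma> ^^ j) x"] path_weight.simps 1 2 3 exp_add
    using Suc[of "\<sigma> x"] assms by simp
qed

text \<open>Each \<open>w\<close> is represented by the longer word that \<open>p w\<close> shows on its first \<open>j + n\<close> coordinates: \<open>j\<close>
  letters of past and \<open>n\<close> transitions. For every past the probabilities of the continuations sum to
  \<open>1\<close>.\<close>

lemma sum_exp_birkhoff_sum_le:
  assumes \<mu>: "\<mu> \<in> prob_measures T" "0 < \<eta>"
    and W: "W \<subseteq> language_n A X n" "\<And>w. w \<in> W \<Longrightarrow> p w \<in> X \<and> initial_word (p w) n = w"
  shows "(\<Sum>w\<in>W. exp (birkhoff_sum I (\<lambda>x. ln (transition \<mu> \<eta> (initial_word x (j + 1)))) n (p w)))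
    \<le> card (sequences A j)"
proof -
  let ?q = "\<lambda>w. (initial_word (p w) j, initial_word ((\<sigma> ^^ j) (p w)) n)"
  let ?pw = "path_weight (transition \<mu> \<eta>)"
  have fin: "finite (sequences A k)" for k by (rule finite_sequences[OF finite_A])
  have inj: "inj_on ?q W"
  proof
    fix w w' assume w: "w \<in> W" "w' \<in> W" "?q w = ?q w'"
    then have "initial_word (p w) (j + n) = initial_word (p w') (j + n)"
      unfolding initial_word_add by simp
    then have "initial_word (p w) n = initial_word (p w') n"
      using take_initial_word[of n "p w" "j + n"] take_initial_word[of n "p w'" "j + n"] by simp
    then show "w = w'" using W(2) w by metis
  qed
  have seq: "initial_word x k \<in> sequences A k" if "x \<in> X" for x k
    using initial_word_in_language[OF that] language_n_subset unfolding sequences_def by blast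
  have "(\<Sum>w\<in>W. exp (birkhoff_sum I (\<lambda>x. ln (transition \<mu> \<eta> (initial_word x (j + 1)))) n (p w)))
      = (\<Sum>w\<in>W. case_prod ?pw (?q w))"
    by (simp only: exp_birkhoff_sum_eq_path_weight[of "transition \<mu> \<eta>", OF transition_pos[OF \<mu>]] prod.case)
  also have "\<dots> = (\<Sum>uy\<in>?q ` W. case_prod ?pw uy)" by (simp only: sum.reindex[OF inj] comp_def)
  also have "\<dots> \<le> (\<Sum>uy\<in>sequences A j \<times> sequences A n. case_prod ?pw uy)"
  proof (rule sum_mono2)
    show "?q ` W \<subseteq> sequences A j \<times> sequences A n" using W(2) seq shift_in by blast
    show "0 \<le> case_prod ?pw uy" for uy
      using path_weight_nonneg[of "transition \<mu> \<eta>"] transition_pos[OF \<mu>] by (auto simp: less_imp_le split: prod.split)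
  qed (use fin in simp)
  also have "\<dots> = (\<Sum>u\<in>sequences A j. 1)"
    unfolding sum.cartesian_product[symmetric] path_weight_total[OF transition_sum[OF \<mu>]] ..
  finally show ?thesis by simp
qed

text \<open>The mean of \<open>- ln\<close> of the conditional probability is the conditional entropy of a letter given \<open>j\<close>
  preceding ones.\<close>

lemma integral_ln_transition_tendsto:
  assumes \<mu>: "\<mu> \<in> prob_measures T"
  shows "((\<lambda>\<eta>. - (\<integral>x. ln (transition \<mu> \<eta> (initial_word x (j + 1))) \<partial>\<mu>)) \<longlongrightarrow>
    block_entropy \<mu> (j + 1) - block_entropy \<mu> j) (at_right 0)"
proof -
  interpret prob_space \<mu> by (rule prob_measuresD[OF \<mu>])
  let ?p = "\<lambda>u. measure \<mu> (cylinder X u)"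
  have mono: "?p u \<le> ?p (butlast u)" for u
  proof (rule finite_measure_mono)
    show "cylinder X u \<subseteq> cylinder X (butlast u)"
      by (auto simp: cylinder_def butlast_conv_take take_initial_word) (metis diff_le_self min.absorb2 min.commute take_initial_word)
  qed (rule clopen_sets[OF \<mu> cylinder_clopen])
  have "((\<lambda>\<eta>. \<Sum>u\<in>language_n A X (j + 1). ?p u * ln (transition \<mu> \<eta> u)) \<longlongrightarrow>
     (\<Sum>u\<in>language_n A X (j + 1). ?p u * (ln (?p u) - ln (?p (butlast u))))) (at_right 0)"
  proof (rule tendsto_sum)
    fix u
    show "((\<lambda>\<eta>. ?p u * ln (transition \<mu> \<eta> u)) \<longlongrightarrow> ?p u * (ln (?p u) - ln (?p (butlast u)))) (at_right 0)"
    proof (cases "?p u = 0")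
      case False
      then have pos: "0 < ?p u" by (simp add: zero_less_measure_iff)
      then have pos': "0 < ?p (butlast u)" using mono[of u] by linarith
      have "((\<lambda>\<eta>. transition \<mu> \<eta> u) \<longlongrightarrow> (?p u + 0) / (?p (butlast u) + 0 * real (card A))) (at_right 0)"
        unfolding transition_def using pos'
        by (intro tendsto_divide tendsto_add tendsto_mult tendsto_const tendsto_ident_at) auto
      then have "((\<lambda>\<eta>. ln (transition \<mu> \<eta> u)) \<longlongrightarrow> ln (?p u / ?p (butlast u))) (at_right 0)"
        using pos pos' by (intro tendsto_ln) auto
      then show ?thesis using pos pos' by (intro tendsto_mult_left) (simp add: ln_div)
    qed simp
  qed
  moreover have "(\<Sum>u\<in>language_n A X (j + 1). ?p u * (ln (?p u) - ln (?p (butlast u)))) =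
      - (block_entropy \<mu> (j + 1) - block_entropy \<mu> j)"
  proof -
    have "butlast (initial_word x (j + 1)) = initial_word x j" for x :: "int \<Rightarrow> 'a"
      by (simp add: butlast_conv_take take_initial_word)
    then have "(\<Sum>u\<in>language_n A X (j + 1). ?p u * ln (?p (butlast u))) = (\<Sum>v\<in>language_n A X j. ?p v * ln (?p v))"
      using integral_word_function[OF \<mu>, of "\<lambda>u. ln (?p (butlast u))" "j + 1"]
        integral_word_function[OF \<mu>, of "\<lambda>u. ln (?p u)" j] by simp
    then show ?thesis
      by (simp add: block_entropy_def right_diff_distrib sum_subtractf sum_negf)
  qed
  ultimately have "((\<lambda>\<eta>. - (\<Sum>u\<in>language_n A X (j + 1). ?p u * ln (transition \<mu> \<eta> u))) \<longlongrightarrow>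
      - (- (block_entropy \<mu> (j + 1) - block_entropy \<mu> j))) (at_right 0)"
    by (intro tendsto_minus) simp
  then show ?thesis
    unfolding integral_word_function[OF \<mu>, of "\<lambda>u. ln (transition \<mu> _ u)"] by simp
qed

abbreviation deviation_prob where
  "deviation_prob m U n \<equiv> measure m {x \<in> topspace T. empirical_measure T \<sigma> n x \<in> U}"

lemma empirical_measure_T:
  assumes "0 < n" "x \<in> X"
  shows "empirical_measure T \<sigma> n x \<in> prob_measures T"
    and "continuous_map T euclideanreal f \<Longrightarrow>
      integral\<^sup>L (empirical_measure T \<sigma> n x) f = birkhoff_sum I f n x / n"
  using empirical_measure_props[of n T \<sigma> x] shift_in[of _ 1] assms by (auto simp: birkhoff_sum_def)

text \<open>Near \<open>\<mu>\<close>, Birkhoff sums of \<open>\<phi>\<close> and of the logarithmic transition probability \<open>g\<close> are both controlled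
  by their integrals. So for every word that occurs, the Gibbs bound may be multiplied by
  \<open>exp (S\<^sub>n g - n \<integral>g d\<mu> + n \<epsilon>)\<close>, which is at least \<open>1\<close>. Summation over the words then produces a sum
  of probabilities instead of the number of words.\<close>

theorem local_upper_bound:
  assumes m: "m \<in> prob_measures T" and \<phi>: "continuous_map T euclideanreal \<phi>"
    and gibbs: "0 < K'" "\<And>x n. x \<in> X \<Longrightarrow> 1 \<le> n \<Longrightarrow>
      measure m (cylinder X (initial_word x n)) \<le> K' * exp (- real n * P + birkhoff_sum I \<phi> n x)"
    and \<mu>: "\<mu> \<in> prob_measures T"
    and a: "block_entropy \<mu> (j + 1) - block_entropy \<mu> j + integral\<^sup>L \<mu> \<phi> - P < a"
  shows "\<exists>U. openin (weak_star_topology T) U \<and> \<mu> \<in> U \<and>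
    (\<forall>\<^sub>F n in sequentially. deviation_prob m U n \<le> exp (real n * a))"
proof -
  interpret m: prob_space m by (rule prob_measuresD[OF m])
  let ?H = "block_entropy \<mu> (j + 1) - block_entropy \<mu> j"
  define \<epsilon> where "\<epsilon> = (a - (?H + integral\<^sup>L \<mu> \<phi> - P)) / 4"
  have \<epsilon>: "0 < \<epsilon>" using a by (simp add: \<epsilon>_def)
  let ?g = "\<lambda>\<eta> x. ln (transition \<mu> \<eta> (initial_word x (j + 1)))"
  have "\<forall>\<^sub>F \<eta> in at_right 0. - (\<integral>x. ?g \<eta> x \<partial>\<mu>) < ?H + \<epsilon>"
    using integral_ln_transition_tendsto[OF \<mu>, of j] \<epsilon> by (intro order_tendstoD) auto
  moreover have "\<forall>\<^sub>F \<eta> in at_right 0. 0 < (\<eta>::real)" by (rule eventually_at_right_less)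
  ultimately have "\<forall>\<^sub>F \<eta> in at_right 0. - (\<integral>x. ?g \<eta> x \<partial>\<mu>) < ?H + \<epsilon> \<and> 0 < \<eta>"
    by (rule eventually_conj)
  then obtain \<eta> where \<eta>: "- (\<integral>x. ?g \<eta> x \<partial>\<mu>) < ?H + \<epsilon>" "0 < \<eta>"
    using eventually_happens'[OF trivial_limit_at_right_real[of "0::real"]] by blast
  define g where "g = ?g \<eta>"
  have g: "continuous_map T euclideanreal g"
    unfolding g_def by (rule continuous_map_word_function)
  define U where "U = {\<nu> \<in> prob_measures T. integral\<^sup>L \<nu> \<phi> \<in> {..<integral\<^sup>L \<mu> \<phi> + \<epsilon>}} \<inter>
    {\<nu> \<in> prob_measures T. integral\<^sup>L \<nu> g \<in> {integral\<^sup>L \<mu> g - \<epsilon><..}}"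
  have U: "openin (weak_star_topology T) U"
    unfolding U_def by (intro openin_Int openin_weak_star_basic \<phi> g) auto
  have "\<mu> \<in> U" using \<mu> \<epsilon> by (simp add: U_def)
  define D where "D = real (card (sequences A j))"
  let ?b = "integral\<^sup>L \<mu> \<phi> - P - integral\<^sup>L \<mu> g + 2 * \<epsilon>"
  have bound: "deviation_prob m U n \<le> K' * D * exp (n * ?b)" if n: "0 < n" for n
  proof -
    \<comment> \<open>The Gibbs bound is used at a point \<open>p w\<close> of the cylinder whose own empirical measure is in \<open>U\<close>.\<close>
    define W where "W = {w \<in> language_n A X n. \<exists>x\<in>X. initial_word x n = w \<and> empirical_measure T \<sigma> n x \<in> U}"
    define p where "p w = (SOME x. x \<in> X \<and> initial_word x n = w \<and> empirical_measure T \<sigma> n x \<in> U)" for w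
    have p: "p w \<in> X" "initial_word (p w) n = w" "empirical_measure T \<sigma> n (p w) \<in> U" if "w \<in> W" for w
      using someI_ex[of "\<lambda>x. x \<in> X \<and> initial_word x n = w \<and> empirical_measure T \<sigma> n x \<in> U"] that
      unfolding W_def p_def by blast+
    have finW: "finite W" using finite_language_n by (simp add: W_def)
    have meas: "cylinder X w \<in> sets m" for w by (rule clopen_sets[OF m cylinder_clopen])
    have "{x \<in> topspace T. empirical_measure T \<sigma> n x \<in> U} \<subseteq> (\<Union>w\<in>W. cylinder X w)"
    proof
      fix x assume "x \<in> {x \<in> topspace T. empirical_measure T \<sigma> n x \<in> U}"
      then have "initial_word x n \<in> W" "x \<in> cylinder X (initial_word x n)"
        using initial_word_in_language by (auto simp: W_def cylinder_def)
      then show "x \<in> (\<Union>w\<in>W. cylinder X w)" by blast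
    qed
    then have "deviation_prob m U n \<le> measure m (\<Union>w\<in>W. cylinder X w)"
      using finW meas by (intro m.finite_measure_mono) auto
    also have "\<dots> \<le> (\<Sum>w\<in>W. measure m (cylinder X w))"
      using finW meas by (intro m.finite_measure_subadditive_finite) auto
    also have "\<dots> \<le> (\<Sum>w\<in>W. K' * exp (n * ?b) * exp (birkhoff_sum I g n (p w)))"
    proof (rule sum_mono)
      fix w assume w: "w \<in> W"
      note E = empirical_measure_T[OF n p(1)[OF w]]
      have "birkhoff_sum I \<phi> n (p w) / n < integral\<^sup>L \<mu> \<phi> + \<epsilon>"
        "integral\<^sup>L \<mu> g - \<epsilon> < birkhoff_sum I g n (p w) / n"
        using p(3)[OF w] E(2)[OF \<phi>] E(2)[OF g] by (auto simp: U_def)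
      then have "birkhoff_sum I \<phi> n (p w) < n * (integral\<^sup>L \<mu> \<phi> + \<epsilon>)"
        "n * (integral\<^sup>L \<mu> g - \<epsilon>) < birkhoff_sum I g n (p w)" using n by (simp_all add: field_simps)
      then have "- real n * P + birkhoff_sum I \<phi> n (p w) \<le> n * ?b + birkhoff_sum I g n (p w)"
        by (simp add: algebra_simps)
      then have "K' * exp (- real n * P + birkhoff_sum I \<phi> n (p w)) \<le> K' * exp (n * ?b + birkhoff_sum I g n (p w))"
        using gibbs(1) by simp
      then show "measure m (cylinder X w) \<le> K' * exp (n * ?b) * exp (birkhoff_sum I g n (p w))"
        using gibbs(2)[OF p(1)[OF w], of n] n p(2)[OF w] by (simp add: exp_add mult.assoc)
    qed
    also have "\<dots> = K' * exp (n * ?b) * (\<Sum>w\<in>W. exp (birkhoff_sum I g n (p w)))"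
      by (simp add: sum_distrib_left)
    also have "\<dots> \<le> K' * exp (n * ?b) * D"
      unfolding D_def g_def using p gibbs(1)
      by (intro mult_left_mono sum_exp_birkhoff_sum_le[OF \<mu> \<eta>(2)]) (auto simp: W_def)
    finally show ?thesis by (simp add: mult.commute mult.left_commute)
  qed
  have "\<forall>\<^sub>F n in sequentially. ln (K' * D + 1) / \<epsilon> \<le> real n"
    using filterlim_real_sequentially by (simp add: filterlim_at_top)
  then have "\<forall>\<^sub>F n in sequentially. deviation_prob m U n \<le> exp (real n * a)"
    using eventually_gt_at_top[of 0]
  proof eventually_elim
    case (elim n)
    have KD: "0 \<le> K' * D" using gibbs(1) by (simp add: D_def)
    have "ln (K' * D + 1) \<le> n * \<epsilon>" using elim(1) \<epsilon> by (simp add: field_simps)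
    then have "exp (ln (K' * D + 1)) \<le> exp (n * \<epsilon>)" by (simp only: exp_le_cancel_iff)
    then have "K' * D \<le> exp (n * \<epsilon>)" using KD by simp
    then have "K' * D * exp (n * ?b) \<le> exp (n * \<epsilon>) * exp (n * ?b)" by (rule mult_right_mono) simp
    also have "\<dots> = exp (n * (?b + \<epsilon>))" by (simp add: exp_add[symmetric] algebra_simps)
    also have "\<dots> \<le> exp (n * a)"
    proof -
      have "?b + \<epsilon> \<le> a" using \<eta>(1) unfolding g_def[symmetric] by (simp add: \<epsilon>_def field_simps)
      then show ?thesis by (simp add: mult_left_mono)
    qed
    finally show ?case using bound[OF elim(2)] by linarith
  qed
  then show ?thesis using U \<open>\<mu> \<in> U\<close> by blast
qed

text \<open>If \<open>\<mu>\<close> is not invariant, some \<open>f = 1\<^bsub>\<sigma>\<^sup>-\<^sup>1C\<^esub> - 1\<^bsub>C\<^esub>\<close> has nonzero integral, but its Birkhoff sums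
  telescope, so that empirical measures eventually avoid a neighbourhood of \<open>\<mu>\<close>.\<close>

lemma local_upper_bound_noninvariant:
  assumes \<mu>: "\<mu> \<in> prob_measures T" "\<mu> \<notin> invariant_measures T \<sigma>"
  shows "\<exists>U. openin (weak_star_topology T) U \<and> \<mu> \<in> U \<and>
    (\<forall>\<^sub>F n in sequentially. deviation_prob m U n = 0)"
proof -
  interpret prob_space \<mu> by (rule prob_measuresD[OF \<mu>(1)])
  obtain C where C: "C \<in> clopens" and ne: "measure \<mu> {x \<in> topspace T. \<sigma> x \<in> C} \<noteq> measure \<mu> C"
    using noninvariant_clopen[OF continuous_map_shift \<mu>] by blast
  let ?C' = "{x \<in> topspace T. \<sigma> x \<in> C}"
  have C': "?C' \<in> clopens"
    using openin_continuous_map_preimage[OF continuous_map_shift, of C]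
      closedin_continuous_map_preimage[OF continuous_map_shift, of C] C by (simp add: clopens_def)
  define f where "f x = indicat_real ?C' x - indicat_real C x" for x
  have cont: "continuous_map T euclideanreal (indicat_real C)" "continuous_map T euclideanreal (indicat_real ?C')"
    using C C' continuous_map_indicator_clopen by (auto simp: clopens_def)
  then have f: "continuous_map T euclideanreal f"
    unfolding f_def by (intro continuous_map_diff)
  have ms: "C \<in> sets \<mu>" "?C' \<in> sets \<mu>" using clopen_sets[OF \<mu>(1)] C C' by auto
  have int: "integral\<^sup>L \<mu> f = measure \<mu> ?C' - measure \<mu> C"
  proof -
    have "integral\<^sup>L \<mu> f = integral\<^sup>L \<mu> (indicat_real ?C') - integral\<^sup>L \<mu> (indicat_real C)"
      unfolding f_def using compact_continuous_integrable[OF compact_T _ \<mu>(1)] cont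
      by (intro Bochner_Integration.integral_diff)
    then show ?thesis using ms by (simp add: sets.Int_space_eq2)
  qed
  define \<delta> where "\<delta> = \<bar>integral\<^sup>L \<mu> f\<bar> / 2"
  have \<delta>: "0 < \<delta>" using ne by (simp add: \<delta>_def int)
  define U where "U = {\<nu> \<in> prob_measures T. integral\<^sup>L \<nu> f \<in> {y. \<delta> < \<bar>y\<bar>}}"
  have "open {y::real. \<delta> < \<bar>y\<bar>}" by (intro open_Collect_less continuous_intros)
  then have U: "openin (weak_star_topology T) U"
    unfolding U_def using f by (intro openin_weak_star_basic)
  have "\<mu> \<in> U" using \<mu>(1) \<delta> by (simp add: U_def \<delta>_def)
  have tele: "birkhoff_sum I f n x = indicat_real C ((\<sigma> ^^ n) x) - indicat_real C x" if "x \<in> X" for n x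
  proof (induction n)
    case (Suc n)
    have "f ((\<sigma> ^^ n) x) = indicat_real C ((\<sigma> ^^ Suc n) x) - indicat_real C ((\<sigma> ^^ n) x)"
      using shift_in[OF that, of n] by (simp add: f_def indicator_def)
    then show ?case using Suc by (simp add: birkhoff_sum_def)
  qed (simp add: birkhoff_sum_def)
  have "\<forall>\<^sub>F n in sequentially. 1 / \<delta> \<le> real n"
    using filterlim_real_sequentially by (simp add: filterlim_at_top)
  then have "\<forall>\<^sub>F n in sequentially. deviation_prob m U n = 0"
    using eventually_gt_at_top[of 0]
  proof eventually_elim
    case (elim n)
    have "empirical_measure T \<sigma> n x \<notin> U" if x: "x \<in> X" for x
    proof -
      have "\<bar>birkhoff_sum I f n x\<bar> \<le> 1" unfolding tele[OF x] by (simp add: indicator_def)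
      also have "1 \<le> \<delta> * n" using elim \<delta> by (simp add: field_simps)
      finally have "\<bar>birkhoff_sum I f n x / n\<bar> \<le> \<delta>" using elim(2) by (simp add: field_simps)
      then show ?thesis using empirical_measure_T(2)[OF elim(2) x f] by (simp add: U_def)
    qed
    then have "{x \<in> topspace T. empirical_measure T \<sigma> n x \<in> U} = {}" by auto
    then show ?case by (simp only: measure_empty)
  qed
  then show ?thesis using U \<open>\<mu> \<in> U\<close> by blast
qed

end

section \<open>The local lower bound\<close>

text \<open>The weight \<open>z\<close> is fixed first, so small that the powers of \<open>1 + z\<close> and \<open>1 + card A z\<close> cost at most
  half of \<open>\<delta>\<close>. The remaining factors, polynomial or \<open>z\<^bsup>-2\<gamma>(l)\<^esup>\<close>, are subexponential because \<open>\<gamma>\<close> is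
  sublinear. The product is the number of readings of one block in \<open>card_glue_fibre\<close>.\<close>

lemma edit_ball_subexponential:
  fixes \<delta> :: real
  assumes A: "finite A" and \<gamma>: "(\<lambda>n. real (\<gamma> n) / real n) \<longlonglongrightarrow> 0" and \<delta>: "0 < \<delta>"
  shows "\<forall>\<^sub>F l in sequentially. \<exists>Q.
    (\<forall>v. length v \<le> l + \<gamma> l \<longrightarrow> card {w \<in> lists A. length w = l \<and> (\<exists>d\<le>\<gamma> l. (edit A ^^ d) v w)} \<le> Q) \<and>
    real ((l + \<gamma> l + 1) * (\<tau> + 1) * Q) \<le> exp (\<delta> * l)"
proof -
  define c where "c = real (card A)"
  define z where "z = min 1 (\<delta> / (2 * (2 + c)))"
  have c: "0 \<le> c" by (simp add: c_def)
  have z: "0 < z" "z \<le> 1" using \<delta> c by (auto simp: z_def)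
  have zc: "(2 + c) * z \<le> \<delta> / 2"
  proof -
    have "(2 + c) * z \<le> (2 + c) * (\<delta> / (2 * (2 + c)))" using c by (intro mult_left_mono) (auto simp: z_def)
    also have "\<dots> = \<delta> / 2" using c by (simp add: field_simps)
    finally show ?thesis .
  qed
  have "(\<lambda>l. ln 3 / real l + ln (real l) / real l + ln (real \<tau> + 1) / real l + 2 * ln (1 / z) * (real (\<gamma> l) / real l)) \<longlonglongrightarrow> 0 + 0 + 0 + 2 * ln (1 / z) * 0"
    by (intro tendsto_add tendsto_mult tendsto_const lim_const_over_n lim_ln_over_n \<gamma>)
  then have "\<forall>\<^sub>F l in sequentially. ln 3 / real l + ln (real l) / real l + ln (real \<tau> + 1) / real l + 2 * ln (1 / z) * (real (\<gamma> l) / real l) < \<delta> / 2"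
    by (rule order_tendstoD) (use \<delta> in simp)
  moreover have "\<forall>\<^sub>F l in sequentially. real (\<gamma> l) / real l < 1" using \<gamma> by (rule order_tendstoD) simp
  ultimately show ?thesis using eventually_gt_at_top[of 0]
  proof eventually_elim
    case (elim l)
    have l: "1 \<le> real l" "\<gamma> l \<le> l" using elim(2,3) by (auto simp: field_simps)
    define R where "R = (1 + z) ^ (l + \<gamma> l) * (1 + c * z) ^ l / z ^ (2 * \<gamma> l)"
    have R: "0 \<le> R" using z c by (simp add: R_def)
    have "card {w \<in> lists A. length w = l \<and> (\<exists>d\<le>\<gamma> l. (edit A ^^ d) v w)} \<le> nat \<lfloor>R\<rfloor>"
      if v: "length v \<le> l + \<gamma> l" for v
    proof -
      have "z ^ (2 * \<gamma> l) * card {w \<in> lists A. length w = l \<and> (\<exists>d\<le>\<gamma> l. (edit A ^^ d) v w)}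
          \<le> (1 + z) ^ length v * (1 + c * z) ^ l"
        unfolding c_def by (rule card_edit_ball[OF A z])
      also have "\<dots> \<le> (1 + z) ^ (l + \<gamma> l) * (1 + c * z) ^ l"
        using z c v by (intro mult_right_mono power_increasing) auto
      finally have "real (card {w \<in> lists A. length w = l \<and> (\<exists>d\<le>\<gamma> l. (edit A ^^ d) v w)}) \<le> R"
        using z by (simp add: R_def field_simps)
      then show ?thesis by (simp add: le_nat_floor)
    qed
    moreover have "real ((l + \<gamma> l + 1) * (\<tau> + 1) * nat \<lfloor>R\<rfloor>) \<le> exp (\<delta> * l)"
    proof -
      have R_le: "R \<le> exp (2 * z * l) * exp (c * z * l) * exp (2 * ln (1 / z) * \<gamma> l)"
      proof -
        have "(1 + z) ^ (l + \<gamma> l) \<le> exp z ^ (l + \<gamma> l)" using z by (intro power_mono exp_ge_add_one_self) auto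
        also have "\<dots> = exp (z * real (l + \<gamma> l))" by (simp only: exp_of_nat2_mult)
        also have "\<dots> \<le> exp (2 * z * l)"
        proof -
          have "z * real (l + \<gamma> l) \<le> z * (2 * real l)" using l(2) z by (intro mult_left_mono) auto
          then show ?thesis by (simp add: mult.commute mult.left_commute)
        qed
        finally have 1: "(1 + z) ^ (l + \<gamma> l) \<le> exp (2 * z * l)" .
        have "(1 + c * z) ^ l \<le> exp (c * z) ^ l" using z c by (intro power_mono exp_ge_add_one_self) auto
        also have "\<dots> = exp (c * z * l)" by (simp only: exp_of_nat2_mult)
        finally have 2: "(1 + c * z) ^ l \<le> exp (c * z * l)" .
        have "inverse (z ^ (2 * \<gamma> l)) = exp (ln (1 / z)) ^ (2 * \<gamma> l)"
          using z by (simp add: power_inverse divide_inverse)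
        also have "\<dots> = exp (2 * ln (1 / z) * \<gamma> l)"
          unfolding exp_of_nat2_mult[symmetric] by (simp add: ac_simps)
        finally have 3: "inverse (z ^ (2 * \<gamma> l)) = exp (2 * ln (1 / z) * \<gamma> l)" .
        show ?thesis unfolding R_def divide_inverse 3 using 1 2 c z
          by (intro mult_right_mono mult_mono) auto
      qed
      have "real ((l + \<gamma> l + 1) * (\<tau> + 1) * nat \<lfloor>R\<rfloor>) = real (l + \<gamma> l + 1) * (real \<tau> + 1) * real (nat \<lfloor>R\<rfloor>)"
        by (simp only: of_nat_mult of_nat_add of_nat_1)
      also have "\<dots> \<le> (3 * real l) * (real \<tau> + 1) * R"
        using l R by (intro mult_mono) auto
      also have "\<dots> \<le> (3 * real l) * (real \<tau> + 1) * (exp (2 * z * l) * exp (c * z * l) * exp (2 * ln (1 / z) * \<gamma> l))"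
        using R_le l by (intro mult_left_mono) auto
      also have "\<dots> = exp (ln 3 + ln (real l) + ln (real \<tau> + 1) + 2 * z * l + c * z * l + 2 * ln (1 / z) * \<gamma> l)"
        using l by (simp add: exp_add)
      also have "\<dots> \<le> exp (\<delta> * l)"
      proof -
        have "ln 3 + ln (real l) + ln (real \<tau> + 1) + 2 * ln (1 / z) * \<gamma> l \<le> \<delta> / 2 * l"
          using elim(1) l by (simp add: field_simps)
        moreover have "(2 + c) * z * l \<le> \<delta> / 2 * l" using zc l by (intro mult_right_mono) auto
        ultimately show ?thesis by (simp add: algebra_simps)
      qed
      finally show ?thesis .
    qed
    ultimately show ?case by blast
  qed
qed

text \<open>The number \<open>N\<close> of blocks is just large enough for total length \<open>n\<close> even if every block shrinks by
  \<open>\<gamma>\<close>; then the length overshoots \<open>n\<close> only by a small proportion.\<close>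

lemma block_count_bounds:
  fixes \<delta> :: real
  assumes \<delta>: "0 < \<delta>" "\<delta> \<le> 1/8" and l: "real (\<gamma> + \<tau>) \<le> \<delta> * real l" "0 < l" and n: "real l \<le> \<delta> * real n"
  defines "N \<equiv> n div (l - \<gamma>) + 1"
  shows "n \<le> N * (l - \<gamma>)" "real n \<le> real (N * l)" "real (N * l) \<le> (1 + 4 * \<delta>) * n"
    "real (N * (l + \<gamma> + \<tau>)) \<le> (1 + 6 * \<delta>) * n"
proof -
  have "\<delta> * real l \<le> 1/8 * real l" using \<delta> by (intro mult_right_mono) auto
  then have "real (8 * (\<gamma> + \<tau>)) \<le> real l" using l(1) by simp
  then have "8 * (\<gamma> + \<tau>) \<le> l" by (simp only: of_nat_le_iff)
  then have \<gamma>: "\<gamma> < l" using l(2) by auto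
  then have e: "real (l - \<gamma>) = real l - real \<gamma>" by simp
  have div: "n = (n div (l - \<gamma>)) * (l - \<gamma>) + n mod (l - \<gamma>)" "n mod (l - \<gamma>) < l - \<gamma>"
    using \<gamma> by (simp only: div_mult_mod_eq) (rule mod_less_divisor, use \<gamma> in simp)
  have N: "N * (l - \<gamma>) = (n div (l - \<gamma>)) * (l - \<gamma>) + (l - \<gamma>)" by (simp add: N_def)
  show 1: "n \<le> N * (l - \<gamma>)" using div N by linarith
  have "N * (l - \<gamma>) \<le> N * l" by simp
  then show 2: "real n \<le> real (N * l)" using 1 by linarith
  have "N * (l - \<gamma>) \<le> n + l" using N div(1) by linarith
  then have "real N * (real l - real \<gamma>) \<le> n + l" unfolding e[symmetric] by (metis of_nat_add of_nat_le_iff of_nat_mult)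
  moreover have "real N * (real l - real \<gamma>) \<ge> real N * ((1 - \<delta>) * l)"
    using l(1) by (intro mult_left_mono) (auto simp: algebra_simps)
  ultimately have 3: "(1 - \<delta>) * (real N * l) \<le> (1 + \<delta>) * n" using n by (simp add: algebra_simps)
  also have "\<dots> \<le> ((1 - \<delta>) * (1 + 4 * \<delta>)) * n"
  proof (rule mult_right_mono)
    have "4 * (\<delta> * \<delta>) \<le> 2 * \<delta>" using mult_right_mono[OF \<delta>(2), of \<delta>] \<delta>(1) by simp
    then show "1 + \<delta> \<le> (1 - \<delta>) * (1 + 4 * \<delta>)" by (simp add: algebra_simps)
  qed simp
  finally have "real N * l \<le> (1 + 4 * \<delta>) * n" using \<delta> by (simp add: mult.assoc)
  then show 4: "real (N * l) \<le> (1 + 4 * \<delta>) * n" by simp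
  have "real (N * (l + \<gamma> + \<tau>)) = real N * (l + real (\<gamma> + \<tau>))" by simp
  also have "\<dots> \<le> real N * ((1 + \<delta>) * l)" using l(1) by (intro mult_left_mono) (auto simp: algebra_simps)
  also have "\<dots> = (1 + \<delta>) * real (N * l)" by simp
  also have "\<dots> \<le> (1 + \<delta>) * ((1 + 4 * \<delta>) * n)" using 4 \<delta> by (intro mult_left_mono) auto
  also have "\<dots> = ((1 + \<delta>) * (1 + 4 * \<delta>)) * n" by simp
  also have "\<dots> \<le> (1 + 6 * \<delta>) * n"
  proof (rule mult_right_mono)
    have "4 * (\<delta> * \<delta>) \<le> \<delta>" using mult_right_mono[OF \<delta>(2), of \<delta>] \<delta>(1) by simp
    then show "(1 + \<delta>) * (1 + 4 * \<delta>) \<le> 1 + 6 * \<delta>" by (simp add: algebra_simps)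
  qed simp
  finally show "real (N * (l + \<gamma> + \<tau>)) \<le> (1 + 6 * \<delta>) * n" .
qed

context shift_space
begin

lemma block_distribution:
  assumes "\<mu> \<in> prob_measures T"
  shows "finite_distribution (language_n A X n) (\<lambda>w. measure \<mu> (cylinder X w))"
  by standard (auto simp: finite_language_n measure_cylinder_sum[OF assms])

lemma block_entropy_nonneg:
  assumes "\<mu> \<in> prob_measures T" shows "0 \<le> block_entropy \<mu> n"
proof -
  interpret prob_space \<mu> by (rule prob_measuresD[OF assms])
  have "0 \<le> - measure \<mu> (cylinder X w) * ln (measure \<mu> (cylinder X w))" for w
    by (cases "measure \<mu> (cylinder X w) = 0") (auto simp: mult_le_0_iff ln_le_zero_iff zero_less_measure_iff prob_le_1)
  then show ?thesis unfolding block_entropy_def by (intro sum_nonneg)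
qed

end

text \<open>The combinatorial hypotheses on \<open>G\<close>, with the connecting words given by a function \<open>c\<close>.\<close>

locale approachable_shift = shift_space I A X for I :: "int set" and A :: "'a set" and X +
  fixes G :: "'a list set" and c :: "'a list \<Rightarrow> 'a list \<Rightarrow> 'a list" and \<tau> :: nat and g :: "nat \<Rightarrow> nat"
  assumes G_language: "G \<subseteq> language A X"
    and gluing: "\<And>v w. v \<in> G \<Longrightarrow> w \<in> G \<Longrightarrow> v @ c v w @ w \<in> G \<and> length (c v w) \<le> \<tau>"
    and mistakes: "(\<lambda>n. real (g n) / real n) \<longlonglongrightarrow> 0"
    and approachable: "\<And>w. w \<in> language A X \<Longrightarrow> \<exists>v\<in>G. edit_dist A v w \<le> g (length w)"
begin

lemma edit_replacement:
  obtains r where "\<And>w. w \<in> language_n A X l \<Longrightarrow> r w \<in> G"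
    "\<And>w. w \<in> language_n A X l \<Longrightarrow> \<exists>d\<le>g l. (edit A ^^ d) (r w) w"
proof -
  have "\<exists>v. v \<in> G \<and> (\<exists>d\<le>g l. (edit A ^^ d) v w)" if w: "w \<in> language_n A X l" for w
  proof -
    have wL: "w \<in> language A X" "length w = l" using w by (auto simp: language_n_def)
    then obtain v where v: "v \<in> G" "edit_dist A v w \<le> g l" using approachable by blast
    have "(edit A ^^ edit_dist A v w) v w"
      using v(1) G_language wL by (intro edit_steps_edit_dist) (auto simp: language_def)
    then show ?thesis using v by blast
  qed
  then show thesis using that by metis
qed

text \<open>Concatenating \<open>N\<close> typical words of length \<open>l\<close>, each replaced by a word of \<open>G\<close> and glued to
  the next, produces words of \<open>G\<close> whose Birkhoff averages are close to the integrals with respect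
  to \<open>\<mu>\<close>: typicality controls the average over the \<open>N\<close> blocks, and by invariance the mean of a
  Birkhoff sum over one block is \<open>l\<close> times the integral. At most \<open>exp (\<delta> l N)\<close> sequences of blocks
  lead to the same word, so the number of words obtained is governed by the block entropy.\<close>

theorem many_good_words:
  fixes \<epsilon> :: real
  assumes \<mu>: "\<mu> \<in> invariant_measures T \<sigma>"
    and fin: "finite \<F>" and cont: "\<forall>f\<in>\<F>. continuous_map T euclideanreal f"
    and \<epsilon>: "0 < \<epsilon>"
  shows "\<forall>\<^sub>F l in sequentially. \<forall>\<^sub>F n in sequentially. \<exists>W. finite W \<and> W \<subseteq> G \<and>
    exp (real n * (block_entropy \<mu> l / real l - \<epsilon>)) \<le> card W \<and>
    (\<forall>w\<in>W. n \<le> length w \<and> length w \<le> (1 + \<epsilon>) * n \<and>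
      (\<forall>x\<in>X. initial_word x (length w) = w \<longrightarrow> (\<forall>f\<in>\<F>.
        \<bar>birkhoff_sum I f n x - n * integral\<^sup>L \<mu> f\<bar> \<le> \<epsilon> * n \<and>
        \<bar>birkhoff_sum I f (length w) x - n * integral\<^sup>L \<mu> f\<bar> \<le> \<epsilon> * n)))"
proof -
  have \<F>: "finite \<F>" "\<And>f. f \<in> \<F> \<Longrightarrow> continuous_map T euclideanreal f" using fin cont by auto
  note P = invariant_measuresD(1)[OF \<mu>]
  interpret \<mu>: prob_space \<mu> by (rule prob_measuresD[OF P])
  obtain B where B: "1 \<le> B" "\<And>f x. f \<in> \<F> \<Longrightarrow> x \<in> X \<Longrightarrow> \<bar>f x\<bar> \<le> B"
  proof -
    have "\<exists>b\<ge>0. \<forall>x\<in>X. \<bar>f x\<bar> \<le> b" if "f \<in> \<F>" for f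
      using compact_continuous_bounded[OF compact_T \<F>(2)[OF that]] by (metis topspace_T)
    then obtain b where b: "\<And>f. f \<in> \<F> \<Longrightarrow> 0 \<le> b f \<and> (\<forall>x\<in>X. \<bar>f x\<bar> \<le> b f)" by metis
    have "\<bar>f x\<bar> \<le> 1 + (\<Sum>f\<in>\<F>. b f)" if "f \<in> \<F>" "x \<in> X" for f x
      using b that member_le_sum[of f \<F> b] \<F>(1) by fastforce
    moreover have "0 \<le> (\<Sum>f\<in>\<F>. b f)" using b by (intro sum_nonneg) blast
    ultimately show thesis using that[of "1 + (\<Sum>f\<in>\<F>. b f)"] by simp
  qed
  \<comment> \<open>The errors below add up to \<open>10 \<eta> n + 10 \<delta> B n\<close>, half of \<open>\<epsilon> n\<close> each.\<close>
  define \<eta> where "\<eta> = \<epsilon> / 20"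
  define \<delta> where "\<delta> = min (1/8) (\<epsilon> / (20 * B))"
  have \<eta>: "0 < \<eta>" using \<epsilon> by (simp add: \<eta>_def)
  have \<delta>: "0 < \<delta>" "\<delta> \<le> 1/8" "10 * (\<delta> * B) \<le> \<epsilon> / 2"
  proof -
    show "0 < \<delta>" "\<delta> \<le> 1/8" using \<epsilon> B(1) by (auto simp: \<delta>_def)
    have "\<delta> * B \<le> \<epsilon> / (20 * B) * B" using B(1) by (intro mult_right_mono) (auto simp: \<delta>_def)
    then show "10 * (\<delta> * B) \<le> \<epsilon> / 2" using B(1) by simp
  qed
  have "\<delta> * 1 \<le> \<delta> * B" using \<delta>(1) B(1) by (intro mult_left_mono) auto
  then have \<delta>\<epsilon>: "10 * \<delta> \<le> \<epsilon> / 2" using \<delta>(3) by linarith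
  \<comment> \<open>Replace every function by a block function, uniformly up to \<open>\<eta>\<close> per symbol.\<close>
  have "\<exists>k F b C. 0 \<le> b \<and> (\<forall>u. \<bar>F u\<bar> \<le> b) \<and>
      (\<forall>x\<in>X. \<forall>n. \<bar>birkhoff_sum I f n x - block_sum k F (initial_word x n)\<bar> \<le> \<eta> * n + C)"
    if "f \<in> \<F>" for f
    using birkhoff_sum_block_approximation[OF \<F>(2)[OF that] \<eta>] by metis
  then obtain k F b C where F: "\<And>f u. f \<in> \<F> \<Longrightarrow> \<bar>F f u\<bar> \<le> b f"
    "\<And>f x n. f \<in> \<F> \<Longrightarrow> x \<in> X \<Longrightarrow> \<bar>birkhoff_sum I f n x - block_sum (k f) (F f) (initial_word x n)\<bar> \<le> \<eta> * n + C f"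
    and b: "\<And>f. f \<in> \<F> \<Longrightarrow> 0 \<le> b f"
    by metis
  define Y where "Y f = block_sum (k f) (F f)" for f
  define D where "D f = 2 * b f * (4 * k f + 1)" for f
  have small: "\<forall>\<^sub>F l in sequentially. real (g l) * d + e \<le> \<rho> * real l" if "0 < \<rho>" for d e \<rho>
  proof -
    have "(\<lambda>l. real (g l) / real l * d + e / real l) \<longlonglongrightarrow> 0 * d + 0"
      by (intro tendsto_add tendsto_mult tendsto_const mistakes lim_const_over_n)
    then have "\<forall>\<^sub>F l in sequentially. real (g l) / real l * d + e / real l < \<rho>"
      by (rule order_tendstoD) (use that in simp)
    then show ?thesis using eventually_gt_at_top[of 0]
      by eventually_elim (simp add: field_simps)
  qed
  have ev1: "\<forall>\<^sub>F l in sequentially. \<forall>f\<in>\<F>. real (g l) * D f + (D f * (\<tau> + 1) + 1) \<le> \<eta> * real l"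
    using \<F>(1) small[OF \<eta>] by (intro eventually_ball_finite) auto
  have ev1': "\<forall>\<^sub>F l in sequentially. \<forall>f\<in>\<F>. C f \<le> \<eta> * real l"
    using \<F>(1) small[OF \<eta>, of 0] by (intro eventually_ball_finite) auto
  have ev2: "\<forall>\<^sub>F l in sequentially. real (g l) * 1 + (\<tau> + 1) \<le> \<delta> * real l" by (rule small[OF \<delta>(1)])
  show ?thesis
    using ev1 ev1' ev2 edit_ball_subexponential[OF finite_A mistakes \<delta>(1), of \<tau>] eventually_gt_at_top[of 0]
  proof eventually_elim
    case (elim l)
    let ?S = "language_n A X l" and ?\<gamma> = "g l"
    define p where "p = (\<lambda>w. measure \<mu> (cylinder X w))"
    interpret p: finite_distribution ?S p unfolding p_def by (rule block_distribution[OF P])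
    have H: "block_entropy \<mu> l = (\<Sum>w\<in>?S. - p w * ln (p w))" by (simp add: block_entropy_def p_def)
    obtain r where r: "\<And>w. w \<in> ?S \<Longrightarrow> r w \<in> G" "\<And>w. w \<in> ?S \<Longrightarrow> \<exists>d\<le>?\<gamma>. (edit A ^^ d) (r w) w"
      using edit_replacement by blast
    have lenS: "length w = l" "w \<in> lists A" if "w \<in> ?S" for w using that language_n_subset by auto
    have r_len: "l - ?\<gamma> \<le> length (r w) \<and> length (r w) \<le> l + ?\<gamma>" if w: "w \<in> ?S" for w
    proof -
      obtain d where "d \<le> ?\<gamma>" "(edit A ^^ d) (r w) w" using r(2)[OF w] by blast
      then show ?thesis using edit_steps_length[of d A "r w" w] lenS[OF w] by linarith
    qed
    obtain Q where Q: "\<And>v. length v \<le> l + ?\<gamma> \<Longrightarrow> card {w \<in> lists A. length w = l \<and> (\<exists>d\<le>?\<gamma>. (edit A ^^ d) v w)} \<le> Q"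
      "real ((l + ?\<gamma> + 1) * (\<tau> + 1) * Q) \<le> exp (\<delta> * l)"
      using elim(4) by blast
    have fibre: "card {w \<in> ?S. r w = v} \<le> Q" for v
    proof (cases "{w \<in> ?S. r w = v} = {}")
      case False
      then obtain w where "w \<in> ?S" "r w = v" by blast
      then have "length v \<le> l + ?\<gamma>" using r_len by blast
      moreover have "card {w \<in> ?S. r w = v} \<le> card {w \<in> lists A. length w = l \<and> (\<exists>d\<le>?\<gamma>. (edit A ^^ d) v w)}"
      proof (rule card_mono)
        show "finite {w \<in> lists A. length w = l \<and> (\<exists>d\<le>?\<gamma>. (edit A ^^ d) v w)}"
          by (rule finite_subset[OF _ finite_words[OF finite_A, of l]]) auto
        show "{w \<in> ?S. r w = v} \<subseteq> {w \<in> lists A. length w = l \<and> (\<exists>d\<le>?\<gamma>. (edit A ^^ d) v w)}"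
          using r(2) lenS by auto
      qed
      ultimately show ?thesis using Q(1) by (meson order_trans)
    qed (simp only: card.empty)
    have meanY: "\<bar>p.mean (Y f) - l * integral\<^sup>L \<mu> f\<bar> \<le> \<eta> * l + C f" if f: "f \<in> \<F>" for f
    proof -
      note int = integral_birkhoff_sum[OF \<mu> \<F>(2)[OF f], of l]
      have intY: "integrable \<mu> (\<lambda>x. Y f (initial_word x l))"
        by (rule compact_continuous_integrable[OF compact_T continuous_map_word_function P])
      have "p.mean (Y f) = (\<integral>x. Y f (initial_word x l) \<partial>\<mu>)"
        by (subst p.mean_def) (simp only: integral_word_function[OF P] p_def)
      then have "\<bar>p.mean (Y f) - l * integral\<^sup>L \<mu> f\<bar> = \<bar>\<integral>x. birkhoff_sum I f l x - Y f (initial_word x l) \<partial>\<mu>\<bar>"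
        using int intY by (simp add: abs_minus_commute)
      also have "\<dots> \<le> (\<integral>x. \<bar>birkhoff_sum I f l x - Y f (initial_word x l)\<bar> \<partial>\<mu>)"
        by (rule integral_abs_bound)
      also have "\<dots> \<le> (\<integral>x. \<eta> * l + C f \<partial>\<mu>)"
        using int(1) intY F(2)[OF f] prob_measuresD(3)[OF P] unfolding Y_def[symmetric]
        by (intro integral_mono) auto
      finally show ?thesis by (simp add: \<mu>.prob_space)
    qed
    \<comment> \<open>The tolerance \<open>1\<close> per block suffices: it is negligible compared with the block length \<open>l\<close>.\<close>
    have "\<forall>\<^sub>F N in sequentially. exp (real N * (block_entropy \<mu> l - 1)) \<le>
      card {ws \<in> sequences ?S N. \<forall>y\<in>Y ` \<F>. \<bar>sum_list (map y ws) - real N * p.mean y\<bar> \<le> 1 * real N}"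
      unfolding H using \<F>(1) by (intro p.typical_sequences) auto
    then obtain N0 where N0: "\<And>N. N0 \<le> N \<Longrightarrow> exp (real N * (block_entropy \<mu> l - 1)) \<le>
      card {ws \<in> sequences ?S N. \<forall>y\<in>Y ` \<F>. \<bar>sum_list (map y ws) - real N * p.mean y\<bar> \<le> 1 * real N}"
      unfolding eventually_sequentially by blast
    have "\<forall>\<^sub>F n in sequentially. real l / \<delta> \<le> real n"
      using filterlim_real_sequentially by (simp add: filterlim_at_top)
    then show ?case
      using eventually_ge_at_top[of "N0 * l"]
    proof eventually_elim
      case n: (elim n)
      define N where "N = n div (l - ?\<gamma>) + 1"
      have l\<gamma>: "real (?\<gamma> + \<tau>) \<le> \<delta> * real l" and l1: "1 \<le> \<delta> * real l" using elim(3) by auto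
      have nl: "real l \<le> \<delta> * real n" using n(1) \<delta>(1) by (simp add: field_simps)
      note N = block_count_bounds[OF \<delta>(1,2) l\<gamma> elim(5) nl, folded N_def]
      have n0: "0 < real n" using nl elim(5) \<delta>(1) by (metis less_le_trans of_nat_0_less_iff zero_less_mult_pos)
      have "N0 \<le> N"
      proof -
        have "N0 * l \<le> N * l" using n(2) N(2) by linarith
        then show ?thesis using elim(5) by simp
      qed
      have Nl2: "real (N * l) \<le> 2 * real n"
      proof -
        have "(1 + 4 * \<delta>) * n \<le> 2 * real n" using \<delta>(2) by (intro mult_right_mono) auto
        then show ?thesis using N(3) by linarith
      qed
      let ?\<Theta> = "glue c r"
      define Typ where "Typ = {ws \<in> sequences ?S N. \<forall>y\<in>Y ` \<F>. \<bar>sum_list (map y ws) - real N * p.mean y\<bar> \<le> 1 * real N}"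
      have finTyp: "finite Typ" using finite_sequences[OF finite_language_n] by (simp add: Typ_def)
      define W where "W = ?\<Theta> ` Typ"
      have "exp (real n * (block_entropy \<mu> l / l - \<epsilon>)) \<le> card W"
      proof -
        have "Typ \<subseteq> (\<Union>y\<in>W. {ws \<in> sequences ?S N. ?\<Theta> ws = y})" by (auto simp: W_def Typ_def)
        then have "card Typ \<le> card (\<Union>y\<in>W. {ws \<in> sequences ?S N. ?\<Theta> ws = y})"
          using finTyp finite_sequences[OF finite_language_n] by (intro card_mono finite_UN_I) (auto simp: W_def)
        also have "\<dots> \<le> (\<Sum>y\<in>W. card {ws \<in> sequences ?S N. ?\<Theta> ws = y})"
          using finTyp by (intro card_UN_le) (simp add: W_def)
        also have "\<dots> \<le> (\<Sum>y\<in>W. ((l + ?\<gamma> + 1) * (\<tau> + 1) * Q) ^ N)"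
          using gluing r(1) r_len fibre finite_language_n by (intro sum_mono card_glue_fibre[of G]) auto
        also have "\<dots> = card W * ((l + ?\<gamma> + 1) * (\<tau> + 1) * Q) ^ N" by simp
        finally have "real (card Typ) \<le> real (card W) * real ((l + ?\<gamma> + 1) * (\<tau> + 1) * Q) ^ N"
          by (metis of_nat_le_iff of_nat_mult of_nat_power)
        also have "\<dots> \<le> card W * exp (\<delta> * l) ^ N"
          using Q(2) by (intro mult_left_mono power_mono) auto
        also have "exp (\<delta> * l) ^ N = exp (\<delta> * real (N * l))"
          by (simp add: exp_of_nat_mult[symmetric] ac_simps)
        finally have cW: "card Typ \<le> card W * exp (\<delta> * real (N * l))" .
        have "exp (real N * (block_entropy \<mu> l - 1)) \<le> card W * exp (\<delta> * real (N * l))"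
          using N0[OF \<open>N0 \<le> N\<close>] cW unfolding Typ_def by linarith
        then have "exp (real N * (block_entropy \<mu> l - 1)) / exp (\<delta> * real (N * l)) \<le> card W"
          by (simp add: divide_le_eq)
        then have "exp (real N * (block_entropy \<mu> l - 1) - \<delta> * real (N * l)) \<le> card W"
          by (simp only: exp_diff)
        moreover have "real n * (block_entropy \<mu> l / l - \<epsilon>) \<le> real N * (block_entropy \<mu> l - 1) - \<delta> * real (N * l)"
        proof -
          have "real n * (block_entropy \<mu> l / l) \<le> real (N * l) * (block_entropy \<mu> l / l)"
            using N(2) block_entropy_nonneg[OF P] by (intro mult_right_mono) auto
          then have 1: "real n * (block_entropy \<mu> l / l) \<le> real N * block_entropy \<mu> l" using elim(5) by simp
          have "real N * 1 \<le> real N * (\<delta> * l)" using l1 by (intro mult_left_mono) auto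
          then have 2: "real N \<le> \<delta> * real (N * l)" by (simp add: ac_simps)
          have "\<delta> * real (N * l) \<le> \<delta> * (2 * real n)" using Nl2 \<delta>(1) by (intro mult_left_mono) auto
          moreover have "(4 * \<delta>) * n \<le> \<epsilon> * n" using \<delta>\<epsilon> \<delta>(1) \<epsilon> by (intro mult_right_mono) auto
          ultimately show ?thesis using 1 2 by (simp add: algebra_simps)
        qed
        ultimately show ?thesis by (meson exp_le_cancel_iff order_trans)
      qed
      moreover have "finite W" using finTyp by (simp add: W_def)
      moreover have "w \<in> G \<and> n \<le> length w \<and> length w \<le> (1 + \<epsilon>) * n \<and>
        (\<forall>x\<in>X. initial_word x (length w) = w \<longrightarrow> (\<forall>f\<in>\<F>.
        \<bar>birkhoff_sum I f n x - n * integral\<^sup>L \<mu> f\<bar> \<le> \<epsilon> * n \<and>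
        \<bar>birkhoff_sum I f (length w) x - n * integral\<^sup>L \<mu> f\<bar> \<le> \<epsilon> * n))" if wW: "w \<in> W" for w
      proof -
        obtain ws where ws: "w = ?\<Theta> ws" "ws \<in> sequences ?S N"
          "\<And>f. f \<in> \<F> \<Longrightarrow> \<bar>sum_list (map (Y f) ws) - real N * p.mean (Y f)\<bar> \<le> 1 * real N"
          using wW unfolding W_def Typ_def by blast
        let ?L = "length w"
        have "w \<in> G" unfolding ws(1) using gluing r(1) ws(2) by (intro glue_in[of G c ?S r ws N]) (auto simp: N_def)
        have L: "N * (l - ?\<gamma>) \<le> ?L" "?L \<le> N * (l + ?\<gamma> + \<tau>)"
          using glue_length[of G c \<tau> ?S r "l - ?\<gamma>" "l + ?\<gamma>" ws N] gluing r(1) r_len ws(1,2) by auto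
        have nL: "n \<le> ?L" using N(1) L(1) by linarith
        have "real ?L \<le> real (N * (l + ?\<gamma> + \<tau>))" using L(2) by (simp only: of_nat_le_iff)
        then have L6: "real ?L \<le> (1 + 6 * \<delta>) * n" using N(4) by linarith
        have "(1 + 6 * \<delta>) * n \<le> (1 + \<epsilon>) * n" "(1 + 6 * \<delta>) * n \<le> 2 * real n"
          using \<delta>\<epsilon> \<delta> \<epsilon> by (intro mult_right_mono; simp)+
        then have L2: "real ?L \<le> (1 + \<epsilon>) * n" "real ?L \<le> 2 * real n" using L6 by linarith+
        have main: "\<bar>birkhoff_sum I f n x - n * integral\<^sup>L \<mu> f\<bar> \<le> \<epsilon> * n \<and>
            \<bar>birkhoff_sum I f ?L x - n * integral\<^sup>L \<mu> f\<bar> \<le> \<epsilon> * n"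
          if x: "x \<in> X" "initial_word x ?L = w" and f: "f \<in> \<F>" for x f
        proof -
          let ?i = "integral\<^sup>L \<mu> f"
          have e1: "\<bar>birkhoff_sum I f ?L x - Y f w\<bar> \<le> \<eta> * ?L + C f"
            using F(2)[OF f x(1), of ?L] x(2) by (simp add: Y_def)
          have "\<bar>Y f w - sum_list (map (Y f) ws)\<bar> \<le> N * (?\<gamma> * D f + 4 * b f * k f + b f * \<tau>)"
            unfolding ws(1) Y_def
          proof (rule block_sum_glue[OF gluing r(1) F(1)[OF f] _ ws(2)])
            fix u assume u: "u \<in> ?S"
            obtain d where d: "d \<le> ?\<gamma>" "(edit A ^^ d) (r u) u" using r(2)[OF u] by blast
            have "\<bar>block_sum (k f) (F f) (r u) - block_sum (k f) (F f) u\<bar> \<le> d * D f"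
              using edit_steps_bound[OF block_sum_edit[OF F(1)[OF f]] d(2)] by (simp add: D_def)
            also have "\<dots> \<le> ?\<gamma> * D f" using d(1) b[OF f] by (intro mult_right_mono) (auto simp: D_def)
            finally show "\<bar>block_sum (k f) (F f) (r u) - block_sum (k f) (F f) u\<bar> \<le> ?\<gamma> * D f" .
          qed
          also have "\<dots> \<le> N * (?\<gamma> * D f + D f * (\<tau> + 1))"
          proof (intro mult_left_mono)
            have "0 \<le> b f * k f" "0 \<le> b f * k f * \<tau>" "0 \<le> b f * \<tau>" using b[OF f] by simp_all
            then show "?\<gamma> * D f + 4 * b f * k f + b f * \<tau> \<le> ?\<gamma> * D f + D f * (\<tau> + 1)"
              using b[OF f] by (simp add: D_def algebra_simps)
          qed simp
          finally have e2: "\<bar>Y f w - sum_list (map (Y f) ws)\<bar> \<le> N * (?\<gamma> * D f + D f * (\<tau> + 1))" .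
          have e3: "\<bar>sum_list (map (Y f) ws) - N * p.mean (Y f)\<bar> \<le> N" using ws(3)[OF f] by simp
          have e4: "\<bar>N * p.mean (Y f) - real (N * l) * ?i\<bar> \<le> N * (\<eta> * l + C f)"
          proof -
            have "N * p.mean (Y f) - real (N * l) * ?i = N * (p.mean (Y f) - l * ?i)"
              by (simp add: right_diff_distrib)
            then have "\<bar>N * p.mean (Y f) - real (N * l) * ?i\<bar> = N * \<bar>p.mean (Y f) - l * ?i\<bar>"
              by (simp add: abs_mult)
            also have "\<dots> \<le> N * (\<eta> * l + C f)" by (intro mult_left_mono meanY[OF f]) simp
            finally show ?thesis .
          qed
          have C\<eta>: "C f \<le> \<eta> * l" using elim(2) f by auto
          have "1 * real l \<le> real N * l" by (intro mult_right_mono) (auto simp: N_def)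
          then have "\<eta> * l \<le> \<eta> * real (N * l)" using \<eta> by (intro mult_left_mono) auto
          then have CN: "C f \<le> \<eta> * real (N * l)" using C\<eta> by linarith
          have "N * (?\<gamma> * D f + D f * (\<tau> + 1)) + N = N * (?\<gamma> * D f + (D f * (\<tau> + 1) + 1))"
            by (simp add: algebra_simps)
          also have "\<dots> \<le> N * (\<eta> * l)" using elim(1) f by (intro mult_left_mono) auto
          finally have e23: "N * (?\<gamma> * D f + D f * (\<tau> + 1)) + N \<le> \<eta> * real (N * l)" by (simp add: ac_simps)
          have "N * (\<eta> * l + C f) \<le> N * (\<eta> * l + \<eta> * l)" using C\<eta> by (intro mult_left_mono) auto
          then have e4': "N * (\<eta> * l + C f) \<le> 2 * (\<eta> * real (N * l))" by (simp add: ac_simps)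
          have "\<eta> * real (N * l) \<le> \<eta> * (2 * real n)" "\<eta> * ?L \<le> \<eta> * (2 * real n)"
            using Nl2 L2(2) \<eta> by (intro mult_left_mono; simp)+
          then have S1: "\<bar>birkhoff_sum I f ?L x - real (N * l) * ?i\<bar> \<le> 10 * (\<eta> * n)"
            using e1 e2 e3 e4 e23 e4' CN by linarith
          have iB: "\<bar>?i\<bar> \<le> B"
          proof -
            have "\<bar>?i\<bar> \<le> (\<integral>x. \<bar>f x\<bar> \<partial>\<mu>)" by (rule integral_abs_bound)
            also have "\<dots> \<le> (\<integral>x. B \<partial>\<mu>)"
              using compact_continuous_integrable[OF compact_T \<F>(2)[OF f] P] B(2)[OF f] prob_measuresD(3)[OF P]
              by (intro integral_mono) auto
            finally show ?thesis by (simp add: \<mu>.prob_space)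
          qed
          have "\<bar>real (N * l) * ?i - n * ?i\<bar> = \<bar>real (N * l) - n\<bar> * \<bar>?i\<bar>"
            by (simp only: left_diff_distrib[symmetric] abs_mult)
          also have "\<dots> \<le> (4 * \<delta> * n) * B"
            using N(2,3) iB B(1) \<delta>(1) by (intro mult_mono) (auto simp: algebra_simps)
          finally have S2: "\<bar>real (N * l) * ?i - n * ?i\<bar> \<le> 4 * (\<delta> * B * n)" by (simp add: ac_simps)
          have "birkhoff_sum I f ?L x = birkhoff_sum I f n x + birkhoff_sum I f (?L - n) ((\<sigma> ^^ n) x)"
            using birkhoff_sum_add[of f n "?L - n" x] nL by simp
          then have "\<bar>birkhoff_sum I f ?L x - birkhoff_sum I f n x\<bar> = \<bar>birkhoff_sum I f (?L - n) ((\<sigma> ^^ n) x)\<bar>" by simp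
          also have "\<dots> \<le> real (?L - n) * B"
            by (rule birkhoff_sum_bound[of f B, OF B(2)[OF f] shift_in[OF x(1)]])
          also have "\<dots> \<le> (6 * \<delta> * n) * B"
            using nL L6 B(1) by (intro mult_right_mono) (auto simp: algebra_simps)
          finally have S3: "\<bar>birkhoff_sum I f ?L x - birkhoff_sum I f n x\<bar> \<le> 6 * (\<delta> * B * n)" by (simp add: ac_simps)
          have "10 * (\<delta> * B) * n \<le> \<epsilon> / 2 * real n" using \<delta>(3) by (intro mult_right_mono) auto
          then have "10 * (\<delta> * B * n) \<le> \<epsilon> / 2 * real n" by simp
          moreover have "10 * (\<eta> * n) = \<epsilon> / 2 * real n" by (simp add: \<eta>_def)
          moreover have "0 \<le> \<delta> * B * n" using \<delta>(1) B(1) by simp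
          ultimately have "10 * (\<eta> * n) + 10 * (\<delta> * B * n) \<le> \<epsilon> * n" "10 * (\<eta> * n) + 4 * (\<delta> * B * n) \<le> \<epsilon> * n"
            by linarith+
          then show ?thesis using S1 S2 S3 by linarith
        qed
        show ?thesis using \<open>w \<in> G\<close> nL L2(1) main by blast
      qed
      ultimately show ?case by (intro exI[of _ W]) blast
    qed
  qed
qed

end

section \<open>Entropy and the large deviations principle\<close>

locale gibbs_shift = approachable_shift I A X G c \<tau> g
  for I :: "int set" and A :: "'a set" and X G c \<tau> g +
  fixes m :: "(int \<Rightarrow> 'a) measure" and \<phi> :: "(int \<Rightarrow> 'a) \<Rightarrow> real" and K K' P :: real
  assumes m: "m \<in> prob_measures (shift_topology I A X)"
    and \<phi>: "continuous_map (shift_topology I A X) euclideanreal \<phi>"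
    and K: "0 < K" "0 < K'"
    and gibbs_upper: "\<And>x n. x \<in> X \<Longrightarrow> 1 \<le> n \<Longrightarrow>
      measure m (cylinder X (initial_word x n)) \<le> K' * exp (- real n * P + birkhoff_sum I \<phi> n x)"
    and gibbs_lower: "\<And>x n. x \<in> X \<Longrightarrow> 1 \<le> n \<Longrightarrow> initial_word x n \<in> G \<Longrightarrow>
      K * exp (- real n * P + birkhoff_sum I \<phi> n x) \<le> measure m (cylinder X (initial_word x n))"
begin

text \<open>Cylinders of words of the same length are disjoint, so no point is counted more often than there
  are lengths.\<close>

lemma sum_cylinders_le:
  assumes W: "finite W" and V: "V \<in> sets m" "\<And>w. w \<in> W \<Longrightarrow> cylinder X w \<subseteq> V"
  shows "(\<Sum>w\<in>W. measure m (cylinder X w)) \<le> card (length ` W) * measure m V"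
proof -
  interpret m: prob_space m by (rule prob_measuresD[OF m])
  have "(\<Sum>w\<in>W. measure m (cylinder X w)) = (\<Sum>l\<in>length ` W. \<Sum>w\<in>{w \<in> W. length w = l}. measure m (cylinder X w))"
    using W by (intro sum.group[symmetric]) auto
  also have "\<dots> \<le> (\<Sum>l\<in>length ` W. measure m V)"
  proof (rule sum_mono)
    fix l
    have "(\<Sum>w\<in>{w \<in> W. length w = l}. measure m (cylinder X w)) = measure m (\<Union>w\<in>{w \<in> W. length w = l}. cylinder X w)"
    proof (rule m.finite_measure_finite_Union[symmetric])
      show "cylinder X ` {w \<in> W. length w = l} \<subseteq> sets m" using clopen_sets[OF m cylinder_clopen] by blast
      show "disjoint_family_on (cylinder X) {w \<in> W. length w = l}"
        by (auto simp: disjoint_family_on_def cylinder_def)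
    qed (use W in simp)
    also have "\<dots> \<le> measure m V" using V by (intro m.finite_measure_mono) auto
    finally show "(\<Sum>w\<in>{w \<in> W. length w = l}. measure m (cylinder X w)) \<le> measure m V" .
  qed
  finally show ?thesis by simp
qed

text \<open>The words of \<open>many_good_words\<close> have lengths between \<open>n\<close> and \<open>(1 + e) n\<close>. The cylinder of such a word
  consists of points with empirical measure in \<open>U\<close>, and the lower Gibbs bound applies at the full
  length of the word, which changes the exponent only by \<open>O(e n)\<close>.\<close>

theorem local_lower_bound:
  assumes \<mu>: "\<mu> \<in> invariant_measures T \<sigma>"
    and U: "openin (weak_star_topology T) U" "\<mu> \<in> U" and \<epsilon>: "0 < \<epsilon>"
  shows "\<forall>\<^sub>F l in sequentially. \<forall>\<^sub>F n in sequentially.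
    exp (real n * (block_entropy \<mu> l / real l + integral\<^sup>L \<mu> \<phi> - P - \<epsilon>)) \<le> deviation_prob m U n"
proof -
  interpret m: prob_space m by (rule prob_measuresD[OF m])
  obtain \<F> \<epsilon>' where \<F>: "finite \<F>" "0 < \<epsilon>'" "\<And>f. f \<in> \<F> \<Longrightarrow> continuous_map T euclideanreal f"
    and U_nbhd: "\<And>\<nu>. \<nu> \<in> prob_measures T \<Longrightarrow> \<forall>f\<in>\<F>. \<bar>integral\<^sup>L \<nu> f - integral\<^sup>L \<mu> f\<bar> < \<epsilon>' \<Longrightarrow> \<nu> \<in> U"
    using weak_star_neighbourhood[OF U] by metis
  define e where "e = min (\<epsilon>' / 2) (\<epsilon> / (\<bar>P\<bar> + 3))"
  have e: "0 < e" "e < \<epsilon>'" using \<F>(2) \<epsilon> by (auto simp: e_def)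
  have eP: "e * (\<bar>P\<bar> + 3) \<le> \<epsilon>"
  proof -
    have "e * (\<bar>P\<bar> + 3) \<le> \<epsilon> / (\<bar>P\<bar> + 3) * (\<bar>P\<bar> + 3)" by (intro mult_right_mono) (auto simp: e_def)
    then show ?thesis by simp
  qed
  have "finite (insert \<phi> \<F>)" "\<forall>f\<in>insert \<phi> \<F>. continuous_map T euclideanreal f" using \<F> \<phi> by auto
  from many_good_words[OF \<mu> this e(1)] show ?thesis
  proof eventually_elim
    case (elim l)
    have "\<forall>\<^sub>F n in sequentially. 2 * ln (2 / K) / e \<le> real n"
      using filterlim_real_sequentially by (simp add: filterlim_at_top)
    then show ?case using elim eventually_gt_at_top[of 0]
    proof eventually_elim
      case n: (elim n)
      from n(2) obtain W where W: "finite W" "W \<subseteq> G" "exp (real n * (block_entropy \<mu> l / real l - e)) \<le> card W"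
        and len: "\<And>w. w \<in> W \<Longrightarrow> n \<le> length w \<and> length w \<le> (1 + e) * n"
        and bs: "\<And>w x f. w \<in> W \<Longrightarrow> x \<in> X \<Longrightarrow> initial_word x (length w) = w \<Longrightarrow> f \<in> insert \<phi> \<F> \<Longrightarrow>
          \<bar>birkhoff_sum I f n x - n * integral\<^sup>L \<mu> f\<bar> \<le> e * n \<and>
          \<bar>birkhoff_sum I f (length w) x - n * integral\<^sup>L \<mu> f\<bar> \<le> e * n" by blast
      define V where "V = {x \<in> topspace T. empirical_measure T \<sigma> n x \<in> U}"
      have "openin T V"
        unfolding V_def using continuous_map_empirical_measure[OF continuous_map_shift n(3)] U(1)
        by (rule openin_continuous_map_preimage)
      then have V: "V \<in> sets m" using prob_measuresD(2)[OF m] openin_sets_borel_of by blast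
      have sub: "cylinder X w \<subseteq> V" if w: "w \<in> W" for w
      proof
        fix x assume "x \<in> cylinder X w"
        then have x: "x \<in> X" "initial_word x (length w) = w" by (auto simp: cylinder_def)
        note E = empirical_measure_T[OF n(3) x(1)]
        have "\<bar>integral\<^sup>L (empirical_measure T \<sigma> n x) f - integral\<^sup>L \<mu> f\<bar> < \<epsilon>'" if f: "f \<in> \<F>" for f
        proof -
          have "\<bar>birkhoff_sum I f n x - n * integral\<^sup>L \<mu> f\<bar> / n \<le> e"
            using bs[OF w x, of f] f n(3) by (simp add: divide_le_eq mult.commute)
          moreover have "birkhoff_sum I f n x / n - integral\<^sup>L \<mu> f = (birkhoff_sum I f n x - n * integral\<^sup>L \<mu> f) / n"
            using n(3) by (simp add: diff_divide_distrib)
          ultimately show ?thesis using E(2)[OF \<F>(3)[OF f]] e(2) by (simp add: abs_divide)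
        qed
        then have "empirical_measure T \<sigma> n x \<in> U" using U_nbhd[OF E(1)] by blast
        then show "x \<in> V" using x(1) by (simp add: V_def)
      qed
      define \<kappa> where "\<kappa> = K * exp (n * (integral\<^sup>L \<mu> \<phi> - P) - e * n * (\<bar>P\<bar> + 1))"
      have "\<kappa> \<le> measure m (cylinder X w)" if w: "w \<in> W" for w
      proof -
        have "w \<in> language A X" using w W(2) G_language by blast
        then obtain x where x: "x \<in> X" "initial_word x (length w) = w"
          by (auto simp: language_def cylinder_def)
        have "(real (length w) - n) * P \<le> (real (length w) - n) * \<bar>P\<bar>"
          using len[OF w] by (intro mult_left_mono) auto
        also have "\<dots> \<le> (e * n) * \<bar>P\<bar>" using len[OF w] by (intro mult_right_mono) (auto simp: algebra_simps)
        finally have "n * (integral\<^sup>L \<mu> \<phi> - P) - e * n * (\<bar>P\<bar> + 1)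
            \<le> - real (length w) * P + (n * integral\<^sup>L \<mu> \<phi> - e * n)"
          by (simp add: algebra_simps)
        also have "\<dots> \<le> - real (length w) * P + birkhoff_sum I \<phi> (length w) x"
          using bs[OF w x, of \<phi>] by (simp add: abs_le_iff)
        finally have "\<kappa> \<le> K * exp (- real (length w) * P + birkhoff_sum I \<phi> (length w) x)"
          using K(1) by (simp add: \<kappa>_def)
        also have "\<dots> \<le> measure m (cylinder X w)"
          using gibbs_lower[OF x(1), of "length w"] x(2) len[OF w] n(3) w W(2) by auto
        finally show ?thesis .
      qed
      then have "(\<Sum>w\<in>W. \<kappa>) \<le> (\<Sum>w\<in>W. measure m (cylinder X w))" by (rule sum_mono)
      also have "\<dots> \<le> card (length ` W) * measure m V"
        by (rule sum_cylinders_le[OF W(1) V sub])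
      also have "\<dots> \<le> (e * n + 1) * measure m V"
      proof (rule mult_right_mono)
        have "length ` W \<subseteq> {n..nat \<lfloor>(1 + e) * n\<rfloor>}" using len by (auto simp: le_nat_floor)
        from card_mono[OF _ this] have "card (length ` W) \<le> nat \<lfloor>(1 + e) * n\<rfloor> + 1 - n" by simp
        moreover have "real (nat \<lfloor>(1 + e) * n\<rfloor>) \<le> (1 + e) * n" using e by (intro of_nat_floor) simp
        moreover have "n \<le> nat \<lfloor>(1 + e) * n\<rfloor>" using e by (intro le_nat_floor) (simp add: algebra_simps)
        ultimately show "real (card (length ` W)) \<le> e * n + 1" by (simp add: algebra_simps)
      qed simp
      finally have count: "card W * \<kappa> \<le> (e * n + 1) * measure m V" by simp
      \<comment> \<open>The number of lengths and the constant \<open>K\<close> are absorbed by \<open>exp (e n)\<close>.\<close>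
      have absorb: "e * n + 1 \<le> K * exp (e * n)"
      proof -
        have half: "ln (2 / K) \<le> e * n / 2" using n(1) e(1) by (simp add: field_simps)
        have "2 / K = exp (ln (2 / K))" using K(1) by simp
        also have "\<dots> \<le> exp (e * n / 2)" using half by (simp only: exp_le_cancel_iff)
        finally have 1: "2 \<le> K * exp (e * n / 2)" using K(1) by (simp add: field_simps)
        have 2: "1 + e * n / 2 \<le> exp (e * n / 2)" by (rule exp_ge_add_one_self)
        have "2 * (1 + e * n / 2) \<le> K * exp (e * n / 2) * exp (e * n / 2)"
          using 1 2 e(1) by (intro mult_mono) auto
        also have "\<dots> = K * exp (e * n)" by (simp add: exp_add[symmetric] mult.assoc)
        finally show ?thesis by simp
      qed
      have "exp (real n * (block_entropy \<mu> l / real l - e)) * \<kappa> \<le> card W * \<kappa>"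
        using W(3) K(1) by (intro mult_right_mono) (auto simp: \<kappa>_def)
      also note count
      also have "(e * n + 1) * measure m V \<le> K * exp (e * n) * measure m V"
        by (intro mult_right_mono absorb) simp
      finally have "exp (real n * (block_entropy \<mu> l / real l - e)) * exp (n * (integral\<^sup>L \<mu> \<phi> - P) - e * n * (\<bar>P\<bar> + 1))
          \<le> exp (e * n) * measure m V"
        using K(1) by (simp add: \<kappa>_def mult.assoc mult.left_commute[of _ K])
      then have "exp (real n * (block_entropy \<mu> l / real l - e)) * exp (n * (integral\<^sup>L \<mu> \<phi> - P) - e * n * (\<bar>P\<bar> + 1)) / exp (e * n)
          \<le> measure m V"
        by (simp add: divide_le_eq mult.commute)
      then have "exp (real n * (block_entropy \<mu> l / real l - e) + (n * (integral\<^sup>L \<mu> \<phi> - P) - e * n * (\<bar>P\<bar> + 1)) - e * n)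
          \<le> measure m V"
        by (simp only: exp_add exp_diff)
      moreover have "real n * (block_entropy \<mu> l / real l + integral\<^sup>L \<mu> \<phi> - P - \<epsilon>) \<le>
          real n * (block_entropy \<mu> l / real l - e) + (n * (integral\<^sup>L \<mu> \<phi> - P) - e * n * (\<bar>P\<bar> + 1)) - e * n"
      proof -
        have "real n * (e * (\<bar>P\<bar> + 3)) \<le> real n * \<epsilon>" using eP by (intro mult_left_mono) auto
        then show ?thesis by (simp add: algebra_simps)
      qed
      ultimately show ?case unfolding V_def by (meson exp_le_cancel_iff order_trans)
    qed
  qed
qed

text \<open>The two local bounds refer to the same probabilities, which forces \<open>H\<^sub>l / l\<close> to be asymptotically
  at most each increment \<open>H\<^bsub>j+1\<^esub> - H\<^sub>j\<close>. As \<open>H\<^sub>l / l\<close> is the average of the first \<open>l\<close> increments, it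
  converges to their infimum. In particular the limit that defines the entropy exists.\<close>

theorem block_entropy_rate:
  assumes \<mu>: "\<mu> \<in> invariant_measures T \<sigma>"
  shows "\<And>l. 0 < l \<Longrightarrow> entropy_of A X \<mu> \<le> block_entropy \<mu> l / real l"
    and "\<And>\<epsilon>. 0 < \<epsilon> \<Longrightarrow> \<exists>j. block_entropy \<mu> (j + 1) - block_entropy \<mu> j < entropy_of A X \<mu> + \<epsilon>"
proof -
  note Pr = invariant_measuresD(1)[OF \<mu>]
  interpret prob_space \<mu> by (rule prob_measuresD[OF Pr])
  let ?H = "block_entropy \<mu>"
  \<comment> \<open>In a neighbourhood given by the upper bound the lower bound must not exceed it.\<close>
  have compare: "\<forall>\<^sub>F l in sequentially. ?H l / real l \<le> ?H (j + 1) - ?H j + \<epsilon>" if \<epsilon>: "0 < \<epsilon>" for j \<epsilon>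
  proof -
    let ?a = "?H (j + 1) - ?H j + integral\<^sup>L \<mu> \<phi> - P + \<epsilon> / 2"
    obtain U where U: "openin (weak_star_topology T) U" "\<mu> \<in> U"
      "\<forall>\<^sub>F n in sequentially. deviation_prob m U n \<le> exp (real n * ?a)"
      using local_upper_bound[OF m \<phi> K(2) gibbs_upper Pr, of j ?a] \<epsilon> by auto
    have "0 < \<epsilon> / 2" using \<epsilon> by simp
    from local_lower_bound[OF \<mu> U(1,2) this] show ?thesis
    proof eventually_elim
      case (elim l)
      have "\<forall>\<^sub>F n in sequentially. ?H l / real l \<le> ?H (j + 1) - ?H j + \<epsilon>"
        using elim U(3) eventually_gt_at_top[of 0]
      proof eventually_elim
        case (elim n)
        then have "exp (real n * (?H l / real l + integral\<^sup>L \<mu> \<phi> - P - \<epsilon> / 2)) \<le> exp (real n * ?a)"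
          by (meson order_trans)
        then have "real n * (?H l / real l + integral\<^sup>L \<mu> \<phi> - P - \<epsilon> / 2) \<le> real n * ?a"
          by (simp only: exp_le_cancel_iff)
        then have "?H l / real l + integral\<^sup>L \<mu> \<phi> - P - \<epsilon> / 2 \<le> ?a"
          using elim(3) by (simp only: mult_le_cancel_left_pos of_nat_0_less_iff)
        then show ?case by linarith
      qed
      then show ?case by simp
    qed
  qed
  define d where "d = (INF j. ?H (j + 1) - ?H j)"
  have incr_nonneg: "0 \<le> ?H (j + 1) - ?H j" for j
  proof (rule field_le_epsilon)
    fix \<epsilon> :: real assume "0 < \<epsilon>"
    then obtain l where "?H l / real l \<le> ?H (j + 1) - ?H j + \<epsilon>"
      using compare eventually_happens'[OF sequentially_bot] by blast
    moreover have "0 \<le> ?H l / real l" using block_entropy_nonneg[OF Pr] by simp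
    ultimately show "0 \<le> ?H (j + 1) - ?H j + \<epsilon>" by linarith
  qed
  then have bdd: "bdd_below (range (\<lambda>j. ?H (j + 1) - ?H j))" by (intro bdd_belowI2)
  have d_le: "d \<le> ?H (j + 1) - ?H j" for j
    unfolding d_def by (rule cINF_lower[OF bdd]) simp
  have d_approx: "\<exists>j. ?H (j + 1) - ?H j < d + \<epsilon>" if "0 < \<epsilon>" for \<epsilon>
    using cINF_less_iff[OF _ bdd, of "d + \<epsilon>"] that by (auto simp: d_def)
  have "?H 0 = 0"
  proof -
    have "measure \<mu> (cylinder X w) = 1" if "w \<in> language_n A X 0" for w
    proof -
      have "cylinder X w = space \<mu>" using that prob_measuresD(3)[OF Pr]
        by (auto simp: language_n_def cylinder_def initial_word_def)
      then show ?thesis using prob_space by simp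
    qed
    then show ?thesis by (simp add: block_entropy_def)
  qed
  then have "l * d \<le> ?H l" for l :: nat
  proof (induction l)
    case (Suc l)
    then show ?case using d_le[of l] by (simp add: algebra_simps)
  qed simp
  then have lower: "d \<le> ?H l / real l" if "0 < l" for l
    using that by (simp add: field_simps)
  have "(\<lambda>l. ?H l / real l) \<longlonglongrightarrow> d"
  proof (rule order_tendstoI)
    fix y assume "y < d"
    show "\<forall>\<^sub>F l in sequentially. y < ?H l / real l"
      using eventually_gt_at_top[of 0]
    proof eventually_elim
      case (elim l)
      then show ?case using lower[OF elim] \<open>y < d\<close> by linarith
    qed
  next
    fix y assume y: "d < y"
    then obtain j where j: "?H (j + 1) - ?H j < d + (y - d) / 2" using d_approx[of "(y - d) / 2"] by auto
    have "0 < (y - d) / 2" using y by simp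
    from compare[OF this, of j] show "\<forall>\<^sub>F l in sequentially. ?H l / real l < y"
    proof eventually_elim
      case (elim l)
      then show ?case using j by (simp add: field_simps)
    qed
  qed
  then have "(\<lambda>l. 1 / real l * ?H l) \<longlonglongrightarrow> d" by simp
  then have ent: "entropy_of A X \<mu> = d" unfolding entropy_of_def block_entropy_def[symmetric] by (rule limI)
  show "entropy_of A X \<mu> \<le> ?H l / real l" if "0 < l" for l using lower[OF that] ent by simp
  show "\<exists>j. ?H (j + 1) - ?H j < entropy_of A X \<mu> + \<epsilon>" if "0 < \<epsilon>" for \<epsilon> using d_approx[OF that] ent by simp
qed

theorem level2_LDP_gibbs:
  "level2_LDP T \<sigma> m (\<lambda>\<mu>. if \<mu> \<in> invariant_measures T \<sigma>
      then ereal (entropy_of A X \<mu> + integral\<^sup>L \<mu> \<phi> - P) else -\<infinity>)" (is "level2_LDP T \<sigma> m ?q")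
proof (rule level2_LDP_from_local_bounds[OF compact_space_weak_star continuous_map_shift m])
  fix U \<mu> a
  assume U: "openin (weak_star_topology T) U" "\<mu> \<in> U" and a: "ereal a < ?q \<mu>"
  then have \<mu>: "\<mu> \<in> invariant_measures T \<sigma>" by (auto split: if_splits)
  define \<epsilon> where "\<epsilon> = entropy_of A X \<mu> + integral\<^sup>L \<mu> \<phi> - P - a"
  have \<epsilon>: "0 < \<epsilon>" using a \<mu> by (simp add: \<epsilon>_def)
  have "\<forall>\<^sub>F l in sequentially. 0 < l \<and> (\<forall>\<^sub>F n in sequentially.
    exp (real n * (block_entropy \<mu> l / real l + integral\<^sup>L \<mu> \<phi> - P - \<epsilon>)) \<le> deviation_prob m U n)"
    using local_lower_bound[OF \<mu> U \<epsilon>] eventually_gt_at_top[of 0] by (rule eventually_conj[rotated])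
  then obtain l where l: "0 < l" "\<forall>\<^sub>F n in sequentially.
    exp (real n * (block_entropy \<mu> l / real l + integral\<^sup>L \<mu> \<phi> - P - \<epsilon>)) \<le> deviation_prob m U n"
    using eventually_happens'[OF sequentially_bot] by blast
  have "a \<le> block_entropy \<mu> l / real l + integral\<^sup>L \<mu> \<phi> - P - \<epsilon>"
    using block_entropy_rate(1)[OF \<mu> l(1)] by (simp add: \<epsilon>_def)
  then have le: "exp (real n * a) \<le> exp (real n * (block_entropy \<mu> l / real l + integral\<^sup>L \<mu> \<phi> - P - \<epsilon>))" for n
    by (simp add: mult_left_mono)
  show "\<forall>\<^sub>F n in sequentially. exp (real n * a) \<le> deviation_prob m U n"
    using l(2) by (rule eventually_mono) (rule order_trans[OF le])
next
  fix \<mu> a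
  assume \<mu>: "\<mu> \<in> prob_measures T" and a: "?q \<mu> < ereal a"
  show "\<exists>U. openin (weak_star_topology T) U \<and> \<mu> \<in> U \<and>
    (\<forall>\<^sub>F n in sequentially. deviation_prob m U n \<le> exp (real n * a))"
  proof (cases "\<mu> \<in> invariant_measures T \<sigma>")
    case True
    then have "entropy_of A X \<mu> + integral\<^sup>L \<mu> \<phi> - P < a" using a by simp
    then obtain j where "block_entropy \<mu> (j + 1) - block_entropy \<mu> j <
        entropy_of A X \<mu> + (a - (entropy_of A X \<mu> + integral\<^sup>L \<mu> \<phi> - P))"
      using block_entropy_rate(2)[OF True, of "a - (entropy_of A X \<mu> + integral\<^sup>L \<mu> \<phi> - P)"] by auto
    then show ?thesis
      by (intro local_upper_bound[OF m \<phi> K(2) gibbs_upper \<mu>, of j]; linarith)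
  next
    case False
    obtain U where U: "openin (weak_star_topology T) U" "\<mu> \<in> U"
      "\<forall>\<^sub>F n in sequentially. deviation_prob m U n = 0"
      using local_upper_bound_noninvariant[OF \<mu> False] by blast
    have "\<forall>\<^sub>F n in sequentially. deviation_prob m U n \<le> exp (real n * a)"
      using U(3) by (rule eventually_mono) simp
    then show ?thesis using U by blast
  qed
qed

end

theorem theorem1:
  fixes I :: "int set" and A :: "'a set" and X :: "(int \<Rightarrow> 'a) set"
    and m :: "(int \<Rightarrow> 'a) measure" and \<phi> :: "(int \<Rightarrow> 'a) \<Rightarrow> real" and G :: "'a list set"
  assumes "I = {1..} \<or> I = UNIV"
    and "finite A"
    and "subshift I A X"
    and "m \<in> prob_measures (shift_topology I A X)"
    and "continuous_map (shift_topology I A X) euclideanreal \<phi>"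
    and "G \<subseteq> language A X"
    and "\<exists>\<tau>>0. \<forall>v\<in>G. \<forall>w\<in>G. \<exists>u\<in>language A X. length u \<le> \<tau> \<and> v @ u @ w \<in> G"
    and "edit_approachable A (language A X) G"
    and "gibbs I A X m \<phi> G"
  shows "level2_LDP (shift_topology I A X) (left_shift I) m (rate_function I A X \<phi>)"
proof -
  obtain \<tau> where "\<forall>v\<in>G. \<forall>w\<in>G. \<exists>u\<in>language A X. length u \<le> \<tau> \<and> v @ u @ w \<in> G"
    using assms(7) by blast
  then obtain c where c: "\<And>v w. v \<in> G \<Longrightarrow> w \<in> G \<Longrightarrow> v @ c v w @ w \<in> G \<and> length (c v w) \<le> \<tau>"
    by metis
  obtain g where g: "(\<lambda>n. real (g n) / real n) \<longlonglongrightarrow> 0"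
    "\<And>w. w \<in> language A X \<Longrightarrow> \<exists>v\<in>G. edit_dist A v w \<le> g (length w)"
    using assms(8) unfolding edit_approachable_def mistake_function_def by blast
  obtain K K' where K: "0 < K" "0 < K'"
    "\<And>x n. x \<in> X \<Longrightarrow> 1 \<le> n \<Longrightarrow> measure m (cylinder X (initial_word x n))
        \<le> K' * exp (- real n * pressure I A X \<phi> + birkhoff_sum I \<phi> n x)"
    "\<And>x n. x \<in> X \<Longrightarrow> 1 \<le> n \<Longrightarrow> initial_word x n \<in> G \<Longrightarrow>
        K * exp (- real n * pressure I A X \<phi> + birkhoff_sum I \<phi> n x) \<le> measure m (cylinder X (initial_word x n))"
    using assms(9) unfolding gibbs_def by blast
  interpret gibbs_shift I A X G c \<tau> g m \<phi> K K' "pressure I A X \<phi>"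
    by unfold_locales (fact assms c g K)+
  have "rate_function I A X \<phi> = (\<lambda>\<mu>. if \<mu> \<in> invariant_measures (shift_topology I A X) (left_shift I)
      then ereal (entropy_of A X \<mu> + integral\<^sup>L \<mu> \<phi> - pressure I A X \<phi>) else -\<infinity>)"
    by (simp add: rate_function_def fun_eq_iff)
  then show ?thesis using level2_LDP_gibbs by simp
qed

end
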